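(* Let $G$ be a bipartite graph, let $J \subseteq L(G)$ be a subgraph of its line graph, and let $M \subseteq V(J)$ be a matching in $G$. If $\operatorname{conn}(J) \leq \frac{|M|}{2} - 2$, then $J$ has a CP-decomposition with respect to $M$.
   Context: Graphs are finite and may have parallel edges. Two edges are parallel if they have the same endpoints (every edge is parallel to itself). A matching is a set of pairwise disjoint edges. Line graph: $L(G)$ is the simple graph whose vertex set is $E(G)$ (parallel edges being distinct vertices), with two distinct edges $e, f$ adjacent iff $e \cap f \neq \emptyset$. A subgraph $J\subseteq L(G)$ need not be induced or spanning; its vertices are edges of $G$. Let $J\subseteq L(G)$. Two edges of $G$ are $J$-adjacent if they are connected by an edge of $J$. An edge $e \in V(J)$ is at home in a subgraph $T \subseteq G$ if $T$ is a path on $4$ vertices, $e$ intersects $T$ in an interior vertex of $T$, and $e$ is $J$-adjacent to some edge of $T$. CP-decomposition: let $k\in\mathbb{N}$ (including $0$) and let $M \subseteq V(J)$ be a matching in $G$ of size $2k$. A CP-decomposition of $J$ with respect to $M$ is a set of $k$ vertex-disjoint subgraphs $S_1,\dots,S_s,T_1,\dots,T_t$ of $G$ (so $s+t=k$) such that: (1) each $S_i$ is isomorphic to $C_4$ (a cycle on $4$ vertices), contains two edges of $M$, and every two (distinct) intersecting edges of $S_i$ are $J$-adjacent; (2) each $T_j$ is isomorphic to $P_4$ (a path on $4$ vertices), contains two edges of $M$, and every two (distinct) intersecting edges of $T_j$ are $J$-adjacent; (3) every edge in $V(J)$ is equal to or parallel to an edge of some $S_i$, or is at home in some $T_j$. (A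 CP-decomposition with respect to $M$ exists only if $|M|$ is even, so the claim includes that $|M|$ is even.) Connectedness: for an integer $k\ge -1$, a space $X$ is $k$-connected if for every integer $-1\le j\le k$ every continuous map $S^j \to X$ extends to a continuous map $B^{j+1} \to X$ (with $S^{-1}=\emptyset$, so $(-1)$-connected means nonempty). $\operatorname{conn}(X)$ is the largest $k$ such that $X$ is $k$-connected; it is $-2$ if $X$ is empty and $+\infty$ if $X$ is $k$-connected for all $k$. For a graph $H$, $\operatorname{conn}(H)$ means $\operatorname{conn}$ of (the geometric realization of) the independence complex of $H$, i.e. the abstract simplicial complex on $V(H)$ whose simplices are the independent sets of $H$. *)

theory Defs
  imports "HOL-Analysis.Analysis"
begin

section \<open>Graphs\<close>

record ('v, 'e) mgraph =
  verts :: "'v set"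
  edges :: "'e set"
  ends  :: "'e \<Rightarrow> 'v set"

text \<open>Finite loopless graphs, possibly with parallel edges (bipartite graphs have no loops).
  Simple graphs are represented with edge type \<open>'v set\<close> and \<open>ends = id\<close>.\<close>

definition finite_graph :: "('v, 'e) mgraph \<Rightarrow> bool" where
  "finite_graph G \<longleftrightarrow> finite (verts G) \<and> finite (edges G) \<and>
     (\<forall>e\<in>edges G. ends G e \<subseteq> verts G \<and> card (ends G e) = 2)"

definition bipartite_graph :: "('v, 'e) mgraph \<Rightarrow> bool" where
  "bipartite_graph G \<longleftrightarrow> finite_graph G \<and>
     (\<exists>A B. A \<inter> B = {} \<and> A \<union> B = verts G \<and>
        (\<forall>e\<in>edges G. \<exists>a\<in>A. \<exists>b\<in>B. ends G e = {a, b}))"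

text \<open>A subgraph carries the same total incidence function as its host, so that it is determined
  by its vertex set and its edge set; it need be neither induced nor spanning.\<close>

definition subgraph :: "('v, 'e) mgraph \<Rightarrow> ('v, 'e) mgraph \<Rightarrow> bool" where
  "subgraph H G \<longleftrightarrow> verts H \<subseteq> verts G \<and> edges H \<subseteq> edges G \<and> ends H = ends G \<and>
     (\<forall>e\<in>edges H. ends H e \<subseteq> verts H)"

definition isomorphic_graphs :: "('v, 'e) mgraph \<Rightarrow> ('w, 'f) mgraph \<Rightarrow> bool" where
  "isomorphic_graphs G H \<longleftrightarrow> (\<exists>\<phi> \<psi>. bij_betw \<phi> (verts G) (verts H) \<and> bij_betw \<psi> (edges G) (edges H) \<and>
     (\<forall>e\<in>edges G. ends H (\<psi> e) = \<phi> ` ends G e))"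

definition cycle_graph :: "nat \<Rightarrow> (nat, nat set) mgraph" where
  "cycle_graph n = \<lparr>verts = {..<n}, edges = {{i, Suc i mod n} | i. i < n}, ends = id\<rparr>"

definition path_graph :: "nat \<Rightarrow> (nat, nat set) mgraph" where
  "path_graph n = \<lparr>verts = {..<n}, edges = {{i, Suc i} | i. Suc i < n}, ends = id\<rparr>"

definition matching :: "('v, 'e) mgraph \<Rightarrow> 'e set \<Rightarrow> bool" where
  "matching G M \<longleftrightarrow> M \<subseteq> edges G \<and> disjoint_family_on (ends G) M"

definition parallel_edges :: "('v, 'e) mgraph \<Rightarrow> 'e \<Rightarrow> 'e \<Rightarrow> bool" where
  "parallel_edges G e f \<longleftrightarrow> e \<in> edges G \<and> f \<in> edges G \<and> ends G e = ends G f"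

definition line_graph :: "('v, 'e) mgraph \<Rightarrow> ('e, 'e set) mgraph" where
  "line_graph G = \<lparr>verts = edges G,
     edges = {{e, f} | e f. e \<in> edges G \<and> f \<in> edges G \<and> e \<noteq> f \<and> ends G e \<inter> ends G f \<noteq> {}},
     ends = id\<rparr>"


section \<open>CP-decompositions\<close>

definition adjacent_in :: "('e, 'e set) mgraph \<Rightarrow> 'e \<Rightarrow> 'e \<Rightarrow> bool" where
  "adjacent_in J e f \<longleftrightarrow> {e, f} \<in> edges J"

definition intersecting_edges_adjacent ::
  "('v, 'e) mgraph \<Rightarrow> ('e, 'e set) mgraph \<Rightarrow> ('v, 'e) mgraph \<Rightarrow> bool" where
  "intersecting_edges_adjacent G J S \<longleftrightarrow>
     (\<forall>e\<in>edges S. \<forall>f\<in>edges S. e \<noteq> f \<and> ends G e \<inter> ends G f \<noteq> {} \<longrightarrow> adjacent_in J e f)"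

text \<open>For a path: its vertices of degree two.\<close>

definition interior_verts :: "('v, 'e) mgraph \<Rightarrow> 'v set" where
  "interior_verts T = {v \<in> verts T. card {e \<in> edges T. v \<in> ends T e} = 2}"

definition at_home ::
  "('v, 'e) mgraph \<Rightarrow> ('e, 'e set) mgraph \<Rightarrow> 'e \<Rightarrow> ('v, 'e) mgraph \<Rightarrow> bool" where
  "at_home G J e T \<longleftrightarrow> e \<in> verts J \<and> subgraph T G \<and> isomorphic_graphs T (path_graph 4) \<and>
     ends G e \<inter> interior_verts T \<noteq> {} \<and> (\<exists>f\<in>edges T. adjacent_in J e f)"

definition CP_decomposition ::
  "('v, 'e) mgraph \<Rightarrow> ('e, 'e set) mgraph \<Rightarrow> 'e set \<Rightarrow> nat \<Rightarrow>
   ('v, 'e) mgraph set \<Rightarrow> ('v, 'e) mgraph set \<Rightarrow> bool" where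
  "CP_decomposition G J M k \<S> \<T> \<longleftrightarrow>
     M \<subseteq> verts J \<and> matching G M \<and> card M = 2 * k \<and>
     finite (\<S> \<union> \<T>) \<and> card (\<S> \<union> \<T>) = k \<and>
     (\<forall>H\<in>\<S> \<union> \<T>. subgraph H G) \<and> disjoint_family_on verts (\<S> \<union> \<T>) \<and>
     (\<forall>S\<in>\<S>. isomorphic_graphs S (cycle_graph 4) \<and> card (edges S \<inter> M) = 2 \<and>
        intersecting_edges_adjacent G J S) \<and>
     (\<forall>T\<in>\<T>. isomorphic_graphs T (path_graph 4) \<and> card (edges T \<inter> M) = 2 \<and>
        intersecting_edges_adjacent G J T) \<and>
     (\<forall>e\<in>verts J. (\<exists>S\<in>\<S>. \<exists>f\<in>edges S. parallel_edges G e f) \<or> (\<exists>T\<in>\<T>. at_home G J e T))"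

definition has_CP_decomposition ::
  "('v, 'e) mgraph \<Rightarrow> ('e, 'e set) mgraph \<Rightarrow> 'e set \<Rightarrow> bool" where
  "has_CP_decomposition G J M \<longleftrightarrow> (\<exists>k \<S> \<T>. CP_decomposition G J M k \<S> \<T>)"


section \<open>Connectedness\<close>

text \<open>The sphere of dimension \<open>n - 1\<close> as the boundary of the \<open>n\<close>-dimensional ball; for \<open>n = 0\<close> these
  are the empty space and a point.\<close>

definition bdry_sphere :: "nat \<Rightarrow> (nat \<Rightarrow> real) topology" where
  "bdry_sphere n = subtopology (Euclidean_space n) {x. (\<Sum>i<n. x i ^ 2) = 1}"

definition unit_ball :: "nat \<Rightarrow> (nat \<Rightarrow> real) topology" where
  "unit_ball n = subtopology (Euclidean_space n) {x. (\<Sum>i<n. x i ^ 2) \<le> 1}"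

lemma bdry_sphere_0: "topspace (bdry_sphere 0) = {}"
  by (simp add: bdry_sphere_def)

lemma bdry_sphere_Suc: "bdry_sphere (Suc n) = nsphere n"
  by (simp add: bdry_sphere_def nsphere_def lessThan_Suc_atMost)

definition k_connected :: "int \<Rightarrow> 'a topology \<Rightarrow> bool" where
  "k_connected k X \<longleftrightarrow> (\<forall>j::int. - 1 \<le> j \<and> j \<le> k \<longrightarrow>
     (\<forall>f. continuous_map (bdry_sphere (nat (j + 1))) X f \<longrightarrow>
       (\<exists>g. continuous_map (unit_ball (nat (j + 1))) X g \<and>
            (\<forall>x\<in>topspace (bdry_sphere (nat (j + 1))). g x = f x))))"

definition conn :: "'a topology \<Rightarrow> ereal" where
  "conn X =
     (if topspace X = {} then - 2
      else if \<forall>k\<ge>- 1. k_connected k X then \<infinity>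
      else ereal (of_int (GREATEST k. - 1 \<le> k \<and> k_connected k X)))"

lemma k_connected_mono: "k_connected k X \<Longrightarrow> l \<le> k \<Longrightarrow> k_connected l X"
  by (auto simp: k_connected_def)

lemma k_connected_minus_1: "k_connected (- 1) X \<longleftrightarrow> topspace X \<noteq> {}"
proof
  assume conn: "k_connected (- 1) X"
  have "continuous_map (bdry_sphere (nat (- 1 + 1))) X (\<lambda>_. undefined)"
    using bdry_sphere_0 by simp
  then obtain g where "continuous_map (unit_ball 0) X g"
    using conn[unfolded k_connected_def, rule_format, of "- 1" "\<lambda>_. undefined"] by auto
  moreover have "(\<lambda>_. 0) \<in> topspace (unit_ball 0)"
    by (simp add: unit_ball_def topspace_Euclidean_space)
  ultimately show "topspace X \<noteq> {}"
    by (force simp: continuous_map_def Pi_iff)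
next
  assume "topspace X \<noteq> {}"
  then obtain c where "c \<in> topspace X" by blast
  show "k_connected (- 1) X"
    unfolding k_connected_def
  proof (intro allI impI)
    fix j :: int and f :: "(nat \<Rightarrow> real) \<Rightarrow> 'a"
    assume "- 1 \<le> j \<and> j \<le> - 1"
    then have "nat (j + 1) = 0" by simp
    moreover have "continuous_map (unit_ball 0) X (\<lambda>_. c)"
      using \<open>c \<in> topspace X\<close> by simp
    ultimately show "\<exists>g. continuous_map (unit_ball (nat (j + 1))) X g \<and>
        (\<forall>x\<in>topspace (bdry_sphere (nat (j + 1))). g x = f x)"
      by (intro exI[of _ "\<lambda>_. c"]) (simp only: bdry_sphere_0 ball_simps simp_thms)
  qed
qed

text \<open>In particular the maximum in the definition of \<open>conn\<close> exists.\<close>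

lemma le_conn_iff:
  assumes "- 1 \<le> k"
  shows "ereal (of_int k) \<le> conn X \<longleftrightarrow> k_connected k X"
proof -
  consider "topspace X = {}" | "topspace X \<noteq> {}" "\<forall>k\<ge>- 1. k_connected k X"
    | l where "topspace X \<noteq> {}" "- 1 \<le> l" "\<not> k_connected l X"
    by metis
  then show ?thesis
  proof cases
    case 1
    then have "\<not> k_connected k X"
      using k_connected_minus_1 k_connected_mono assms by blast
    moreover have "(- 2 :: ereal) = ereal (- 2)" by simp
    ultimately show ?thesis
      using 1 assms by (simp add: conn_def)
  next
    case 2
    then show ?thesis using assms by (simp add: conn_def)
  next
    case 3
    let ?P = "\<lambda>i. - 1 \<le> i \<and> k_connected i X"
    let ?m = "GREATEST i. ?P i"
    let ?A = "{i. ?P i}"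
    have "?A \<subseteq> {- 1..l}"
    proof
      fix i assume "i \<in> ?A"
      moreover from this have "\<not> l \<le> i"
        using 3 k_connected_mono[of i X l] by blast
      ultimately show "i \<in> {- 1..l}" by simp
    qed
    then have fin: "finite ?A"
      using finite_subset by blast
    have "- 1 \<in> ?A"
      using 3 k_connected_minus_1 by auto
    then have "Max ?A \<in> ?A"
      using fin Max_in by blast
    then have max: "?P (Max ?A)" by blast
    moreover have upper: "i \<le> Max ?A" if "?P i" for i
      using fin that by (intro Max_ge) simp_all
    ultimately have "?m = Max ?A"
      by (rule Greatest_equality)
    then have "k \<le> ?m \<longleftrightarrow> k_connected k X"
      using assms max upper[of k] k_connected_mono[of "Max ?A" X k] by metis
    moreover have "conn X = ereal (of_int ?m)"
      using 3 unfolding conn_def by metis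
    ultimately show ?thesis by simp
  qed
qed

definition independence_complex :: "('v, 'e) mgraph \<Rightarrow> 'v set set" where
  "independence_complex H = {I. I \<subseteq> verts H \<and> (\<forall>e\<in>edges H. \<not> ends H e \<subseteq> I)}"

text \<open>Points are given by their barycentric coordinates, extended by zero. For finite complexes the
  product topology is the usual topology of the geometric realization.\<close>

definition geometric_realization :: "'a set set \<Rightarrow> ('a \<Rightarrow> real) topology" where
  "geometric_realization K = subtopology (powertop_real UNIV)
     {x. (\<forall>v. 0 \<le> x v) \<and> finite {v. x v \<noteq> 0} \<and> {v. x v \<noteq> 0} \<in> K \<and> (\<Sum>v | x v \<noteq> 0. x v) = 1}"

definition graph_conn :: "('v, 'e) mgraph \<Rightarrow> ereal" where
  "graph_conn H = conn (geometric_realization (independence_complex H))"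

end

theory Submission
  imports Defs
begin

text \<open>
  The proof is an induction on the size of \<open>J\<close> that is driven by Meshulam's theorem: for an edge \<open>ab\<close>
  of \<open>J\<close>, the independence complex of \<open>J\<close> is \<open>k\<close>-connected if that of \<open>J\<close> without this edge is
  \<open>k\<close>-connected and that of \<open>J\<close> after its explosion (the removal of \<open>a\<close>, \<open>b\<close> and all their neighbours)
  is \<open>(k - 1)\<close>-connected. If the complex of \<open>J\<close> has low connectedness, then so has the complex after
  a deletion, or the complex after an explosion has a connectedness lower by one.

  Meshulam's theorem (\<open>meshulam\<close>) is proved without homology or homotopy groups. Let \<open>U\<close> be the
  realization of the larger complex without the midpoint of the edge \<open>ab\<close>, and \<open>W\<close> the open star of
  this edge. Then \<open>U\<close> retracts to the smaller complex, and \<open>U \<inter> W\<close> is a suspension of the link.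
  Two facts about relatively open sets finish the argument: if \<open>U \<union> W\<close> and \<open>U \<inter> W\<close> are
  \<open>k\<close>-connected, so is \<open>U\<close> (\<open>fills_upto_open_part\<close>); and if \<open>U\<close> and \<open>W\<close> are \<open>k\<close>-connected and
  \<open>U \<inter> W\<close> is \<open>(k - 1)\<close>-connected, then \<open>U \<union> W\<close> is \<open>k\<close>-connected (\<open>fills_upto_Un\<close>). Both follow from
  subdividing a cube finely and extending maps cell by cell (\<open>extend_over_complex\<close>).

  In the induction a deletable edge is harmless, because a decomposition survives the addition of
  edges to \<open>J\<close>. So suppose that every edge is explodable and that \<open>J\<close> has no decomposition. An edge
  \<open>d\<close> that is adjacent to a matching edge turns out to be adjacent to exactly two of them, one at each
  end (\<open>neighbour_is_arc\<close>). Directed from the second side of the bipartition to the first, these edges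
  define a digraph on the matching, in which a path of a decomposition is an arc and a 4-cycle is a
  2-cycle. Exploding an arc at its tail leaves a decomposition \<open>D\<close> with respect to the other matching
  edges, and since \<open>D\<close> covers the surviving edges, each arc between other matching edges leads from
  the tail or to the head of a path of \<open>D\<close> or lies on a 4-cycle of \<open>D\<close> (\<open>surviving_arc\<close>). On the other hand \<open>D\<close> cannot
  be completed to a decomposition of \<open>J\<close>, so the tail of the exploded arc has a predecessor that is
  not a tail in \<open>D\<close> (\<open>obstructing_arc\<close>).

  These two facts determine the digraph at its sources. A source component consists of two edges
  \<open>p\<close> and \<open>q\<close>, since it contains an arc from which everything but its tail can be reached and so would
  otherwise consist of heads without tails to precede them (\<open>source_two_cycle\<close>). No arc leaves it, for such
  an arc could not be obstructed (\<open>source_two_cycle_closed\<close>). So \<open>p\<close> and \<open>q\<close> span a 4-cycle that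
  completes a decomposition of the rest, a contradiction (\<open>no_minimal_counterexample\<close>).
\<close>

section \<open>Extending maps over balls and cubes\<close>

definition extendable :: "'a::topological_space set \<Rightarrow> 'a set \<Rightarrow> 'b::topological_space set \<Rightarrow> bool" where
  "extendable B A S \<longleftrightarrow> (\<forall>f. continuous_on A f \<and> f \<in> A \<rightarrow> S \<longrightarrow>
     (\<exists>g. continuous_on B g \<and> g \<in> B \<rightarrow> S \<and> (\<forall>x\<in>A. g x = f x)))"

lemma extendableI:
  assumes "\<And>f. continuous_on A f \<Longrightarrow> f \<in> A \<rightarrow> S \<Longrightarrow>
    \<exists>g. continuous_on B g \<and> g \<in> B \<rightarrow> S \<and> (\<forall>x\<in>A. g x = f x)"
  shows "extendable B A S"
  using assms by (auto simp: extendable_def)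

lemma extendableE:
  assumes "extendable B A S" "continuous_on A f" "f \<in> A \<rightarrow> S"
  obtains g where "continuous_on B g" "g \<in> B \<rightarrow> S" "\<And>x. x \<in> A \<Longrightarrow> g x = f x"
proof -
  have "\<exists>g. continuous_on B g \<and> g \<in> B \<rightarrow> S \<and> (\<forall>x\<in>A. g x = f x)"
    using assms(1) unfolding extendable_def by (rule allE[of _ f]) (simp add: assms(2,3))
  then show ?thesis using that by (elim exE conjE) simp
qed

text \<open>The pair \<open>(B, A)\<close> need not be homeomorphic to \<open>(B', A')\<close>: a map of pairs \<open>\<Psi>\<close> that has the
  left inverse \<open>\<Phi>\<close> on \<open>A\<close> suffices, since \<open>f \<circ> \<Phi>\<close> can be extended over \<open>B'\<close> and pulled back.\<close>

lemma extendable_transport: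
  assumes ext: "extendable B' A' S"
    and "continuous_on A' \<Phi>" "\<Phi> \<in> A' \<rightarrow> A"
    and "continuous_on B \<Psi>" "\<Psi> \<in> B \<rightarrow> B'" "\<Psi> \<in> A \<rightarrow> A'"
    and inv: "\<And>x. x \<in> A \<Longrightarrow> \<Phi> (\<Psi> x) = x"
  shows "extendable B A S"
proof (rule extendableI)
  fix f assume f: "continuous_on A f" "f \<in> A \<rightarrow> S"
  have "continuous_on A' (f \<circ> \<Phi>)"
    using assms f by (intro continuous_on_compose) (auto intro: continuous_on_subset)
  moreover have "f \<circ> \<Phi> \<in> A' \<rightarrow> S" using assms f by auto
  ultimately obtain g where g: "continuous_on B' g" "g \<in> B' \<rightarrow> S" "\<And>x. x \<in> A' \<Longrightarrow> g x = (f \<circ> \<Phi>) x"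
    by (rule extendableE[OF ext]) blast
  have "continuous_on B (g \<circ> \<Psi>)"
    using assms g by (intro continuous_on_compose) (auto intro: continuous_on_subset)
  moreover have "g \<circ> \<Psi> \<in> B \<rightarrow> S" using assms g by auto
  moreover have "\<forall>x\<in>A. (g \<circ> \<Psi>) x = f x"
    using assms(6) inv g(3) by (auto simp: Pi_iff)
  ultimately show "\<exists>g. continuous_on B g \<and> g \<in> B \<rightarrow> S \<and> (\<forall>x\<in>A. g x = f x)" by blast
qed

lemma continuous_on_paste_le:
  fixes h :: "'a::topological_space \<Rightarrow> real"
  assumes "continuous_on B h"
    and "continuous_on {x\<in>B. h x \<le> c} f" "continuous_on {x\<in>B. c \<le> h x} g"
    and "\<And>x. x \<in> B \<Longrightarrow> h x = c \<Longrightarrow> f x = g x"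
  shows "continuous_on B (\<lambda>x. if h x \<le> c then f x else g x)"
  by (rule continuous_on_cases_le) (use assms in auto)

text \<open>The \<open>n\<close>-dimensional space of the first \<open>n\<close> coordinates lives inside \<open>nat \<Rightarrow> real\<close>, because the
  dimension of the spheres to be filled depends on the size of the matching and hence cannot be a type.\<close>

definition coord_space :: "nat \<Rightarrow> (nat \<Rightarrow> real) set" where
  "coord_space n = {x. \<forall>i\<ge>n. x i = 0}"

definition scale :: "real \<Rightarrow> ('a \<Rightarrow> real) \<Rightarrow> 'a \<Rightarrow> real" where
  "scale c x = (\<lambda>i. c * x i)"

lemma scale_scale [simp]: "scale a (scale b x) = scale (a * b) x"
  by (simp add: scale_def mult.assoc)

lemma scale_1 [simp]: "scale 1 x = x"
  by (simp add: scale_def)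

lemma scale_in_coord_space [simp]: "x \<in> coord_space n \<Longrightarrow> scale c x \<in> coord_space n"
  by (simp add: coord_space_def scale_def)

lemma continuous_on_coord [continuous_intros]: "continuous_on A (\<lambda>x::'i \<Rightarrow> real. x i)"
  by (rule continuous_on_product_then_coordinatewise) (rule continuous_on_id)

lemma continuous_on_scale [continuous_intros]:
  "continuous_on A a \<Longrightarrow> continuous_on A f \<Longrightarrow> continuous_on A (\<lambda>x. scale (a x) (f x))"
  unfolding scale_def
  by (intro continuous_on_coordinatewise_then_product continuous_on_mult)
     (auto intro: continuous_on_product_then_coordinatewise)

definition norm_on :: "nat \<Rightarrow> ((nat \<Rightarrow> real) \<Rightarrow> real) \<Rightarrow> bool" where
  "norm_on n N \<longleftrightarrow> continuous_on UNIV N \<and> (\<forall>x. 0 \<le> N x) \<and> (\<forall>c\<ge>0. \<forall>x. N (scale c x) = c * N x)"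

text \<open>Unit balls of equivalent norms have the same extension property. Radial projection carries a map
  on the second unit sphere to the first one. The extension over the first ball is then shrunk so
  that it fits inside the second ball, and between the shrunken ball and the second sphere the map is
  kept constant along rays. In this way continuity at the origin is never at stake.\<close>

lemma extendable_change_norm:
  assumes N1: "norm_on n N1" and N2: "norm_on n N2"
    and le12: "\<And>x. x \<in> coord_space n \<Longrightarrow> N1 x \<le> C * N2 x"
    and le21: "\<And>x. x \<in> coord_space n \<Longrightarrow> N2 x \<le> C * N1 x" and "C \<ge> 0"
    and ext: "extendable {x\<in>coord_space n. N1 x \<le> 1} {x\<in>coord_space n. N1 x = 1} S"
  shows "extendable {x\<in>coord_space n. N2 x \<le> 1} {x\<in>coord_space n. N2 x = 1} S"
proof (rule extendableI)
  let ?V = "coord_space n"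
  let ?S1 = "{x\<in>?V. N1 x = 1}" and ?B1 = "{x\<in>?V. N1 x \<le> 1}"
  let ?S2 = "{x\<in>?V. N2 x = 1}" and ?B2 = "{x\<in>?V. N2 x \<le> 1}"
  fix f assume f: "continuous_on ?S2 f" "f \<in> ?S2 \<rightarrow> S"
  have c1: "continuous_on X N1" and c2: "continuous_on X N2" for X
    using N1 N2 by (auto simp: norm_on_def intro: continuous_on_subset)
  have h1: "N1 (scale c x) = c * N1 x" and h2: "N2 (scale c x) = c * N2 x" if "c \<ge> 0" for c x
    using N1 N2 that by (auto simp: norm_on_def)
  have nn1: "N1 x \<ge> 0" and nn2: "N2 x \<ge> 0" for x
    using N1 N2 by (auto simp: norm_on_def)
  have pos: "N2 x > 0" if "x \<in> ?V" "N1 x > 0" for x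
    using le12[OF that(1)] that nn2[of x] by (cases "N2 x = 0") auto
  define \<phi> where "\<phi> = (\<lambda>x. scale (1 / N2 x) x)"
  have \<phi>c: "continuous_on X \<phi>" if "X \<subseteq> ?V" "\<And>x. x \<in> X \<Longrightarrow> N1 x > 0" for X
    unfolding \<phi>_def using that pos
    by (intro continuous_intros c2 continuous_on_id) fastforce
  have \<phi>im: "\<phi> x \<in> ?S2" if "x \<in> ?V" "N1 x > 0" for x
    using that pos[OF that] by (simp add: \<phi>_def h2)
  have "continuous_on ?S1 (f \<circ> \<phi>)"
    by (intro continuous_on_compose \<phi>c continuous_on_subset[OF f(1)]) (use \<phi>im in auto)
  moreover have "f \<circ> \<phi> \<in> ?S1 \<rightarrow> S" using \<phi>im f by fastforce
  ultimately obtain g where g: "continuous_on ?B1 g" "g \<in> ?B1 \<rightarrow> S" "\<And>x. x \<in> ?S1 \<Longrightarrow> g x = (f \<circ> \<phi>) x"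
    by (rule extendableE[OF ext]) blast
  define D where "D = C + 1"
  have D: "D > 0" "D > C" using \<open>C \<ge> 0\<close> by (auto simp: D_def)
  define G where "G = (\<lambda>x. if D * N1 x \<le> 1 then g (scale D x) else f (\<phi> x))"
  have "continuous_on ?B2 G"
    unfolding G_def
  proof (rule continuous_on_paste_le)
    show "continuous_on ?B2 (\<lambda>x. D * N1 x)" by (intro continuous_intros c1)
    show "continuous_on {x \<in> ?B2. D * N1 x \<le> 1} (\<lambda>x. g (scale D x))"
      by (rule continuous_on_compose2[OF g(1)]) (use D in \<open>auto intro!: continuous_on_scale continuous_on_id continuous_on_const simp: h1\<close>)
    have p: "N1 x > 0" if "1 \<le> D * N1 x" for x
      using that nn1[of x] by (cases "N1 x = 0") auto
    show "continuous_on {x \<in> ?B2. 1 \<le> D * N1 x} (\<lambda>x. f (\<phi> x))"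
      by (rule continuous_on_compose2[OF f(1) \<phi>c]) (use \<phi>im p in auto)
    fix x assume x: "x \<in> ?B2" "D * N1 x = 1"
    then have "scale D x \<in> ?S1" using D by (auto simp: h1)
    then show "g (scale D x) = f (\<phi> x)"
      using D by (simp add: g(3) \<phi>_def h2)
  qed
  moreover have "G \<in> ?B2 \<rightarrow> S"
  proof
    fix x assume x: "x \<in> ?B2"
    show "G x \<in> S"
    proof (cases "D * N1 x \<le> 1")
      case True
      then have "scale D x \<in> ?B1" using D x by (auto simp: h1)
      then show ?thesis using True g by (auto simp: G_def)
    next
      case False
      then have "N1 x > 0" using nn1[of x] by (cases "N1 x = 0") auto
      then have "\<phi> x \<in> ?S2" using \<phi>im x by blast
      then have "f (\<phi> x) \<in> S" using f(2) by blast
      then show ?thesis using False by (simp add: G_def)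
    qed
  qed
  moreover have "\<forall>x\<in>?S2. G x = f x"
  proof
    fix x assume x: "x \<in> ?S2"
    then have 1: "1 \<le> C * N1 x" using le21[of x] by auto
    then have "N1 x > 0" using nn1[of x] by (cases "N1 x = 0") auto
    then have "C * N1 x < D * N1 x" using D by simp
    then have "\<not> D * N1 x \<le> 1" using 1 by linarith
    then show "G x = f x" using x by (simp add: G_def \<phi>_def)
  qed
  ultimately show "\<exists>g. continuous_on ?B2 g \<and> g \<in> ?B2 \<rightarrow> S \<and> (\<forall>x\<in>?S2. g x = f x)" by blast
qed

definition max_norm :: "nat \<Rightarrow> (nat \<Rightarrow> real) \<Rightarrow> real" where
  "max_norm n x = Max (insert 0 ((\<lambda>i. \<bar>x i\<bar>) ` {..<n}))"

definition eucl_norm :: "nat \<Rightarrow> (nat \<Rightarrow> real) \<Rightarrow> real" where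
  "eucl_norm n x = sqrt (\<Sum>i<n. (x i)\<^sup>2)"

lemma max_norm_Suc: "max_norm (Suc n) x = max \<bar>x n\<bar> (max_norm n x)"
  unfolding max_norm_def lessThan_Suc image_insert
  by (subst insert_commute) (simp add: Max_insert)

lemma max_norm_0: "max_norm 0 x = 0"
  by (simp add: max_norm_def)

lemma max_norm_le_iff: "0 \<le> c \<Longrightarrow> max_norm n x \<le> c \<longleftrightarrow> (\<forall>i<n. \<bar>x i\<bar> \<le> c)"
  by (induction n) (auto simp: max_norm_0 max_norm_Suc less_Suc_eq)

lemma max_norm_nonneg: "0 \<le> max_norm n x"
  by (induction n) (auto simp: max_norm_0 max_norm_Suc)

lemma max_norm_attained: "0 < max_norm n x \<Longrightarrow> \<exists>i<n. \<bar>x i\<bar> = max_norm n x"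
  by (induction n) (auto simp: max_norm_0 max_norm_Suc less_Suc_eq max_def)

lemma abs_le_max_norm: "i < n \<Longrightarrow> \<bar>x i\<bar> \<le> max_norm n x"
  using max_norm_le_iff[OF max_norm_nonneg, of n x n x] by auto

lemma norm_on_max_norm: "norm_on n (max_norm n)"
proof -
  have "continuous_on UNIV (max_norm n)"
  proof (induction n)
    case 0
    then show ?case by (simp add: max_norm_0[abs_def] )
  next
    case (Suc n)
    then show ?case
      unfolding max_norm_Suc[abs_def] by (intro continuous_intros) auto
  qed
  moreover have "max_norm n (scale c x) = c * max_norm n x" if "c \<ge> 0" for c x
    using that by (induction n) (auto simp: max_norm_0 max_norm_Suc scale_def abs_mult max_mult_distrib_left)
  ultimately show ?thesis by (simp add: norm_on_def max_norm_nonneg)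
qed

lemma norm_on_eucl_norm: "norm_on n (eucl_norm n)"
  unfolding norm_on_def
proof (intro conjI allI impI)
  show "continuous_on UNIV (eucl_norm n)"
    unfolding eucl_norm_def by (intro continuous_intros)
  show "0 \<le> eucl_norm n x" for x by (simp add: eucl_norm_def sum_nonneg)
  show "eucl_norm n (scale c x) = c * eucl_norm n x" if "0 \<le> c" for c x
    using that by (simp add: eucl_norm_def scale_def power_mult_distrib real_sqrt_mult flip: sum_distrib_left)
qed

lemma max_norm_le_eucl_norm: "max_norm n x \<le> eucl_norm n x"
proof -
  have "\<bar>x i\<bar> \<le> eucl_norm n x" if "i < n" for i
  proof -
    have "(x i)\<^sup>2 \<le> (\<Sum>i<n. (x i)\<^sup>2)"
      using that by (intro member_le_sum) auto
    then have "sqrt ((x i)\<^sup>2) \<le> eucl_norm n x"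
      unfolding eucl_norm_def by (rule real_sqrt_le_mono)
    then show ?thesis by simp
  qed
  moreover have "0 \<le> eucl_norm n x" by (simp add: eucl_norm_def sum_nonneg)
  ultimately show ?thesis by (simp add: max_norm_le_iff)
qed

lemma eucl_norm_le_max_norm: "eucl_norm n x \<le> real n * max_norm n x"
proof -
  have "eucl_norm n x \<le> (\<Sum>i<n. \<bar>x i\<bar>)"
    unfolding eucl_norm_def
    using L2_set_le_sum_abs[of x "{..<n}"] by (simp add: L2_set_def)
  also have "\<dots> \<le> (\<Sum>i<n. max_norm n x)"
    by (intro sum_mono abs_le_max_norm) auto
  finally show ?thesis by simp
qed

definition cube :: "nat \<Rightarrow> (nat \<Rightarrow> real) set" where
  "cube n = {x\<in>coord_space n. max_norm n x \<le> 1}"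

definition cube_boundary :: "nat \<Rightarrow> (nat \<Rightarrow> real) set" where
  "cube_boundary n = {x\<in>coord_space n. max_norm n x = 1}"

text \<open>Connectedness is shifted by one in this parameter: \<open>fills_upto n\<close> is \<open>(n - 1)\<close>-connectedness, and
  \<open>n\<close> bounds the dimension of the cubes that can be filled.\<close>

definition fills_upto :: "nat \<Rightarrow> 'a::topological_space set \<Rightarrow> bool" where
  "fills_upto n S \<longleftrightarrow> (\<forall>m\<le>n. extendable (cube m) (cube_boundary m) S)"

lemma extendable_cube_iff_ball:
  "extendable (cube n) (cube_boundary n) S \<longleftrightarrow>
   extendable {x\<in>coord_space n. eucl_norm n x \<le> 1} {x\<in>coord_space n. eucl_norm n x = 1} S"
proof -
  have 1: "eucl_norm n x \<le> (real n + 1) * max_norm n x" for x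
    using eucl_norm_le_max_norm[of n x] max_norm_nonneg[of n x] by (simp add: algebra_simps)
  have "eucl_norm n x \<le> (real n + 1) * eucl_norm n x" for x
    by (simp add: algebra_simps eucl_norm_def sum_nonneg)
  then have 2: "max_norm n x \<le> (real n + 1) * eucl_norm n x" for x
    using max_norm_le_eucl_norm[of n x] by (meson order_trans)
  show ?thesis
    unfolding cube_def cube_boundary_def
    using extendable_change_norm[OF norm_on_max_norm norm_on_eucl_norm 2 1]
      extendable_change_norm[OF norm_on_eucl_norm norm_on_max_norm 1 2] by auto
qed

lemma k_connected_iff_fills_upto:
  fixes S :: "('a \<Rightarrow> real) set"
  assumes "- 1 \<le> k"
  shows "k_connected k (subtopology (powertop_real UNIV) S) \<longleftrightarrow> fills_upto (nat (k + 1)) S"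
proof -
  have sph: "bdry_sphere n = top_of_set {x\<in>coord_space n. eucl_norm n x = 1}" for n
    by (simp add: bdry_sphere_def Euclidean_space_def euclidean_product_topology subtopology_subtopology
        coord_space_def eucl_norm_def Int_def)
  have ball: "unit_ball n = top_of_set {x\<in>coord_space n. eucl_norm n x \<le> 1}" for n
    by (simp add: unit_ball_def Euclidean_space_def euclidean_product_topology subtopology_subtopology
        coord_space_def eucl_norm_def Int_def)
  have *: "(\<forall>f. continuous_map (bdry_sphere n) (top_of_set S) f \<longrightarrow>
      (\<exists>g. continuous_map (unit_ball n) (top_of_set S) g \<and> (\<forall>x\<in>topspace (bdry_sphere n). g x = f x)))
    \<longleftrightarrow> extendable (cube n) (cube_boundary n) S" for n
    unfolding sph ball extendable_cube_iff_ball
    unfolding extendable_def continuous_map_in_subtopology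
      continuous_map_iff_continuous topspace_euclidean_subtopology
    by (simp only: image_subset_iff_funcset conj_assoc)
  have "k_connected k (subtopology (powertop_real UNIV) S) \<longleftrightarrow>
    (\<forall>j::int. - 1 \<le> j \<and> j \<le> k \<longrightarrow>
      extendable (cube (nat (j + 1))) (cube_boundary (nat (j + 1))) S)"
    unfolding k_connected_def euclidean_product_topology * ..
  also have "\<dots> \<longleftrightarrow> fills_upto (nat (k + 1)) S"
    unfolding fills_upto_def
  proof (intro iffI allI impI)
    fix m assume "\<forall>j::int. - 1 \<le> j \<and> j \<le> k \<longrightarrow>
      extendable (cube (nat (j + 1))) (cube_boundary (nat (j + 1))) S" "m \<le> nat (k + 1)"
    then show "extendable (cube m) (cube_boundary m) S"
      using assms by (auto dest!: spec[of _ "int m - 1"])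
  qed auto
  finally show ?thesis .
qed

section \<open>Cubical cells\<close>

definition odds :: "(nat \<Rightarrow> int) \<Rightarrow> nat set" where
  "odds c = {i. odd (c i)}"

text \<open>The cells of the cubical subdivision of \<open>nat \<Rightarrow> real\<close> by the integer points, encoded by the doubled
  coordinates of their centers: an even number \<open>2 m\<close> stands for the point \<open>m\<close>, an odd number \<open>2 m + 1\<close>
  for the interval \<open>[m, m + 1]\<close>. The dimension of a cell is the number of its odd entries.\<close>

definition cell :: "(nat \<Rightarrow> int) \<Rightarrow> (nat \<Rightarrow> real) set" where
  "cell c = {x. \<forall>i. \<bar>2 * x i - of_int (c i)\<bar> \<le> (if odd (c i) then 1 else 0)}"

definition face :: "(nat \<Rightarrow> int) \<Rightarrow> (nat \<Rightarrow> int) \<Rightarrow> bool" where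
  "face d c \<longleftrightarrow> (\<forall>i. \<bar>d i - c i\<bar> \<le> (if odd (c i) then 1 else 0))"

text \<open>The unique cell that has \<open>x\<close> in its relative interior: \<open>\<lfloor>t\<rfloor> + \<lceil>t\<rceil>\<close> is \<open>2 t\<close> for an integer \<open>t\<close> and
  the odd number \<open>2 \<lfloor>t\<rfloor> + 1\<close> otherwise.\<close>

definition carrier_cell :: "(nat \<Rightarrow> real) \<Rightarrow> nat \<Rightarrow> int" where
  "carrier_cell x i = \<lfloor>x i\<rfloor> + \<lceil>x i\<rceil>"

lemma face_refl [simp]: "face c c"
  by (simp add: face_def)

lemma face_trans: "face d e \<Longrightarrow> face e c \<Longrightarrow> face d c"
  unfolding face_def
proof
  fix i
  assume *: "\<forall>i. \<bar>d i - e i\<bar> \<le> (if odd (e i) then 1 else 0)" "\<forall>i. \<bar>e i - c i\<bar> \<le> (if odd (c i) then 1 else 0)"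
  show "\<bar>d i - c i\<bar> \<le> (if odd (c i) then 1 else 0)"
  proof (cases "e i = c i")
    case True
    then show ?thesis using *(1)[rule_format, of i] by simp
  next
    case False
    then have c: "odd (c i)" "\<bar>e i - c i\<bar> = 1" using *(2)[rule_format, of i] by (auto split: if_splits)
    then have "e i = c i + 1 \<or> e i = c i - 1" by linarith
    then have "even (e i)" using c(1) by auto
    then show ?thesis using c *(1)[rule_format, of i] by auto
  qed
qed

lemma face_eq_or_even:
  assumes "face d c"
  shows "d i = c i \<or> odd (c i) \<and> even (d i)"
proof (cases "d i = c i")
  case False
  moreover have "\<bar>d i - c i\<bar> \<le> (if odd (c i) then 1 else 0)" using assms by (simp add: face_def)
  ultimately have "odd (c i)" "d i = c i + 1 \<or> d i = c i - 1" by (auto split: if_splits)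
  then show ?thesis by auto
qed simp

lemma odds_face_psubset:
  assumes "face d c" "d \<noteq> c"
  shows "odds d \<subset> odds c"
proof -
  obtain i where "d i \<noteq> c i" using assms by auto
  moreover have "odd (c j)" if "odd (d j)" for j
    using face_eq_or_even[OF assms(1), of j] that by auto
  ultimately show ?thesis using face_eq_or_even[OF assms(1), of i] unfolding odds_def by auto
qed

text \<open>The coordinatewise reason for the next lemma, by which the incidences between points and cells
  reduce to the face relation, that is, to integer arithmetic.\<close>

lemma carrier_coord_iff:
  "\<bar>2 * t - of_int k\<bar> \<le> (if odd k then 1 else 0) \<longleftrightarrow>
   \<bar>\<lfloor>t\<rfloor> + \<lceil>t\<rceil> - k\<bar> \<le> (if odd k then 1 else 0)" for t :: real
proof (cases "t \<in> \<int>")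
  case True
  then obtain m where "t = of_int m" by (auto elim: Ints_cases)
  then show ?thesis by (auto simp: abs_le_iff; linarith)
next
  case False
  then have ceil: "\<lceil>t\<rceil> = \<lfloor>t\<rfloor> + 1" by (simp add: ceiling_altdef Ints_def) (metis rangeI)
  define m where "m = \<lfloor>t\<rfloor>"
  have m: "of_int m < t" "t < of_int m + 1"
    using False unfolding m_def by (auto simp: less_le) (metis Ints_1 Ints_add Ints_of_int)+
  show ?thesis
  proof (cases "even k")
    case True
    then obtain j where j: "k = 2 * j" by blast
    have "t \<noteq> of_int j" using False by auto
    then show ?thesis using True j ceil by (auto simp flip: m_def) presburger
  next
    case odd: False
    then obtain j where j: "k = 2 * j + 1" by (blast elim: oddE)
    have "\<bar>2 * t - of_int k\<bar> \<le> 1 \<longleftrightarrow> of_int j \<le> t \<and> t \<le> of_int j + 1"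
      using j by auto
    also have "\<dots> \<longleftrightarrow> j \<le> m \<and> m \<le> j"
    proof -
      have "of_int j \<le> t \<longleftrightarrow> j \<le> m" by (simp add: m_def le_floor_iff)
      moreover have "t \<le> of_int j + 1 \<longleftrightarrow> m \<le> j"
        using m False by (simp add: m_def) (smt (verit) Ints_1 Ints_add Ints_of_int floor_le_iff of_int_1 of_int_add)
      ultimately show ?thesis by simp
    qed
    also have "\<dots> \<longleftrightarrow> \<bar>\<lfloor>t\<rfloor> + \<lceil>t\<rceil> - k\<bar> \<le> 1"
      using ceil j by (auto simp flip: m_def)
    finally show ?thesis using odd by simp
  qed
qed

lemma mem_cell_iff: "x \<in> cell c \<longleftrightarrow> face (carrier_cell x) c"
  by (simp add: cell_def face_def carrier_cell_def carrier_coord_iff)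

lemma mem_carrier_cell: "x \<in> cell (carrier_cell x)"
  by (simp add: mem_cell_iff)

lemma cell_mono: "face d c \<Longrightarrow> cell d \<subseteq> cell c"
  by (auto simp: mem_cell_iff intro: face_trans)

lemma closed_cell: "closed (cell c)"
proof -
  have "cell c = (\<Inter>i. {x. \<bar>2 * x i - of_int (c i)\<bar> \<le> (if odd (c i) then 1 else 0)})"
    unfolding cell_def by (simp only: Collect_all_eq)
  also have "closed \<dots>"
    by (intro closed_INT ballI closed_Collect_le continuous_intros)
  finally show ?thesis .
qed

definition cell_boundary :: "(nat \<Rightarrow> int) \<Rightarrow> (nat \<Rightarrow> real) set" where
  "cell_boundary c = {x\<in>cell c. carrier_cell x \<noteq> c}"

lemma mem_cell_boundary_iff:
  "x \<in> cell_boundary c \<longleftrightarrow> x \<in> cell c \<and> (\<exists>i\<in>odds c. \<bar>2 * x i - of_int (c i)\<bar> = 1)"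
proof -
  have "carrier_cell x i = c i \<longleftrightarrow> \<not> (odd (c i) \<and> \<bar>2 * x i - of_int (c i)\<bar> = 1)" if "x \<in> cell c" for i
  proof -
    let ?t = "x i" and ?k = "c i"
    have *: "\<bar>2 * ?t - of_int ?k\<bar> \<le> (if odd ?k then 1 else 0)" using that by (simp add: cell_def)
    show ?thesis
    proof (cases "even ?k")
      case True
      then show ?thesis using * by (auto simp: carrier_coord_iff carrier_cell_def)
    next
      case False
      then obtain j where j: "?k = 2 * j + 1" by (blast elim: oddE)
      then have b: "of_int j \<le> ?t" "?t \<le> of_int j + 1" using * False by auto
      consider "?t = of_int j" | "?t = of_int (j + 1)" | "of_int j < ?t" "?t < of_int (j + 1)"
        using b by fastforce
      then show ?thesis
      proof cases
        case 3
        then have "\<lfloor>?t\<rfloor> = j" "\<lceil>?t\<rceil> = j + 1" by (auto simp: floor_eq_iff ceiling_eq_iff)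
        then show ?thesis using 3 j by (auto simp: carrier_cell_def)
      qed (use j in \<open>auto simp: carrier_cell_def\<close>)
    qed
  qed
  then show ?thesis by (auto simp: cell_boundary_def odds_def)
qed

lemma mem_cube_iff: "x \<in> cube n \<longleftrightarrow> (\<forall>i<n. \<bar>x i\<bar> \<le> 1) \<and> (\<forall>i\<ge>n. x i = 0)"
  by (auto simp: cube_def max_norm_le_iff coord_space_def)

lemma mem_cube_boundary_iff:
  "x \<in> cube_boundary n \<longleftrightarrow> x \<in> cube n \<and> (\<exists>i<n. \<bar>x i\<bar> = 1)"
proof
  assume "x \<in> cube_boundary n"
  then have 1: "max_norm n x = 1" "x \<in> cube n" by (auto simp: cube_boundary_def cube_def)
  then show "x \<in> cube n \<and> (\<exists>i<n. \<bar>x i\<bar> = 1)" using max_norm_attained[of n x] by auto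
next
  assume "x \<in> cube n \<and> (\<exists>i<n. \<bar>x i\<bar> = 1)"
  then show "x \<in> cube_boundary n"
    using abs_le_max_norm[of _ n x] by (fastforce simp: cube_boundary_def cube_def)
qed

text \<open>Rescaling the odd coordinates and renumbering them as \<open>0, 1, \<dots>\<close> identifies a cell and its boundary
  with a standard cube and its boundary.\<close>

lemma extendable_cell:
  assumes "finite (odds c)"
    and ext: "extendable (cube (card (odds c))) (cube_boundary (card (odds c))) S"
  shows "extendable (cell c) (cell_boundary c) S"
proof -
  define n where "n = card (odds c)"
  obtain h where h: "bij_betw h {..<n} (odds c)"
    using ex_bij_betw_nat_finite[OF assms(1)] by (auto simp: n_def lessThan_atLeast0)
  define k where "k = inv_into {..<n} h"
  have hk: "h (k i) = i" "k i < n" if "i \<in> odds c" for i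
    using h that bij_betw_inv_into_right[OF h] bij_betwE[OF bij_betw_inv_into[OF h]] by (auto simp: k_def)
  have kh: "k (h j) = j" "h j \<in> odds c" if "j < n" for j
    using that bij_betw_inv_into_left[OF h] bij_betwE[OF h] by (auto simp: k_def)
  define \<Phi> where "\<Phi> = (\<lambda>y i. of_int (c i) / (2::real) + (if odd (c i) then y (k i) / 2 else 0))"
  define \<Psi> where "\<Psi> = (\<lambda>x j. if j < n then 2 * x (h j) - of_int (c (h j)) else (0::real))"
  have \<Phi>cont: "continuous_on A \<Phi>" for A
  proof (rule continuous_on_coordinatewise_then_product)
    show "continuous_on A (\<lambda>y. \<Phi> y i)" for i
      unfolding \<Phi>_def by (cases "odd (c i)") (auto intro!: continuous_intros)
  qed
  have \<Psi>cont: "continuous_on A \<Psi>" for A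
  proof (rule continuous_on_coordinatewise_then_product)
    show "continuous_on A (\<lambda>x. \<Psi> x j)" for j
      unfolding \<Psi>_def by (cases "j < n") (auto intro!: continuous_intros)
  qed
  have \<Phi>1: "\<Phi> y \<in> cell c" if "y \<in> cube n" for y
    using that hk(2) by (auto simp: cell_def \<Phi>_def mem_cube_iff odds_def)
  have \<Phi>2: "\<Phi> y \<in> cell_boundary c" if "y \<in> cube_boundary n" for y
  proof -
    obtain j where j: "j < n" "\<bar>y j\<bar> = 1" and y: "y \<in> cube n"
      using \<open>y \<in> cube_boundary n\<close> unfolding mem_cube_boundary_iff by blast
    have "\<bar>2 * \<Phi> y (h j) - of_int (c (h j))\<bar> = 1"
      using j kh[OF j(1)] by (auto simp: \<Phi>_def odds_def)
    then show ?thesis using kh[OF j(1)] \<Phi>1[OF y] by (auto simp: mem_cell_boundary_iff)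
  qed
  have \<Psi>1: "\<Psi> x \<in> cube n" if "x \<in> cell c" for x
  proof -
    have "\<bar>2 * x i - of_int (c i)\<bar> \<le> 1" for i
    proof -
      have "\<bar>2 * x i - of_int (c i)\<bar> \<le> (if odd (c i) then 1 else 0)"
        using that unfolding cell_def by blast
      then show ?thesis by (simp split: if_splits)
    qed
    then show ?thesis by (simp add: mem_cube_iff \<Psi>_def)
  qed
  have \<Psi>2: "\<Psi> x \<in> cube_boundary n" if "x \<in> cell_boundary c" for x
  proof -
    obtain i where i: "i \<in> odds c" "\<bar>2 * x i - of_int (c i)\<bar> = 1" and x: "x \<in> cell c"
      using \<open>x \<in> cell_boundary c\<close> unfolding mem_cell_boundary_iff by blast
    have "\<bar>\<Psi> x (k i)\<bar> = 1" using i hk by (auto simp: \<Psi>_def)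
    then show ?thesis using hk(2)[OF i(1)] \<Psi>1[OF x] by (auto simp: mem_cube_boundary_iff)
  qed
  have inv: "\<Phi> (\<Psi> x) = x" if "x \<in> cell_boundary c" for x
  proof
    fix i
    have "\<bar>2 * x i - of_int (c i)\<bar> \<le> (if odd (c i) then 1 else 0)"
      using that by (simp add: cell_def cell_boundary_def)
    then show "\<Phi> (\<Psi> x) i = x i" using hk[of i] by (auto simp: \<Phi>_def \<Psi>_def odds_def diff_divide_distrib)
  qed
  show ?thesis
    using ext[folded n_def] \<Phi>cont _ \<Psi>cont
    by (rule extendable_transport) (use \<Phi>2 \<Psi>1 \<Psi>2 inv in auto)
qed

lemma mem_Union_cells_iff:
  assumes "\<And>c d. c \<in> F \<Longrightarrow> face d c \<Longrightarrow> d \<in> F"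
  shows "x \<in> \<Union> (cell ` F) \<longleftrightarrow> carrier_cell x \<in> F"
  using assms mem_carrier_cell by (metis UN_iff mem_cell_iff)

text \<open>The obstruction-free step of skeletal extension, with a target set for each cell. Cells are added
  in order of increasing dimension; by then the map is known on the boundary of the new cell, has its
  values in the target of that cell by monotonicity, and can be filled in. The targets are what
  makes it possible to keep track of the two parts of a cover while extending.\<close>

lemma extend_over_complex:
  assumes "finite F" "G \<subseteq> F"
    and F: "\<And>c d. c \<in> F \<Longrightarrow> face d c \<Longrightarrow> d \<in> F"
    and G: "\<And>c d. c \<in> G \<Longrightarrow> face d c \<Longrightarrow> d \<in> G"
    and fin: "\<And>c. c \<in> F \<Longrightarrow> finite (odds c)"
    and contf: "continuous_on (\<Union> (cell ` G)) f"
    and imf: "\<And>c. c \<in> G \<Longrightarrow> f \<in> cell c \<rightarrow> Tg c"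
    and ext: "\<And>c. c \<in> F - G \<Longrightarrow> extendable (cube (card (odds c))) (cube_boundary (card (odds c))) (Tg c)"
    and mono: "\<And>c d. c \<in> F - G \<Longrightarrow> face d c \<Longrightarrow> Tg d \<subseteq> Tg c"
  obtains g where "continuous_on (\<Union> (cell ` F)) g" "\<And>x. x \<in> \<Union> (cell ` G) \<Longrightarrow> g x = f x"
    "\<And>c. c \<in> F \<Longrightarrow> g \<in> cell c \<rightarrow> Tg c"
proof -
  have "\<exists>g. continuous_on (\<Union> (cell ` F)) g \<and> (\<forall>x \<in> \<Union> (cell ` G). g x = f x) \<and>
      (\<forall>c\<in>F. g \<in> cell c \<rightarrow> Tg c)"
    using assms(2) G contf imf ext mono
  proof (induction "card (F - G)" arbitrary: G f rule: less_induct)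
    case less
    note G' = less.prems(2) and im' = less.prems(4) and ext' = less.prems(5) and mono' = less.prems(6)
    show ?case
    proof (cases "F - G = {}")
      case True
      then have "G = F" using less.prems(1) by blast
      then show ?thesis using less.prems by (intro exI[of _ f]) auto
    next
      case False
      have finFG: "finite (F - G)" using assms(1) by simp
      obtain c where c: "c \<in> F - G" and cmin: "\<And>d. d \<in> F - G \<Longrightarrow> card (odds c) \<le> card (odds d)"
        using ex_min_if_finite[of "(\<lambda>c. card (odds c)) ` (F - G)"] finFG False by (auto simp: not_less)
      have faces: "d \<in> G" if "face d c" "d \<noteq> c" for d
      proof (rule ccontr)
        assume "d \<notin> G"
        then have "card (odds c) \<le> card (odds d)" using cmin F c that by blast
        moreover have "card (odds d) < card (odds c)"
          using odds_face_psubset[OF that] fin c by (intro psubset_card_mono) auto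
        ultimately show False by simp
      qed
      \<comment> \<open>The new cell meets the old complex exactly in its boundary.\<close>
      have int: "cell c \<inter> \<Union> (cell ` G) = cell_boundary c"
      proof -
        have *: "x \<in> \<Union> (cell ` G) \<longleftrightarrow> carrier_cell x \<in> G" for x
          by (rule mem_Union_cells_iff) (rule G')
        show ?thesis
          unfolding set_eq_iff Int_iff * cell_boundary_def mem_Collect_eq mem_cell_iff
          using faces c by blast
      qed
      have bd: "x \<in> Tg c" if "x = f y" "y \<in> cell_boundary c" for x y
      proof -
        have "carrier_cell y \<in> G" "face (carrier_cell y) c"
          using that faces by (auto simp: cell_boundary_def mem_cell_iff)
        then show ?thesis using im' mono' c mem_carrier_cell that by blast
      qed
      have "extendable (cell c) (cell_boundary c) (Tg c)"
        using extendable_cell fin c ext' by blast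
      moreover have "continuous_on (cell_boundary c) f"
        using less.prems(3) int by (metis continuous_on_subset inf_le2)
      moreover have "f \<in> cell_boundary c \<rightarrow> Tg c" using bd by blast
      ultimately obtain g where g: "continuous_on (cell c) g" "g \<in> cell c \<rightarrow> Tg c"
        "\<And>x. x \<in> cell_boundary c \<Longrightarrow> g x = f x"
        by (rule extendableE) blast
      define f' where "f' = (\<lambda>x. if x \<in> cell c then g x else f x)"
      have f'f: "f' x = f x" if "x \<in> \<Union> (cell ` G)" for x
        using that g(3) int by (auto simp: f'_def)
      have "finite G" using less.prems(1) assms(1) finite_subset by blast
      have "continuous_on (cell c \<union> \<Union> (cell ` G)) f'"
        unfolding f'_def
      proof (rule continuous_on_cases)
        show "closed (\<Union> (cell ` G))" using \<open>finite G\<close> closed_cell by (intro closed_Union) auto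
        show "\<forall>x. x \<in> cell c \<and> x \<notin> cell c \<or> x \<in> \<Union> (cell ` G) \<and> x \<in> cell c \<longrightarrow> g x = f x"
          using int g(3) by blast
      qed (use closed_cell g less.prems in auto)
      then have cont: "continuous_on (\<Union> (cell ` insert c G)) f'" by simp
      have "card (F - insert c G) < card (F - G)"
        using c finFG by (intro psubset_card_mono) auto
      moreover have "insert c G \<subseteq> F" using c less.prems(1) by blast
      moreover have "d' \<in> insert c G" if "d \<in> insert c G" "face d' d" for d d'
        using that faces G' by blast
      moreover note cont
      moreover have "f' \<in> cell d \<rightarrow> Tg d" if "d \<in> insert c G" for d
      proof (cases "d = c")
        case True
        then show ?thesis using g(2) by (auto simp: f'_def)
      next
        case False
        then have "d \<in> G" using that by blast
        then show ?thesis using f'f im' by fastforce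
      qed
      moreover have "extendable (cube (card (odds d))) (cube_boundary (card (odds d))) (Tg d)"
        if "d \<in> F - insert c G" for d using that ext' by blast
      moreover have "Tg d' \<subseteq> Tg d" if "d \<in> F - insert c G" "face d' d" for d d' using that mono' by blast
      ultimately obtain k where k: "continuous_on (\<Union> (cell ` F)) k"
          "\<forall>x \<in> \<Union> (cell ` insert c G). k x = f' x" "\<forall>c\<in>F. k \<in> cell c \<rightarrow> Tg c"
        using less.hyps[of "insert c G" f'] by blast
      then show ?thesis using f'f by (intro exI[of _ k]) auto
    qed
  qed
  then show ?thesis using that by blast
qed

section \<open>Fine subdivisions of cubes\<close>

lemma compact_cube: "compact (cube n)"
proof -
  have "cube n = PiE UNIV (\<lambda>i. if i < n then {- 1..1} else {0})"
  proof (rule set_eqI)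
    fix x :: "nat \<Rightarrow> real"
    have "x i \<in> (if i < n then {- 1..1} else {0}) \<longleftrightarrow> (if i < n then \<bar>x i\<bar> \<le> 1 else x i = 0)" for i
      by (auto simp: abs_le_iff)
    then have "x \<in> PiE UNIV (\<lambda>i. if i < n then {- 1..1} else {0}) \<longleftrightarrow> (\<forall>i. if i < n then \<bar>x i\<bar> \<le> 1 else x i = 0)"
      unfolding PiE_UNIV_domain Pi_iff by simp
    also have "\<dots> \<longleftrightarrow> x \<in> cube n" unfolding mem_cube_iff by (meson not_less)
    finally show "x \<in> cube n \<longleftrightarrow> x \<in> PiE UNIV (\<lambda>i. if i < n then {- 1..1} else {0})" ..
  qed
  moreover have "compactin (powertop_real UNIV) (PiE UNIV (\<lambda>i. if i < n then {- 1..1::real} else {0}))"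
    unfolding compactin_PiE by auto
  ultimately show ?thesis by (simp add: euclidean_product_topology)
qed

lemma compact_cube_boundary: "compact (cube_boundary n)"
proof -
  have "continuous_on UNIV (max_norm n)" using norm_on_max_norm by (simp add: norm_on_def)
  then have "closed {x. max_norm n x = 1}" by (intro closed_Collect_eq) auto
  moreover have "cube_boundary n = cube n \<inter> {x. max_norm n x = 1}"
    by (auto simp: cube_def cube_boundary_def)
  ultimately show ?thesis using compact_cube by (simp add: compact_Int_closed)
qed

lemma tendsto_fun_iff:
  fixes f :: "'a \<Rightarrow> 'i \<Rightarrow> real"
  shows "(f \<longlongrightarrow> l) F \<longleftrightarrow> (\<forall>i. ((\<lambda>x. f x i) \<longlongrightarrow> l i) F)"
proof -
  have "(f \<longlongrightarrow> l) F \<longleftrightarrow> limitin (powertop_real UNIV) f l F"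
    by (simp add: euclidean_product_topology)
  also have "\<dots> \<longleftrightarrow> (\<forall>i. ((\<lambda>x. f x i) \<longlongrightarrow> l i) F)"
    unfolding limitin_componentwise by auto
  finally show ?thesis .
qed

text \<open>A Lebesgue number for covers by two relatively open sets, measured by coordinate differences.
  If there were none, two sequences that avoid the preimages of the first and of the second set
  would have a common limit, and that limit would lie in neither preimage.\<close>

lemma fine_subdivision:
  fixes K :: "(nat \<Rightarrow> real) set" and F :: "(nat \<Rightarrow> real) \<Rightarrow> 'b::topological_space"
  assumes "compact K" and cont: "continuous_on K F" and im: "F \<in> K \<rightarrow> U \<union> V"
    and U: "openin (top_of_set (U \<union> V)) U" and V: "openin (top_of_set (U \<union> V)) V"
  obtains N :: nat where "N > 0"
    "\<forall>A\<subseteq>K. (\<forall>x\<in>A. \<forall>y\<in>A. \<forall>i. \<bar>x i - y i\<bar> \<le> 1 / N) \<longrightarrow> F ` A \<subseteq> U \<or> F ` A \<subseteq> V"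
proof (rule ccontr)
  assume neg: "\<not> thesis"
  have "\<exists>u v. u \<in> K \<and> v \<in> K \<and> F u \<notin> U \<and> F v \<notin> V \<and> (\<forall>i. \<bar>u i - v i\<bar> \<le> 1 / Suc N)" for N
  proof (rule ccontr)
    assume *: "\<nexists>u v. u \<in> K \<and> v \<in> K \<and> F u \<notin> U \<and> F v \<notin> V \<and> (\<forall>i. \<bar>u i - v i\<bar> \<le> 1 / Suc N)"
    have "F ` A \<subseteq> U \<or> F ` A \<subseteq> V"
      if "A \<subseteq> K" "\<forall>x\<in>A. \<forall>y\<in>A. \<forall>i. \<bar>x i - y i\<bar> \<le> 1 / Suc N" for A
    proof (rule ccontr)
      assume "\<not> (F ` A \<subseteq> U \<or> F ` A \<subseteq> V)"
      then obtain u v where "u \<in> A" "v \<in> A" "F u \<notin> U" "F v \<notin> V" by auto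
      then show False using * that by (meson subsetD)
    qed
    then show False using neg that[of "Suc N"] by (meson zero_less_Suc)
  qed
  then obtain u v where uv: "\<And>N. u N \<in> K" "\<And>N. v N \<in> K" "\<And>N. F (u N) \<notin> U" "\<And>N. F (v N) \<notin> V"
    "\<And>N i. \<bar>u N i - v N i\<bar> \<le> 1 / Suc N"
    by metis
  obtain x r where x: "x \<in> K" and r: "strict_mono r" and lim: "(u \<circ> r) \<longlonglongrightarrow> x"
    using seq_compactE[OF compact_imp_seq_compact[OF \<open>compact K\<close>], of u] uv(1) by blast
  have lim': "(v \<circ> r) \<longlonglongrightarrow> x"
    unfolding tendsto_fun_iff
  proof
    fix i
    have 1: "(\<lambda>N. u (r N) i) \<longlonglongrightarrow> x i" using lim by (simp add: tendsto_fun_iff)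
    have 2: "(\<lambda>N. v (r N) i - u (r N) i) \<longlonglongrightarrow> 0"
    proof (rule Lim_null_comparison)
      show "\<forall>\<^sub>F N in sequentially. norm (v (r N) i - u (r N) i) \<le> 1 / Suc N"
      proof (intro always_eventually allI)
        fix N
        have "\<bar>v (r N) i - u (r N) i\<bar> \<le> 1 / Suc (r N)" using uv(5)[of "r N" i] by (simp add: abs_minus_commute)
        also have "\<dots> \<le> 1 / Suc N" using seq_suble[OF r, of N] by (intro divide_left_mono) auto
        finally show "norm (v (r N) i - u (r N) i) \<le> 1 / Suc N" by simp
      qed
      show "(\<lambda>N. 1 / real (Suc N)) \<longlonglongrightarrow> 0" using LIMSEQ_inverse_real_of_nat by (simp add: inverse_eq_divide)
    qed
    show "(\<lambda>N. (v \<circ> r) N i) \<longlonglongrightarrow> x i" using tendsto_add[OF 1 2] by simp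
  qed
  have contra: False if W: "openin (top_of_set (U \<union> V)) W" "F x \<in> W" and w: "w \<longlonglongrightarrow> x" "\<And>N. w N \<in> K" "\<And>N. F (w N) \<notin> W" for W w
  proof -
    obtain Q where Q: "open Q" "W = (U \<union> V) \<inter> Q" using W by (auto simp: openin_open)
    have "(\<lambda>N. F (w N)) \<longlonglongrightarrow> F x"
      using continuous_on_tendsto_compose[OF cont w(1) x] w(2) by simp
    then have "\<forall>\<^sub>F N in sequentially. F (w N) \<in> Q"
      using Q W(2) by (auto elim: topological_tendstoD)
    then obtain N where "F (w N) \<in> Q" by (auto simp: eventually_sequentially)
    then show False using Q w im by auto
  qed
  have "F x \<in> U \<or> F x \<in> V" using im x by auto
  then show False
    using contra[OF U _ lim] contra[OF V _ lim'] uv(1-4) by (elim disjE) simp_all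
qed

definition grid :: "nat \<Rightarrow> nat \<Rightarrow> (nat \<Rightarrow> int) set" where
  "grid n N = {c. (\<forall>i<n. \<bar>c i\<bar> \<le> 2 * int N) \<and> (\<forall>i\<ge>n. c i = 0)}"

definition grid_boundary :: "nat \<Rightarrow> nat \<Rightarrow> (nat \<Rightarrow> int) set" where
  "grid_boundary n N = {c\<in>grid n N. \<exists>i<n. \<bar>c i\<bar> = 2 * int N}"

lemma finite_grid: "finite (grid n N)"
proof -
  have "grid n N \<subseteq> {c. \<forall>i. (i \<in> {..<n} \<longrightarrow> c i \<in> {- 2 * int N..2 * int N}) \<and> (i \<notin> {..<n} \<longrightarrow> c i = 0)}"
    by (auto simp: grid_def abs_le_iff)
  moreover have "finite \<dots>"
    by (rule finite_set_of_finite_funs) auto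
  ultimately show ?thesis by (rule finite_subset)
qed

lemma odds_grid: "c \<in> grid n N \<Longrightarrow> odds c \<subseteq> {..<n}"
  by (auto simp: grid_def odds_def) (metis even_zero not_less)

lemma finite_odds_grid: "c \<in> grid n N \<Longrightarrow> finite (odds c)"
  by (meson odds_grid finite_lessThan finite_subset)

lemma face_coord: "face d c \<Longrightarrow> \<bar>d i - c i\<bar> \<le> (if odd (c i) then 1 else 0)"
  by (simp add: face_def)

lemma cell_coord: "x \<in> cell c \<Longrightarrow> \<bar>2 * x i - of_int (c i)\<bar> \<le> (if odd (c i) then 1 else 0)"
  unfolding cell_def by blast

lemma face_in_grid: "c \<in> grid n N \<Longrightarrow> face d c \<Longrightarrow> d \<in> grid n N"
proof -
  assume c: "c \<in> grid n N" and d: "face d c"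
  have "\<bar>d i\<bar> \<le> 2 * int N" if "i < n" for i
  proof -
    have "\<bar>c i\<bar> \<le> 2 * int N" using c that by (simp add: grid_def)
    moreover have "\<bar>c i\<bar> \<noteq> 2 * int N" if "odd (c i)" using that by (auto simp: abs_if split: if_splits) presburger
    ultimately show ?thesis using face_coord[OF d, of i] by (auto split: if_splits)
  qed
  moreover have "d i = 0" if "i \<ge> n" for i
    using c that face_coord[OF d, of i] by (simp add: grid_def)
  ultimately show ?thesis by (simp add: grid_def)
qed

lemma face_in_grid_boundary: "c \<in> grid_boundary n N \<Longrightarrow> face d c \<Longrightarrow> d \<in> grid_boundary n N"
proof -
  assume c: "c \<in> grid_boundary n N" and d: "face d c"
  then obtain i where i: "i < n" "\<bar>c i\<bar> = 2 * int N" by (auto simp: grid_boundary_def)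
  then have "even (c i)" by (metis dvd_abs_iff dvd_triv_left)
  then have "d i = c i" using face_coord[OF d, of i] by simp
  then show ?thesis using i c face_in_grid[OF _ d] by (auto simp: grid_boundary_def)
qed

lemma carrier_abs_le_iff: "\<bar>\<lfloor>t\<rfloor> + \<lceil>t\<rceil>\<bar> \<le> 2 * int N \<longleftrightarrow> \<bar>t\<bar> \<le> real N" for t :: real
proof -
  have "\<lceil>t\<rceil> = \<lfloor>t\<rfloor> \<or> \<lceil>t\<rceil> = \<lfloor>t\<rfloor> + 1" by linarith
  then have "\<bar>\<lfloor>t\<rfloor> + \<lceil>t\<rceil>\<bar> \<le> 2 * int N \<longleftrightarrow> - int N \<le> \<lfloor>t\<rfloor> \<and> \<lceil>t\<rceil> \<le> int N"
    by auto
  also have "\<dots> \<longleftrightarrow> - real N \<le> t \<and> t \<le> real N"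
    by (simp add: le_floor_iff ceiling_le_iff)
  finally show ?thesis by auto
qed

lemma carrier_abs_eq_iff: "\<bar>\<lfloor>t\<rfloor> + \<lceil>t\<rceil>\<bar> = 2 * int N \<longleftrightarrow> \<bar>t\<bar> = real N" for t :: real
proof
  assume *: "\<bar>\<lfloor>t\<rfloor> + \<lceil>t\<rceil>\<bar> = 2 * int N"
  have "\<lceil>t\<rceil> = \<lfloor>t\<rfloor>"
  proof (rule ccontr)
    assume "\<lceil>t\<rceil> \<noteq> \<lfloor>t\<rfloor>"
    then have "\<lceil>t\<rceil> = \<lfloor>t\<rfloor> + 1" by linarith
    then show False using * by presburger
  qed
  then have "t = of_int \<lfloor>t\<rfloor>" "\<bar>\<lfloor>t\<rfloor>\<bar> = int N" using * by linarith+
  then show "\<bar>t\<bar> = real N" by (metis of_int_abs of_int_of_nat_eq)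
next
  assume "\<bar>t\<bar> = real N"
  then have "t = real_of_int (int N) \<or> t = real_of_int (- int N)" by auto
  then show "\<bar>\<lfloor>t\<rfloor> + \<lceil>t\<rceil>\<bar> = 2 * int N" by (elim disjE) (simp_all add: floor_minus ceiling_minus)
qed

lemma carrier_eq_0_iff: "\<lfloor>t\<rfloor> + \<lceil>t\<rceil> = 0 \<longleftrightarrow> t = 0" for t :: real
  using carrier_abs_le_iff[of t 0] by simp

lemma mem_cells_grid_iff:
  "x \<in> \<Union> (cell ` grid n N) \<longleftrightarrow> (\<forall>i<n. \<bar>x i\<bar> \<le> real N) \<and> (\<forall>i\<ge>n. x i = 0)"
proof -
  have "x \<in> \<Union> (cell ` grid n N) \<longleftrightarrow> carrier_cell x \<in> grid n N"
    by (rule mem_Union_cells_iff) (rule face_in_grid)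
  then show ?thesis by (simp add: grid_def carrier_cell_def carrier_abs_le_iff carrier_eq_0_iff)
qed

lemma mem_cells_grid_boundary_iff:
  "x \<in> \<Union> (cell ` grid_boundary n N) \<longleftrightarrow> x \<in> \<Union> (cell ` grid n N) \<and> (\<exists>i<n. \<bar>x i\<bar> = real N)"
proof -
  have "x \<in> \<Union> (cell ` grid_boundary n N) \<longleftrightarrow> carrier_cell x \<in> grid_boundary n N"
    by (rule mem_Union_cells_iff) (rule face_in_grid_boundary)
  moreover have "x \<in> \<Union> (cell ` grid n N) \<longleftrightarrow> carrier_cell x \<in> grid n N"
    by (rule mem_Union_cells_iff) (rule face_in_grid)
  ultimately show ?thesis by (simp add: grid_boundary_def carrier_cell_def carrier_abs_eq_iff)
qed

lemma scale_mem_cube: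
  assumes "N > 0"
  shows "x \<in> \<Union> (cell ` grid n N) \<longleftrightarrow> scale (1 / real N) x \<in> cube n"
    and "x \<in> \<Union> (cell ` grid_boundary n N) \<longleftrightarrow> scale (1 / real N) x \<in> cube_boundary n"
  using assms unfolding mem_cells_grid_boundary_iff mem_cells_grid_iff mem_cube_boundary_iff mem_cube_iff scale_def
  by (auto simp: abs_mult field_simps)

lemma cell_diameter: "x \<in> cell c \<Longrightarrow> y \<in> cell c \<Longrightarrow> \<bar>x i - y i\<bar> \<le> 1"
proof -
  assume "x \<in> cell c" "y \<in> cell c"
  then have "\<bar>2 * x i - of_int (c i)\<bar> \<le> (if odd (c i) then 1 else 0)"
      "\<bar>2 * y i - of_int (c i)\<bar> \<le> (if odd (c i) then 1 else 0)"
    unfolding cell_def by blast+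
  then show ?thesis by (auto split: if_splits)
qed

lemma fine_grid:
  fixes F :: "(nat \<Rightarrow> real) \<Rightarrow> 'b::topological_space"
  assumes K: "compact K" and cont: "continuous_on K F" and im: "F \<in> K \<rightarrow> U \<union> V"
    and U: "openin (top_of_set (U \<union> V)) U" and V: "openin (top_of_set (U \<union> V)) V"
  obtains N :: nat where "N > 0"
    "\<forall>c. scale (1 / N) ` cell c \<subseteq> K \<longrightarrow>
       (\<lambda>x. F (scale (1 / N) x)) ` cell c \<subseteq> U \<or> (\<lambda>x. F (scale (1 / N) x)) ` cell c \<subseteq> V"
proof -
  obtain N :: nat where N: "N > 0"
    "\<forall>A\<subseteq>K. (\<forall>x\<in>A. \<forall>y\<in>A. \<forall>i. \<bar>x i - y i\<bar> \<le> 1 / N) \<longrightarrow> F ` A \<subseteq> U \<or> F ` A \<subseteq> V"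
    by (rule fine_subdivision[OF assms]; rule that; assumption)
  have "F ` scale (1 / N) ` cell c \<subseteq> U \<or> F ` scale (1 / N) ` cell c \<subseteq> V"
    if "scale (1 / N) ` cell c \<subseteq> K" for c
  proof (rule N(2)[rule_format, OF that])
    fix x y i assume "x \<in> scale (1 / real N) ` cell c" "y \<in> scale (1 / real N) ` cell c"
    then obtain x' y' where "x' \<in> cell c" "y' \<in> cell c" "x = scale (1 / real N) x'" "y = scale (1 / real N) y'"
      by blast
    then show "\<bar>x i - y i\<bar> \<le> 1 / real N"
      using cell_diameter[of x' c y' i] N(1) by (simp add: scale_def divide_right_mono flip: diff_divide_distrib)
  qed
  then show ?thesis using that[OF N(1)] by (simp add: image_image)
qed


section \<open>Unions of two open sets\<close>

text \<open>The map of a cube into \<open>U \<union> V\<close> that fills a given sphere in \<open>U\<close> is subdivided until every cell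
  goes to \<open>U\<close> or to \<open>V\<close>. It is kept on the cells that go to \<open>U\<close>. The faces that the remaining cells
  share with these are mapped into \<open>U \<inter> V\<close>, so that the remaining cells can be mapped anew into
  \<open>U \<inter> V\<close>.\<close>

lemma fills_upto_open_part:
  assumes U: "openin (top_of_set (U \<union> V)) U" and V: "openin (top_of_set (U \<union> V)) V"
    and fS: "fills_upto n (U \<union> V)" and fUV: "fills_upto n (U \<inter> V)"
  shows "fills_upto n U"
  unfolding fills_upto_def
proof (intro allI impI extendableI)
  fix m f assume "m \<le> n" and f: "continuous_on (cube_boundary m) f" "f \<in> cube_boundary m \<rightarrow> U"
  have "extendable (cube m) (cube_boundary m) (U \<union> V)"
    using fS \<open>m \<le> n\<close> by (simp add: fills_upto_def)
  moreover have "f \<in> cube_boundary m \<rightarrow> U \<union> V" using f(2) by auto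
  ultimately obtain F where F: "continuous_on (cube m) F" "F \<in> cube m \<rightarrow> U \<union> V"
      "\<And>x. x \<in> cube_boundary m \<Longrightarrow> F x = f x"
    using f(1) by (metis extendableE)
  obtain N :: nat where N: "N > 0" and small: "\<forall>c. scale (1 / N) ` cell c \<subseteq> cube m \<longrightarrow>
       (\<lambda>x. F (scale (1 / N) x)) ` cell c \<subseteq> U \<or> (\<lambda>x. F (scale (1 / N) x)) ` cell c \<subseteq> V"
    by (rule fine_grid[OF compact_cube F(1,2) U V]; rule that; assumption)
  define P where "P = (\<lambda>x. F (scale (1 / N) x))"
  define \<U> where "\<U> = {c\<in>grid m N. P ` cell c \<subseteq> U}"
  define Tg where "Tg = (\<lambda>c. if c \<in> \<U> then P ` cell c else U \<inter> V)"
  have cells: "scale (1 / N) ` cell c \<subseteq> cube m" if "c \<in> grid m N" for c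
    using scale_mem_cube(1)[OF N, of _ m] that by blast
  have PV: "P ` cell c \<subseteq> V" if "c \<in> grid m N" "c \<notin> \<U>" for c
    using small[rule_format, OF cells[OF that(1)]] that by (auto simp: \<U>_def P_def)
  have Pcont: "continuous_on (\<Union> (cell ` grid m N)) P"
    unfolding P_def by (rule continuous_on_compose2[OF F(1)])
      (use scale_mem_cube(1)[OF N] in \<open>auto intro!: continuous_on_scale continuous_on_id\<close>)
  obtain g where g: "continuous_on (\<Union> (cell ` grid m N)) g" "\<And>x. x \<in> \<Union> (cell ` \<U>) \<Longrightarrow> g x = P x"
    "\<And>c. c \<in> grid m N \<Longrightarrow> g \<in> cell c \<rightarrow> Tg c"
  proof (rule extend_over_complex[of "grid m N" \<U> P Tg])
    show "d \<in> \<U>" if "c \<in> \<U>" "face d c" for c d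
    proof -
      have "P ` cell d \<subseteq> P ` cell c" using that(2) by (intro image_mono cell_mono)
      then show ?thesis using that face_in_grid[of c m N d] unfolding \<U>_def by blast
    qed
    show "continuous_on (\<Union> (cell ` \<U>)) P"
      by (rule continuous_on_subset[OF Pcont]) (auto simp: \<U>_def)
    show "extendable (cube (card (odds c))) (cube_boundary (card (odds c))) (Tg c)" if "c \<in> grid m N - \<U>" for c
    proof -
      have "card (odds c) \<le> m" using that odds_grid[of c m N] card_mono[of "{..<m}" "odds c"] by auto
      then show ?thesis using fUV \<open>m \<le> n\<close> that by (simp add: Tg_def fills_upto_def)
    qed
    show "Tg d \<subseteq> Tg c" if "c \<in> grid m N - \<U>" "face d c" for c d
      using that PV[of c] cell_mono[of d c] by (auto simp: Tg_def \<U>_def)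
  qed (auto simp: finite_grid finite_odds_grid \<U>_def Tg_def face_in_grid)
  have TgU: "Tg c \<subseteq> U" for c by (auto simp: Tg_def \<U>_def)
  have sc: "scale N x \<in> \<Union> (cell ` grid m N) \<longleftrightarrow> x \<in> cube m"
    "scale N x \<in> \<Union> (cell ` grid_boundary m N) \<longleftrightarrow> x \<in> cube_boundary m" for x
    using scale_mem_cube[OF N, of "scale N x"] N by simp_all
  show "\<exists>g. continuous_on (cube m) g \<and> g \<in> cube m \<rightarrow> U \<and> (\<forall>x\<in>cube_boundary m. g x = f x)"
  proof (intro exI[of _ "\<lambda>x. g (scale N x)"] conjI ballI)
    show "continuous_on (cube m) (\<lambda>x. g (scale N x))"
      by (rule continuous_on_compose2[OF g(1)])
        (use sc in \<open>auto intro!: continuous_on_scale continuous_on_id\<close>)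
    show "(\<lambda>x. g (scale N x)) \<in> cube m \<rightarrow> U"
    proof
      fix x assume "x \<in> cube m"
      then obtain c where "c \<in> grid m N" "scale N x \<in> cell c" using sc(1) by blast
      then show "g (scale N x) \<in> U" using g(3) TgU by blast
    qed
    fix x assume x: "x \<in> cube_boundary m"
    then obtain c where c: "c \<in> grid_boundary m N" "scale N x \<in> cell c" using sc(2) by blast
    \<comment> \<open>A whole cell of the boundary is mapped by \<open>f\<close>, so the filling was not changed on it.\<close>
    have "P ` cell c \<subseteq> U"
    proof
      fix z assume "z \<in> P ` cell c"
      then obtain y where y: "y \<in> cell c" "z = P y" by blast
      then have "scale (1 / N) y \<in> cube_boundary m" using scale_mem_cube(2)[OF N, of y m] c by blast
      then show "z \<in> U" using F(3) f(2) y by (auto simp: P_def)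
    qed
    then have "c \<in> \<U>" using c by (auto simp: \<U>_def grid_boundary_def)
    then have "g (scale N x) = P (scale N x)" using g(2) c(2) by blast
    then show "g (scale N x) = f x" using N F(3)[OF x] by (simp add: P_def)
  qed
qed

lemma extendable_cube_0: "extendable (cube 0) (cube_boundary 0) S \<longleftrightarrow> S \<noteq> {}"
proof -
  have c0: "cube 0 = {\<lambda>_. 0}" by (auto simp: mem_cube_iff)
  have b0: "cube_boundary 0 = {}" by (auto simp: mem_cube_boundary_iff)
  show ?thesis
    unfolding extendable_def c0 b0 by (auto intro!: exI[of _ "\<lambda>_. SOME x. x \<in> S"] some_in_eq[THEN iffD2])
qed

lemma continuous_on_fun_upd:
  fixes f :: "'a::topological_space \<Rightarrow> 'i \<Rightarrow> real"
  assumes "continuous_on A f" "continuous_on A t"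
  shows "continuous_on A (\<lambda>x. (f x)(m := t x))"
proof (rule continuous_on_coordinatewise_then_product)
  show "continuous_on A (\<lambda>x. ((f x)(m := t x)) i)" for i
    by (cases "i = m") (use assms in \<open>auto intro: continuous_on_product_then_coordinatewise\<close>)
qed

lemma carrier_in_012: "0 \<le> t \<Longrightarrow> t \<le> 1 \<Longrightarrow> \<lfloor>t\<rfloor> + \<lceil>t\<rceil> \<in> {0, 1, 2}" for t :: real
proof -
  assume "0 \<le> t" "t \<le> 1"
  moreover define s where "s = \<lfloor>t\<rfloor> + \<lceil>t\<rceil>"
  ultimately have "0 \<le> s" "s \<le> 2" by (auto simp: s_def intro: add_mono[of _ 1 _ 1, simplified]) linarith+
  then have "s \<in> {0, 1, 2}" by auto
  then show ?thesis by (simp add: s_def)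
qed

text \<open>A given map on the boundary of the \<open>m\<close>-cube is deformed to a constant map; coning off the constant
  end then fills the cube. The deformation is a map on the product of the subdivided boundary with
  an interval, whose coordinate has number \<open>m\<close>. The prism over a cell goes to \<open>U\<close>, to \<open>V\<close> or to
  \<open>U \<inter> V\<close>; the last choice is forced only where cells of both kinds meet. Such a cell is a proper
  face of another one, so its prism has dimension less than \<open>m\<close>. This is why one degree less of
  connectedness suffices for \<open>U \<inter> V\<close>.\<close>

lemma fills_upto_Un:
  assumes U: "openin (top_of_set (U \<union> V)) U" and V: "openin (top_of_set (U \<union> V)) V"
    and fU: "fills_upto n U" and fV: "fills_upto n V" and fUV: "fills_upto (n - 1) (U \<inter> V)"
  shows "fills_upto n (U \<union> V)"
  unfolding fills_upto_def
proof (intro allI impI)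
  fix m assume "m \<le> n"
  have "U \<inter> V \<noteq> {}" using fUV extendable_cube_0 by (auto simp: fills_upto_def)
  then obtain p where p: "p \<in> U" "p \<in> V" by blast
  show "extendable (cube m) (cube_boundary m) (U \<union> V)"
  proof (cases "m = 0")
    case True
    then show ?thesis using p by (auto simp: extendable_cube_0)
  next
    case m: False
    show ?thesis
    proof (rule extendableI)
      fix f assume f: "continuous_on (cube_boundary m) f" "f \<in> cube_boundary m \<rightarrow> U \<union> V"
      obtain N :: nat where N: "N > 0" and small: "\<forall>c. scale (1 / N) ` cell c \<subseteq> cube_boundary m \<longrightarrow>
       (\<lambda>x. f (scale (1 / N) x)) ` cell c \<subseteq> U \<or> (\<lambda>x. f (scale (1 / N) x)) ` cell c \<subseteq> V"
        by (rule fine_grid[OF compact_cube_boundary f U V]; rule that; assumption)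
      let ?B = "grid_boundary m N"
      have gb: "d \<in> ?B" if "c \<in> ?B" "face d c" for c d using that face_in_grid_boundary by blast
      define P where "P = (\<lambda>x. f (scale (1 / N) x))"
      \<comment> \<open>\<open>\<U>\<close>: cells that go to \<open>U\<close>; \<open>\<N>\<close>: faces of the others, all of which go to \<open>V\<close>.\<close>
      define \<U> where "\<U> = {c\<in>?B. P ` cell c \<subseteq> U}"
      define \<N> where "\<N> = {d\<in>?B. \<exists>c\<in>?B - \<U>. face d c}"
      define col where "col = (\<lambda>c. if c \<notin> \<U> then V else if c \<in> \<N> then U \<inter> V else U)"
      have cells: "scale (1 / N) ` cell c \<subseteq> cube_boundary m" if "c \<in> ?B" for c
        using scale_mem_cube(2)[OF N, of _ m] that by blast
      have PV: "P ` cell c \<subseteq> V" if "c \<in> ?B" "c \<notin> \<U>" for c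
        using small[rule_format, OF cells[OF that(1)]] that by (auto simp: \<U>_def P_def)
      have Pcol: "P ` cell c \<subseteq> col c" if "c \<in> ?B" for c
        using PV[of c] PV cell_mono[of c] that by (auto simp: col_def \<U>_def \<N>_def) blast
      have colmono: "col d \<subseteq> col c" if "c \<in> ?B" "face d c" for c d
      proof -
        have "d \<in> ?B" using gb[OF that] .
        moreover have "d \<in> \<U>" if "c \<in> \<U>"
        proof -
          have "P ` cell d \<subseteq> P ` cell c" using \<open>face d c\<close> by (intro image_mono cell_mono)
          then show ?thesis using that \<open>d \<in> ?B\<close> unfolding \<U>_def by blast
        qed
        moreover have "d \<in> \<N>" if "c \<in> \<N>" using that \<open>face d c\<close> \<open>d \<in> ?B\<close> face_trans by (auto simp: \<N>_def)
        moreover have "d \<in> \<N>" if "c \<notin> \<U>" using that \<open>face d c\<close> \<open>c \<in> ?B\<close> \<open>d \<in> ?B\<close> by (auto simp: \<N>_def)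
        ultimately show ?thesis by (auto simp: col_def)
      qed
      have colUV: "col c \<subseteq> U \<union> V" "p \<in> col c" for c using p by (auto simp: col_def)
      have cardB: "card (odds c) \<le> m - 1" if c: "c \<in> ?B" for c
      proof -
        obtain i where i: "i < m" "\<bar>c i\<bar> = 2 * int N" using c by (auto simp: grid_boundary_def)
        then have "even (c i)" by (metis dvd_abs_iff dvd_triv_left)
        then have "odds c \<subseteq> {..<m} - {i}" using odds_grid[of c m N] c by (auto simp: grid_boundary_def odds_def)
        then show ?thesis using card_mono[of "{..<m} - {i}" "odds c"] i by simp
      qed
      have finB: "finite (odds c)" if "c \<in> ?B" for c
        using that finite_odds_grid by (auto simp: grid_boundary_def)
      have cardcol: "extendable (cube (Suc (card (odds c)))) (cube_boundary (Suc (card (odds c)))) (col c)"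
        if c: "c \<in> ?B" for c
      proof (cases "c \<in> \<U> \<and> c \<in> \<N>")
        case True
        then obtain c' where c': "c' \<in> ?B" "c' \<notin> \<U>" "face c c'" by (auto simp: \<N>_def)
        then have "card (odds c) < card (odds c')"
          using odds_face_psubset[of c c'] True finB[of c'] by (intro psubset_card_mono) auto
        then have "Suc (card (odds c)) \<le> n - 1" using cardB[OF c'(1)] \<open>m \<le> n\<close> by linarith
        then show ?thesis using True fUV by (simp add: col_def fills_upto_def)
      next
        case False
        have "Suc (card (odds c)) \<le> n" using cardB[OF c] \<open>m \<le> n\<close> m by linarith
        then show ?thesis using False fU fV by (simp add: col_def fills_upto_def)
      qed
      \<comment> \<open>The prism complex: the entry \<open>m\<close> of a cell is \<open>0\<close> at the bottom, \<open>2\<close> at the top and \<open>1\<close> in between.\<close>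
      define base where "base = (\<lambda>c::nat \<Rightarrow> int. c(m := 0))"
      define F where "F = {c. base c \<in> ?B \<and> c m \<in> {0, 1, 2}}"
      define G where "G = {c\<in>F. c m \<noteq> 1}"
      define f' where "f' = (\<lambda>x. if x m \<le> 1 / 2 then P (x(m := 0)) else p)"
      define Tg where "Tg = (\<lambda>c. if c m = 1 then col (base c) else if c m = 0 then P ` cell c else {p})"
      have Bm: "c m = 0" if "c \<in> ?B" for c using that by (auto simp: grid_boundary_def grid_def)
      have face_base: "face (base d) (base c)" if "face d c" for c d
        unfolding face_def
      proof
        fix i
        show "\<bar>base d i - base c i\<bar> \<le> (if odd (base c i) then 1 else 0)"
          using face_coord[OF that, of i] by (cases "i = m") (simp_all add: base_def)
      qed
      have facem: "d m = c m \<or> c m = 1 \<and> d m \<in> {0, 2}" if "c \<in> F" "face d c" for c d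
        using that face_coord[of d c m] by (auto simp: F_def)
      have Fface: "d \<in> F" if "c \<in> F" "face d c" for c d
        using gb[OF _ face_base[OF that(2)]] facem[OF that] that by (auto simp: F_def)
      have Gface: "d \<in> G" if "c \<in> G" "face d c" for c d
        using Fface[of c d] facem[of c d] that by (auto simp: G_def)
      have cell_base: "x(m := 0) \<in> cell (base c)" if "x \<in> cell c" for x c
        unfolding cell_def mem_Collect_eq
      proof
        fix i
        show "\<bar>2 * (x(m := 0)) i - of_int (base c i)\<bar> \<le> (if odd (base c i) then 1 else 0)"
          using cell_coord[OF that, of i] by (cases "i = m") (simp_all add: base_def)
      qed
      have finF: "finite F"
      proof -
        have "c \<in> (\<lambda>(b, k). b(m := k)) ` (?B \<times> {0, 1, 2})" if "c \<in> F" for c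
        proof -
          have "c = (base c)(m := c m)" by (simp add: base_def)
          then show ?thesis using that by (auto simp: F_def intro!: rev_image_eqI[of "(base c, c m)"])
        qed
        moreover have "finite ?B" using finite_grid[of m N] by (auto simp: grid_boundary_def intro: finite_subset)
        ultimately show ?thesis by (meson finite.emptyI finite.insertI finite_SigmaI finite_imageI finite_subset subsetI)
      qed
      have c0: "base c = c" if "c m = 0" for c using that by (auto simp: base_def)
      have half: "x m = (if c m = 0 then 0 else 1)" if "c \<in> G" "x \<in> cell c" for x c
      proof -
        have "\<bar>2 * x m - of_int (c m)\<bar> \<le> (if odd (c m) then 1 else 0)" using that unfolding cell_def by blast
        then show ?thesis using that by (auto simp: G_def F_def)
      qed
      have oddsF: "odds c = insert m (odds (base c))" if "c m = 1" for c
        using that by (auto simp: odds_def base_def)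
      have finoddsF: "finite (odds c)" if "c \<in> F" for c
      proof (rule finite_subset)
        show "odds c \<subseteq> insert m (odds (base c))" by (auto simp: odds_def base_def)
        show "finite (insert m (odds (base c)))" using that finB by (auto simp: F_def)
      qed
      have Pcont: "continuous_on (\<Union> (cell ` ?B)) P"
        unfolding P_def by (rule continuous_on_compose2[OF f(1)])
          (use scale_mem_cube(2)[OF N] in \<open>auto intro!: continuous_on_scale continuous_on_id\<close>)
      have f'cont: "continuous_on (\<Union> (cell ` G)) f'"
        unfolding f'_def
      proof (rule continuous_on_paste_le)
        show "continuous_on {x \<in> \<Union> (cell ` G). x m \<le> 1 / 2} (\<lambda>x. P (x(m := 0)))"
        proof (rule continuous_on_compose2[OF Pcont])
          show "(\<lambda>x. x(m := 0)) ` {x \<in> \<Union> (cell ` G). x m \<le> 1 / 2} \<subseteq> \<Union> (cell ` ?B)"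
            using cell_base by (auto simp: G_def F_def)
        qed (intro continuous_on_fun_upd continuous_on_id continuous_on_const)
        show "P (x(m := 0)) = p" if "x \<in> \<Union> (cell ` G)" "x m = 1 / 2" for x
          using that half by (fastforce split: if_splits)
      qed (auto intro!: continuous_on_coord)
      obtain H where H: "continuous_on (\<Union> (cell ` F)) H" "\<And>x. x \<in> \<Union> (cell ` G) \<Longrightarrow> H x = f' x"
          "\<And>c. c \<in> F \<Longrightarrow> H \<in> cell c \<rightarrow> Tg c"
      proof (rule extend_over_complex[of F G f' Tg])
        show "f' \<in> cell c \<rightarrow> Tg c" if "c \<in> G" for c
        proof
          fix x assume x: "x \<in> cell c"
          show "f' x \<in> Tg c"
            using half[OF that x] that cell_base[OF x] c0[of c] by (auto simp: f'_def Tg_def G_def)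
        qed
        show "extendable (cube (card (odds c))) (cube_boundary (card (odds c))) (Tg c)" if c: "c \<in> F - G" for c
        proof -
          have cm: "c m = 1" and B: "base c \<in> ?B" using c by (auto simp: G_def F_def)
          have "m \<notin> odds (base c)" by (simp add: odds_def base_def)
          then have "card (odds c) = Suc (card (odds (base c)))"
            using oddsF[of c] cm finB[OF B] by simp
          then show ?thesis using cardcol[OF B] cm by (simp add: Tg_def)
        qed
        show "Tg d \<subseteq> Tg c" if c: "c \<in> F - G" and d: "face d c" for c d
        proof -
          have cm: "c m = 1" and B: "base c \<in> ?B" using c by (auto simp: G_def F_def)
          have B': "base d \<in> ?B" using gb[OF B face_base[OF d]] .
          have cd: "col (base d) \<subseteq> col (base c)" using colmono[OF B face_base[OF d]] .
          have "P ` cell d \<subseteq> col (base d)" if "d m = 0" using c0[of d] that Pcol[OF B'] by simp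
          then show ?thesis using cd colUV(2) cm by (auto simp: Tg_def)
        qed
        show "d \<in> F" if "c \<in> F" "face d c" for c d using Fface[OF that] .
        show "d \<in> G" if "c \<in> G" "face d c" for c d using Gface[OF that] .
        show "finite (odds c)" if "c \<in> F" for c using finoddsF[OF that] .
        show "continuous_on (\<Union> (cell ` G)) f'" by (rule f'cont)
        show "G \<subseteq> F" by (auto simp: G_def)
      qed (use finF that in \<open>simp_all only:\<close>)
      have TgS: "Tg c \<subseteq> U \<union> V" if "c \<in> F" for c
        using that Pcol colUV c0[of c] p by (fastforce simp: Tg_def F_def)
      have inF: "x \<in> \<Union> (cell ` F)" "x m = 0 \<or> x m = 1 \<Longrightarrow> x \<in> \<Union> (cell ` G)"
        if "x(m := 0) \<in> \<Union> (cell ` ?B)" "0 \<le> x m" "x m \<le> 1" for x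
      proof -
        have "carrier_cell (x(m := 0)) \<in> ?B"
          using that(1) mem_Union_cells_iff[of ?B "x(m := 0)"] gb by blast
        moreover have "carrier_cell (x(m := 0)) = base (carrier_cell x)"
          by (auto simp: carrier_cell_def base_def)
        ultimately have F: "carrier_cell x \<in> F"
          using carrier_in_012[OF that(2,3)] by (auto simp: F_def carrier_cell_def)
        then show "x \<in> \<Union> (cell ` F)" using mem_carrier_cell by blast
        assume "x m = 0 \<or> x m = 1"
        then have "carrier_cell x \<in> G" using F by (auto simp: G_def carrier_cell_def)
        then show "x \<in> \<Union> (cell ` G)" using mem_carrier_cell by blast
      qed
      \<comment> \<open>The outer shell of the cube carries the deformation, the inner half is mapped to \<open>p\<close>.\<close>
      define \<pi> where "\<pi> = (\<lambda>x. (scale (N / max_norm m x) x)(m := 2 * (1 - max_norm m x)))"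
      have mxc: "continuous_on A (max_norm m)" for A
        using norm_on_max_norm[of m] continuous_on_subset by (auto simp: norm_on_def)
      have \<pi>B: "(\<pi> x)(m := 0) \<in> \<Union> (cell ` ?B)" if "x \<in> cube m" "max_norm m x \<ge> 1 / 2" for x
      proof -
        have "(\<pi> x)(m := 0) = scale (N / max_norm m x) x"
          using that by (auto simp: \<pi>_def scale_def mem_cube_iff)
        moreover have "scale (1 / N) (scale (N / max_norm m x) x) \<in> cube_boundary m"
          using that N norm_on_max_norm[of m] by (auto simp: cube_boundary_def norm_on_def cube_def)
        ultimately show ?thesis using scale_mem_cube(2)[OF N] by simp
      qed
      have \<pi>m: "\<pi> x m = 2 * (1 - max_norm m x)" for x by (simp add: \<pi>_def)
      define g where "g = (\<lambda>x. if max_norm m x \<le> 1 / 2 then p else H (\<pi> x))"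
      have le1: "max_norm m x \<le> 1" if "x \<in> cube m" for x using that by (simp add: cube_def)
      have "continuous_on (cube m) g"
        unfolding g_def
      proof (rule continuous_on_paste_le)
        show "continuous_on {x \<in> cube m. 1 / 2 \<le> max_norm m x} (\<lambda>x. H (\<pi> x))"
        proof (rule continuous_on_compose2[OF H(1)])
          show "continuous_on {x \<in> cube m. 1 / 2 \<le> max_norm m x} \<pi>"
            unfolding \<pi>_def
            by (intro continuous_on_fun_upd continuous_on_scale continuous_on_id continuous_on_divide
                continuous_on_const continuous_on_mult continuous_on_diff mxc) auto
          show "\<pi> ` {x \<in> cube m. 1 / 2 \<le> max_norm m x} \<subseteq> \<Union> (cell ` F)"
            using inF(1) \<pi>B \<pi>m le1 by auto
        qed
        show "p = H (\<pi> x)" if "x \<in> cube m" "max_norm m x = 1 / 2" for x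
        proof -
          have "\<pi> x \<in> \<Union> (cell ` G)" using inF(2)[of "\<pi> x"] \<pi>B \<pi>m that by simp
          then show ?thesis using H(2) \<pi>m that by (simp add: f'_def)
        qed
      qed (auto intro: mxc)
      moreover have "g \<in> cube m \<rightarrow> U \<union> V"
      proof
        fix x assume x: "x \<in> cube m"
        have "H (\<pi> x) \<in> U \<union> V" if ge: "max_norm m x \<ge> 1 / 2"
        proof -
          obtain c where "c \<in> F" "\<pi> x \<in> cell c" using inF(1)[of "\<pi> x"] \<pi>B[OF x ge] \<pi>m le1[OF x] ge by auto
          then show ?thesis using H(3) TgS by blast
        qed
        then show "g x \<in> U \<union> V" using p by (auto simp: g_def)
      qed
      moreover have "g x = f x" if x: "x \<in> cube_boundary m" for x
      proof -
        have x': "x \<in> cube m" "max_norm m x = 1" using x by (auto simp: cube_def cube_boundary_def)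
        then have "\<pi> x \<in> \<Union> (cell ` G)" using inF(2)[of "\<pi> x"] \<pi>B \<pi>m by simp
        then have "g x = P ((\<pi> x)(m := 0))" using H(2) \<pi>m x' by (simp add: g_def f'_def)
        also have "(\<pi> x)(m := 0) = scale N x" using x' by (auto simp: \<pi>_def scale_def mem_cube_iff)
        finally show ?thesis using N by (simp add: P_def)
      qed
      ultimately show "\<exists>g. continuous_on (cube m) g \<and> g \<in> cube m \<rightarrow> U \<union> V \<and> (\<forall>x\<in>cube_boundary m. g x = f x)"
        by blast
    qed
  qed
qed

section \<open>Realizations of simplicial complexes\<close>

text \<open>The outer half of the cube contracts the given map along segments towards \<open>c\<close>, the inner half is
  mapped to \<open>c\<close>.\<close>

lemma fills_upto_starlike:
  fixes S :: "('a \<Rightarrow> real) set"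
  assumes c: "c \<in> S" and star: "\<And>x t. x \<in> S \<Longrightarrow> 0 \<le> t \<Longrightarrow> t \<le> 1 \<Longrightarrow> (\<lambda>v. (1 - t) * c v + t * x v) \<in> S"
  shows "fills_upto n S"
  unfolding fills_upto_def
proof (intro allI impI extendableI)
  fix m f assume f: "continuous_on (cube_boundary m) f" "f \<in> cube_boundary m \<rightarrow> S"
  define \<tau> where "\<tau> = (\<lambda>x. 2 * max_norm m x - 1)"
  define \<phi> where "\<phi> = (\<lambda>x. scale (1 / max_norm m x) x)"
  define g where "g = (\<lambda>x. if max_norm m x \<le> 1 / 2 then c
    else (\<lambda>v. (1 - \<tau> x) * c v + \<tau> x * f (\<phi> x) v))"
  have mxc: "continuous_on A (max_norm m)" for A
    using norm_on_max_norm[of m] continuous_on_subset by (auto simp: norm_on_def)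
  have \<phi>: "\<phi> x \<in> cube_boundary m" if "x \<in> cube m" "1 / 2 \<le> max_norm m x" for x
    using that norm_on_max_norm[of m] by (auto simp: \<phi>_def cube_boundary_def norm_on_def cube_def)
  have "continuous_on (cube m) g"
    unfolding g_def
  proof (rule continuous_on_paste_le)
    have \<phi>c: "continuous_on {x \<in> cube m. 1 / 2 \<le> max_norm m x} \<phi>"
      unfolding \<phi>_def
      by (intro continuous_on_scale continuous_on_divide continuous_on_const continuous_on_id mxc) auto
    have "continuous_on {x \<in> cube m. 1 / 2 \<le> max_norm m x} (\<lambda>x. f (\<phi> x))"
      by (rule continuous_on_compose2[OF f(1) \<phi>c]) (use \<phi> in auto)
    then have "continuous_on {x \<in> cube m. 1 / 2 \<le> max_norm m x} (\<lambda>x. f (\<phi> x) v)" for v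
      by (rule continuous_on_product_then_coordinatewise)
    moreover have "continuous_on {x \<in> cube m. 1 / 2 \<le> max_norm m x} \<tau>"
      unfolding \<tau>_def by (intro continuous_on_diff continuous_on_mult continuous_on_const mxc)
    ultimately show "continuous_on {x \<in> cube m. 1 / 2 \<le> max_norm m x}
        (\<lambda>x v. (1 - \<tau> x) * c v + \<tau> x * f (\<phi> x) v)"
      by (intro continuous_on_coordinatewise_then_product continuous_on_add continuous_on_mult
          continuous_on_diff continuous_on_const)
    show "c = (\<lambda>v. (1 - \<tau> x) * c v + \<tau> x * f (\<phi> x) v)" if "max_norm m x = 1 / 2" for x
    proof -
      have "\<tau> x = 0" using that by (simp add: \<tau>_def)
      then show ?thesis by simp
    qed
  qed (auto intro: mxc)
  moreover have "g \<in> cube m \<rightarrow> S"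
  proof
    fix x assume x: "x \<in> cube m"
    then have "max_norm m x \<le> 1" by (simp add: cube_def)
    moreover have "(\<lambda>v. (1 - \<tau> x) * c v + \<tau> x * f (\<phi> x) v) \<in> S" if "1 / 2 \<le> max_norm m x"
      using that \<phi>[OF x that] f(2) \<open>max_norm m x \<le> 1\<close> by (intro star) (auto simp: \<tau>_def)
    ultimately show "g x \<in> S" using c by (simp add: g_def)
  qed
  moreover have "g x = f x" if "x \<in> cube_boundary m" for x
  proof -
    have "max_norm m x = 1" using that by (simp add: cube_boundary_def)
    then show ?thesis by (simp add: g_def \<tau>_def \<phi>_def)
  qed
  ultimately show "\<exists>g. continuous_on (cube m) g \<and> g \<in> cube m \<rightarrow> S \<and> (\<forall>x\<in>cube_boundary m. g x = f x)" by blast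
qed

lemma fills_upto_retract:
  assumes "fills_upto n S" "continuous_on S r" "r \<in> S \<rightarrow> T" "T \<subseteq> S" "\<And>x. x \<in> T \<Longrightarrow> r x = x"
  shows "fills_upto n T"
  unfolding fills_upto_def
proof (intro allI impI extendableI)
  fix m f assume "m \<le> n" and f: "continuous_on (cube_boundary m) f" "f \<in> cube_boundary m \<rightarrow> T"
  have "extendable (cube m) (cube_boundary m) S" using assms \<open>m \<le> n\<close> by (simp add: fills_upto_def)
  moreover have "f \<in> cube_boundary m \<rightarrow> S" using f(2) assms(4) by auto
  ultimately obtain g where g: "continuous_on (cube m) g" "g \<in> cube m \<rightarrow> S"
      "\<And>x. x \<in> cube_boundary m \<Longrightarrow> g x = f x"
    using f(1) by (metis extendableE)
  have "continuous_on (cube m) (\<lambda>x. r (g x))"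
    by (rule continuous_on_compose2[OF assms(2) g(1)]) (use g(2) in auto)
  moreover have "(\<lambda>x. r (g x)) \<in> cube m \<rightarrow> T" using g(2) assms(3) by auto
  moreover have "\<forall>x\<in>cube_boundary m. r (g x) = f x" using g(3) f(2) assms(5) by auto
  ultimately show "\<exists>g. continuous_on (cube m) g \<and> g \<in> cube m \<rightarrow> T \<and> (\<forall>x\<in>cube_boundary m. g x = f x)" by blast
qed

definition realization :: "'a set set \<Rightarrow> ('a \<Rightarrow> real) set" where
  "realization K = {x. (\<forall>v. 0 \<le> x v) \<and> finite {v. x v \<noteq> 0} \<and> {v. x v \<noteq> 0} \<in> K \<and> (\<Sum>v | x v \<noteq> 0. x v) = 1}"

lemma mem_realization_iff:
  assumes "finite V" "K \<subseteq> Pow V"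
  shows "x \<in> realization K \<longleftrightarrow> (\<forall>v. 0 \<le> x v) \<and> {v. x v \<noteq> 0} \<in> K \<and> (\<Sum>v\<in>V. x v) = 1"
proof -
  have "finite {v. x v \<noteq> 0} \<and> (\<Sum>v | x v \<noteq> 0. x v) = (\<Sum>v\<in>V. x v)" if "{v. x v \<noteq> 0} \<in> K"
  proof -
    have s: "{v. x v \<noteq> 0} \<subseteq> V" using that assms(2) by blast
    then have "(\<Sum>v | x v \<noteq> 0. x v) = (\<Sum>v\<in>V. x v)" by (intro sum.mono_neutral_left assms(1)) auto
    then show ?thesis using s assms(1) finite_subset by auto
  qed
  then show ?thesis by (auto simp: realization_def)
qed

locale simplicial_complex =
  fixes V :: "'a set" and K :: "'a set set"
  assumes finite_V: "finite V" and K_sub: "K \<subseteq> Pow V"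
    and K_down: "\<And>s t. s \<in> K \<Longrightarrow> t \<subseteq> s \<Longrightarrow> t \<in> K"
begin

lemma mem_iff: "x \<in> realization K \<longleftrightarrow> (\<forall>v. 0 \<le> x v) \<and> {v. x v \<noteq> 0} \<in> K \<and> (\<Sum>v\<in>V. x v) = 1"
  using mem_realization_iff[OF finite_V K_sub] .

lemma segment_in_realization:
  assumes x: "x \<in> realization K" and y: "y \<in> realization K"
    and "{v. x v \<noteq> 0} \<union> {v. y v \<noteq> 0} \<in> K" and "0 \<le> t" "t \<le> 1"
  shows "(\<lambda>v. (1 - t) * x v + t * y v) \<in> realization K"
proof -
  let ?z = "\<lambda>v. (1 - t) * x v + t * y v"
  have "0 \<le> ?z v" for v using assms by (simp add: mem_iff)
  moreover have "{v. ?z v \<noteq> 0} \<in> K" by (rule K_down[OF assms(3)]) auto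
  moreover have "(\<Sum>v\<in>V. ?z v) = (1 - t) * (\<Sum>v\<in>V. x v) + t * (\<Sum>v\<in>V. y v)"
    by (simp add: sum.distrib sum_distrib_left)
  ultimately show ?thesis using x y by (simp add: mem_iff)
qed

lemma fills_upto_cone:
  assumes "w \<in> V" and cone: "\<And>s. s \<in> K \<Longrightarrow> insert w s \<in> K" and "K \<noteq> {}"
  shows "fills_upto n (realization K)"
proof (rule fills_upto_starlike)
  let ?c = "\<lambda>v. if v = w then 1 else 0 :: real"
  obtain s where "s \<in> K" using \<open>K \<noteq> {}\<close> by blast
  then have "{w} \<in> K" using cone[of s] K_down[of "insert w s" "{w}"] by auto
  then show c: "?c \<in> realization K" using \<open>w \<in> V\<close> finite_V by (simp add: mem_iff)
  fix x and t :: real assume x: "x \<in> realization K" and t: "0 \<le> t" "t \<le> 1"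
  have "insert w {v. x v \<noteq> 0} \<in> K" using x cone by (simp add: mem_iff)
  moreover have "{v. ?c v \<noteq> 0} \<union> {v. x v \<noteq> 0} = insert w {v. x v \<noteq> 0}" by auto
  ultimately show "(\<lambda>v. (1 - t) * ?c v + t * x v) \<in> realization K"
    by (intro segment_in_realization c x t) simp
qed

text \<open>Without the midpoint of the edge \<open>uv\<close>, the open star of this edge is covered by two open halves,
  one near \<open>u\<close> and one near \<open>v\<close>. Each half is starlike with respect to a point of the edge.\<close>

lemma fills_upto_half_edge_star:
  assumes uv: "u \<noteq> v" "{u, v} \<in> K"
  shows "fills_upto n {x\<in>realization K. 0 < x u \<and> 0 < x v \<and> x v < 1 / 2}"
proof (rule fills_upto_starlike)
  have V: "u \<in> V" "v \<in> V" using uv K_sub by auto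
  let ?c = "\<lambda>w. if w = u then 3 / 4 else if w = v then 1 / 4 else 0 :: real"
  have "{w. ?c w \<noteq> 0} = {u, v}" by auto
  moreover have "(\<Sum>w\<in>V. ?c w) = (\<Sum>w\<in>{u, v}. ?c w)"
    using V by (intro sum.mono_neutral_right finite_V) auto
  ultimately have c: "?c \<in> realization K" using uv by (simp add: mem_iff)
  then show "?c \<in> {x\<in>realization K. 0 < x u \<and> 0 < x v \<and> x v < 1 / 2}" using uv by simp
  fix x and t :: real assume x: "x \<in> {x\<in>realization K. 0 < x u \<and> 0 < x v \<and> x v < 1 / 2}" and t: "0 \<le> t" "t \<le> 1"
  let ?z = "\<lambda>w. (1 - t) * ?c w + t * x w"
  have "{w. ?c w \<noteq> 0} \<union> {w. x w \<noteq> 0} = {w. x w \<noteq> 0}" using x by auto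
  then have z: "?z \<in> realization K"
    using x by (intro segment_in_realization c t) (auto simp: mem_iff)
  have *: "a < (1 - t) * b + t * d" if "a < b" "a < d" for a b d :: real
    using convex_bound_lt[of "- b" "- a" "- d" "1 - t" t] that t by (simp add: algebra_simps)
  have **: "(1 - t) * b + t * d < a" if "b < a" "d < a" for a b d :: real
    using convex_bound_lt[of "b" "a" "d" "1 - t" t] that t by simp
  show "?z \<in> {x\<in>realization K. 0 < x u \<and> 0 < x v \<and> x v < 1 / 2}"
    using z x uv *[of 0 "3/4" "x u"] *[of 0 "1/4" "x v"] **[of "1/4" "1/2" "x v"] by simp
qed

text \<open>The two halves of the punctured open star meet in the product of the link with an open square:
  a point is determined by its coordinates at \<open>u\<close> and \<open>v\<close>, which vary in a convex set, and by the
  remaining coordinates, which are normalized to a point of the link.\<close>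

lemma fills_upto_link_times_square:
  assumes uv: "u \<noteq> v" "{u, v} \<in> K" 
    and link: "fills_upto n (realization {s. s \<inter> {u, v} = {} \<and> s \<union> {u, v} \<in> K})"
  shows "fills_upto n {x\<in>realization K. 0 < x u \<and> x u < 1 / 2 \<and> 0 < x v \<and> x v < 1 / 2}"
    (is "fills_upto n ?D")
  unfolding fills_upto_def
proof (intro allI impI extendableI)
  define L where "L = {s. s \<inter> {u, v} = {} \<and> s \<union> {u, v} \<in> K}"
  have V: "u \<in> V" "v \<in> V" using uv K_sub by auto
  have LV: "L \<subseteq> Pow V" using K_sub by (auto simp: L_def)
  note L_iff = mem_realization_iff[OF finite_V LV]
  have sumV: "(\<Sum>w\<in>V. x w) = x u + x v + (\<Sum>w\<in>V - {u, v}. x w)" for x :: "'a \<Rightarrow> real"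
    using sum.subset_diff[of "{u, v}" V x] V finite_V uv by simp
  fix m f assume "m \<le> n" and f: "continuous_on (cube_boundary m) f" "f \<in> cube_boundary m \<rightarrow> ?D"
  define \<pi> where "\<pi> = (\<lambda>x w. if w = u \<or> w = v then 0 else x w / (1 - x u - x v :: real))"
  define \<sigma> where "\<sigma> = (\<lambda>x w. if w = u \<or> w = v then x w else (0::real))"
  define Q where "Q = {x. 0 < x u \<and> x u < 1 / 2 \<and> 0 < x v \<and> x v < 1 / 2 \<and> (\<forall>w. w \<noteq> u \<and> w \<noteq> v \<longrightarrow> x w = (0::real))}"
  have fc: "continuous_on (cube_boundary m) (\<lambda>x. f x w)" for w
    using f(1) by (rule continuous_on_product_then_coordinatewise)
  have fD: "f x \<in> ?D" if "x \<in> cube_boundary m" for x using f(2) that by blast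
  have pos: "0 < 1 - x u - x v" if "x \<in> ?D" for x using that by auto
  have "continuous_on (cube_boundary m) (\<lambda>x. \<pi> (f x))"
  proof (rule continuous_on_coordinatewise_then_product)
    fix w
    have ne: "\<forall>x\<in>cube_boundary m. 1 - f x u - f x v \<noteq> 0" using pos fD by fastforce
    show "continuous_on (cube_boundary m) (\<lambda>x. \<pi> (f x) w)"
      by (cases "w = u \<or> w = v")
         (auto simp: \<pi>_def intro!: continuous_on_divide continuous_on_diff fc continuous_on_const ne[rule_format])
  qed
  moreover have "(\<lambda>x. \<pi> (f x)) \<in> cube_boundary m \<rightarrow> realization L"
  proof
    fix x0 assume "x0 \<in> cube_boundary m"
    then have x: "f x0 \<in> ?D" by (rule fD)
    let ?x = "f x0"
    have "{w. \<pi> ?x w \<noteq> 0} = {w. ?x w \<noteq> 0} - {u, v}" using pos[OF x] by (auto simp: \<pi>_def)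
    moreover have "({w. ?x w \<noteq> 0} - {u, v}) \<union> {u, v} = {w. ?x w \<noteq> 0}" using x by auto
    ultimately have "{w. \<pi> ?x w \<noteq> 0} \<in> L" using x by (simp add: L_def mem_iff)
    moreover have "(\<Sum>w\<in>V. \<pi> ?x w) = 1"
    proof -
      have "(\<Sum>w\<in>V. \<pi> ?x w) = (\<Sum>w\<in>V - {u, v}. ?x w / (1 - ?x u - ?x v))"
        unfolding sumV[of "\<pi> ?x"] by (simp add: \<pi>_def)
      also have "\<dots> = (1 - ?x u - ?x v) / (1 - ?x u - ?x v)"
        using x sumV[of ?x] unfolding sum_divide_distrib[symmetric] by (simp add: mem_iff)
      finally show ?thesis using pos[OF x] by simp
    qed
    ultimately show "\<pi> ?x \<in> realization L"
      using x pos[OF x] by (simp add: L_iff \<pi>_def mem_iff)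
  qed
  moreover have "extendable (cube m) (cube_boundary m) (realization L)"
    using link \<open>m \<le> n\<close> by (simp add: fills_upto_def L_def)
  ultimately obtain g where g: "continuous_on (cube m) g" "g \<in> cube m \<rightarrow> realization L"
      "\<And>x. x \<in> cube_boundary m \<Longrightarrow> g x = \<pi> (f x)"
    by (metis extendableE)
  have "fills_upto n Q"
  proof (rule fills_upto_starlike)
    show "(\<lambda>w. if w = u \<or> w = v then 1 / 4 else 0) \<in> Q" by (auto simp: Q_def)
    fix x and t :: real assume x: "x \<in> Q" and t: "0 \<le> t" "t \<le> 1"
    have *: "a < (1 - t) * b + t * d" if "a < b" "a < d" for a b d :: real
      using convex_bound_lt[of "- b" "- a" "- d" "1 - t" t] that t by (simp add: algebra_simps)
    have **: "(1 - t) * b + t * d < a" if "b < a" "d < a" for a b d :: real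
      using convex_bound_lt[of "b" "a" "d" "1 - t" t] that t by simp
    show "(\<lambda>w. (1 - t) * (if w = u \<or> w = v then 1 / 4 else 0) + t * x w) \<in> Q"
      using x *[of 0 "1/4" "x u"] *[of 0 "1/4" "x v"] **[of "1/4" "1/2" "x v"] **[of "1/4" "1/2" "x u"]
      by (simp add: Q_def)
  qed
  then have "extendable (cube m) (cube_boundary m) Q" using \<open>m \<le> n\<close> by (simp add: fills_upto_def)
  moreover have "continuous_on (cube_boundary m) (\<lambda>x. \<sigma> (f x))"
  proof (rule continuous_on_coordinatewise_then_product)
    show "continuous_on (cube_boundary m) (\<lambda>x. \<sigma> (f x) w)" for w
      by (cases "w = u \<or> w = v") (auto simp: \<sigma>_def intro!: fc)
  qed
  moreover have "(\<lambda>x. \<sigma> (f x)) \<in> cube_boundary m \<rightarrow> Q" using fD by (auto simp: Q_def \<sigma>_def)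
  ultimately obtain h where h: "continuous_on (cube m) h" "h \<in> cube m \<rightarrow> Q"
      "\<And>x. x \<in> cube_boundary m \<Longrightarrow> h x = \<sigma> (f x)"
    by (metis extendableE)
  define G where "G = (\<lambda>x w. if w = u \<or> w = v then h x w else (1 - h x u - h x v) * g x w)"
  have hc: "continuous_on (cube m) (\<lambda>x. h x w)" and gc: "continuous_on (cube m) (\<lambda>x. g x w)" for w
    using g(1) h(1) by (auto intro: continuous_on_product_then_coordinatewise)
  have "continuous_on (cube m) G"
  proof (rule continuous_on_coordinatewise_then_product)
    show "continuous_on (cube m) (\<lambda>x. G x w)" for w
      by (cases "w = u \<or> w = v")
         (auto simp: G_def intro!: continuous_on_mult continuous_on_diff hc gc continuous_on_const)
  qed
  moreover have "G \<in> cube m \<rightarrow> ?D"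
  proof
    fix x assume x: "x \<in> cube m"
    then have hx: "h x \<in> Q" and gx: "g x \<in> realization L" using g h by auto
    then have p: "0 < 1 - h x u - h x v" and q: "0 < h x u" "h x u < 1/2" "0 < h x v" "h x v < 1/2" by (auto simp: Q_def)
    have gL: "{w. g x w \<noteq> 0} \<in> L" using gx by (simp add: L_iff)
    then have g0: "g x u = 0" "g x v = 0" by (auto simp: L_def)
    have "{w. G x w \<noteq> 0} = {w. g x w \<noteq> 0} \<union> {u, v}" using p q by (auto simp: G_def)
    then have "{w. G x w \<noteq> 0} \<in> K" using gL by (simp add: L_def)
    moreover have "(\<Sum>w\<in>V. G x w) = 1"
    proof -
      have "(\<Sum>w\<in>V - {u, v}. G x w) = (\<Sum>w\<in>V - {u, v}. (1 - h x u - h x v) * g x w)"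
        by (intro sum.cong) (auto simp: G_def)
      also have "\<dots> = (1 - h x u - h x v) * (\<Sum>w\<in>V. g x w)"
        using g0 by (simp add: sumV[of "g x"] flip: sum_distrib_left)
      also have "\<dots> = 1 - h x u - h x v" using gx by (simp add: L_iff)
      finally show ?thesis unfolding sumV[of "G x"] by (simp add: G_def)
    qed
    moreover have "0 \<le> G x w" for w using gx p q by (auto simp: G_def L_iff)
    ultimately show "G x \<in> ?D" using q by (simp add: mem_iff G_def)
  qed
  moreover have "G x = f x" if x: "x \<in> cube_boundary m" for x
  proof
    fix w
    show "G x w = f x w" using pos[OF fD[OF x]] by (auto simp: G_def g(3)[OF x] h(3)[OF x] \<sigma>_def \<pi>_def)
  qed
  ultimately show "\<exists>g. continuous_on (cube m) g \<and> g \<in> cube m \<rightarrow> ?D \<and> (\<forall>x\<in>cube_boundary m. g x = f x)" by blast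
qed

lemma openin_coord:
  fixes X :: "('a \<Rightarrow> real) set"
  shows "openin (top_of_set X) {x\<in>X. a < x u}" "openin (top_of_set X) {x\<in>X. x u < a}"
proof -
  have "open {x::'a \<Rightarrow> real. a < x u}" "open {x::'a \<Rightarrow> real. x u < a}"
    by (intro open_Collect_less continuous_on_coord continuous_on_const)+
  then show "openin (top_of_set X) {x\<in>X. a < x u}" "openin (top_of_set X) {x\<in>X. x u < a}"
    by (auto simp: openin_open Int_def)
qed

text \<open>Let \<open>U\<close> be the realization without the midpoint of the edge \<open>uv\<close> and \<open>W\<close> the open star of the
  edge. The set \<open>U \<inter> W\<close> is, up to homotopy, the suspension of the link, since it is the union of two
  contractible halves that meet in a copy of the link times a square; so it is one degree more
  connected than the link. Hence \<open>U\<close> is as connected as \<open>U \<union> W\<close>, the realization of \<open>K\<close>. Pushing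
  away from the midpoint, that is, decreasing both coordinates by their minimum and normalizing,
  retracts \<open>U\<close> to the subcomplex of simplices that do not contain the edge.\<close>

theorem meshulam_complex:
  assumes uv: "u \<noteq> v" "{u, v} \<in> K" and "n > 0"
    and K: "fills_upto n (realization K)"
    and link: "fills_upto (n - 1) (realization {s. s \<inter> {u, v} = {} \<and> s \<union> {u, v} \<in> K})"
  shows "fills_upto n (realization {s\<in>K. \<not> {u, v} \<subseteq> s})"
proof -
  let ?X = "realization K"
  let ?A = "realization {s\<in>K. \<not> {u, v} \<subseteq> s}"
  have V: "u \<in> V" "v \<in> V" using uv K_sub by auto
  define U where "U = {x\<in>?X. x u < 1 / 2 \<or> x v < 1 / 2}"
  define W where "W = {x\<in>?X. 0 < x u \<and> 0 < x v}"
  define U1 where "U1 = {x\<in>?X. 0 < x u \<and> 0 < x v \<and> x v < 1 / 2}"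
  define U2 where "U2 = {x\<in>?X. 0 < x v \<and> 0 < x u \<and> x u < 1 / 2}"
  have X: "U \<union> W = ?X" by (force simp: U_def W_def mem_iff not_less)
  have UW: "U1 \<union> U2 = U \<inter> W" by (auto simp: U_def W_def U1_def U2_def)
  have o1: "openin (top_of_set ?X) U"
  proof -
    have "U = {x\<in>?X. x u < 1 / 2} \<union> {x\<in>?X. x v < 1 / 2}" by (auto simp: U_def)
    then show ?thesis using openin_Un[OF openin_coord(2)[of ?X u "1/2"] openin_coord(2)[of ?X v "1/2"]] by simp
  qed
  have o2: "openin (top_of_set ?X) W"
  proof -
    have "W = {x\<in>?X. 0 < x u} \<inter> {x\<in>?X. 0 < x v}" by (auto simp: W_def)
    then show ?thesis using openin_Int[OF openin_coord(1)[of ?X 0 u] openin_coord(1)[of ?X 0 v]] by simp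
  qed
  have o3: "openin (top_of_set (U1 \<union> U2)) U1"
  proof -
    have "U1 = {x\<in>U1 \<union> U2. x v < 1 / 2}" by (auto simp: U1_def U2_def)
    then show ?thesis using openin_coord(2)[of "U1 \<union> U2" v "1/2"] by simp
  qed
  have o4: "openin (top_of_set (U1 \<union> U2)) U2"
  proof -
    have "U2 = {x\<in>U1 \<union> U2. x u < 1 / 2}" by (auto simp: U1_def U2_def)
    then show ?thesis using openin_coord(2)[of "U1 \<union> U2" u "1/2"] by simp
  qed
  have f1: "fills_upto n U1" unfolding U1_def using fills_upto_half_edge_star[OF uv] .
  have f2: "fills_upto n U2" unfolding U2_def using fills_upto_half_edge_star[of v u] uv by (simp add: insert_commute)
  have "U1 \<inter> U2 = {x\<in>?X. 0 < x u \<and> x u < 1 / 2 \<and> 0 < x v \<and> x v < 1 / 2}" by (auto simp: U1_def U2_def)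
  then have "fills_upto (n - 1) (U1 \<inter> U2)" using fills_upto_link_times_square[OF uv link] by simp
  then have "fills_upto n (U \<inter> W)" using fills_upto_Un[OF o3 o4 f1 f2] UW by simp
  then have fU: "fills_upto n U" using fills_upto_open_part[of U W n] o1 o2 K X by simp
  have A_sub: "{s\<in>K. \<not> {u, v} \<subseteq> s} \<subseteq> Pow V" using K_sub by auto
  note A_iff = mem_realization_iff[OF finite_V A_sub]
  have A_iff': "x \<in> ?A \<longleftrightarrow> x \<in> ?X \<and> (x u = 0 \<or> x v = 0)" for x
    unfolding A_iff mem_iff by auto
  define r where "r = (\<lambda>x w. (x w - (if w = u \<or> w = v then min (x u) (x v) else 0)) / (1 - 2 * min (x u) (x v) :: real))"
  have den: "0 < 1 - 2 * min (x u) (x v)" if "x \<in> U" for x using that by (auto simp: U_def min_def)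
  show ?thesis
  proof (rule fills_upto_retract[OF fU])
    show "continuous_on U r"
    proof (rule continuous_on_coordinatewise_then_product)
      have ne: "\<forall>x\<in>U. 1 - 2 * min (x u) (x v) \<noteq> 0" using den by fastforce
      show "continuous_on U (\<lambda>x. r x w)" for w
        unfolding r_def
        by (cases "w = u \<or> w = v")
           (auto intro!: continuous_on_divide continuous_on_diff continuous_on_min continuous_on_mult
             continuous_on_coord continuous_on_const ne[rule_format])
    qed
    show "r \<in> U \<rightarrow> ?A"
    proof
      fix x assume x: "x \<in> U"
      define h where "h = min (x u) (x v)"
      have d: "0 < 1 - 2 * h" using den[OF x] by (simp add: h_def)
      have xX: "x \<in> ?X" using x by (simp add: U_def)
      then have h: "h \<ge> 0" "h \<le> x u" "h \<le> x v" by (auto simp: h_def mem_iff)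
      have rx: "r x w = (x w - (if w = u \<or> w = v then h else 0)) / (1 - 2 * h)" for w
        by (simp add: r_def h_def)
      have "{w. r x w \<noteq> 0} \<subseteq> {w. x w \<noteq> 0}" using h by (auto simp: rx)
      then have "{w. r x w \<noteq> 0} \<in> K" using xX K_down by (auto simp: mem_iff)
      moreover have "(\<Sum>w\<in>V. r x w) = 1"
      proof -
        have "(\<Sum>w\<in>V. if w = u \<or> w = v then h else 0) = (\<Sum>w\<in>{u, v}. h)"
          using V by (intro sum.mono_neutral_cong_right finite_V) auto
        then have "(\<Sum>w\<in>V. r x w) = (1 - 2 * h) / (1 - 2 * h)"
          using xX uv by (simp add: rx sum_subtractf mem_iff flip: sum_divide_distrib)
        then show ?thesis using d by simp
      qed
      moreover have "0 \<le> r x w" for w using xX h d by (auto simp: rx mem_iff)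
      moreover have "r x u = 0 \<or> r x v = 0" by (auto simp: rx h_def min_def)
      ultimately show "r x \<in> ?A" unfolding A_iff' mem_iff by blast
    qed
    show "?A \<subseteq> U"
    proof
      fix x assume "x \<in> ?A"
      then show "x \<in> U" unfolding A_iff' U_def by auto
    qed
    show "r x = x" if "x \<in> ?A" for x
    proof
      fix w
      have "min (x u) (x v) = 0" using that unfolding A_iff' mem_iff by (metis min.absorb1 min.absorb2)
      then show "r x w = x w" by (simp add: r_def)
    qed
  qed
qed

end

section \<open>Meshulam's theorem\<close>

definition simple_graph :: "('a, 'a set) mgraph \<Rightarrow> bool" where
  "simple_graph J \<longleftrightarrow> finite (verts J) \<and> ends J = id \<and> (\<forall>\<epsilon>\<in>edges J. \<epsilon> \<subseteq> verts J \<and> card \<epsilon> = 2)"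

definition delete_edge :: "('a, 'a set) mgraph \<Rightarrow> 'a set \<Rightarrow> ('a, 'a set) mgraph" where
  "delete_edge J \<epsilon> = J\<lparr>edges := edges J - {\<epsilon>}\<rparr>"

text \<open>The vertices that survive when the edge \<open>ab\<close> explodes, which kills \<open>a\<close>, \<open>b\<close> and all their
  neighbours.\<close>

definition far_verts :: "('a, 'a set) mgraph \<Rightarrow> 'a \<Rightarrow> 'a \<Rightarrow> 'a set" where
  "far_verts J a b = {w \<in> verts J. w \<noteq> a \<and> w \<noteq> b \<and> \<not> adjacent_in J a w \<and> \<not> adjacent_in J b w}"

definition explode_edge :: "('a, 'a set) mgraph \<Rightarrow> 'a \<Rightarrow> 'a \<Rightarrow> ('a, 'a set) mgraph" where
  "explode_edge J a b = J\<lparr>verts := far_verts J a b, edges := {\<epsilon>\<in>edges J. \<epsilon> \<subseteq> far_verts J a b}\<rparr>"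

lemma simple_graph_delete_edge: "simple_graph J \<Longrightarrow> simple_graph (delete_edge J \<epsilon>)"
  by (auto simp: simple_graph_def delete_edge_def)

lemma simple_graph_explode_edge: "simple_graph J \<Longrightarrow> simple_graph (explode_edge J a b)"
  by (auto simp: simple_graph_def explode_edge_def far_verts_def)

lemma simple_graph_edgeE:
  assumes "simple_graph J" "\<epsilon> \<in> edges J" "a \<in> \<epsilon>"
  obtains b where "\<epsilon> = {a, b}" "a \<noteq> b"
proof -
  have "card \<epsilon> = 2" using assms by (simp add: simple_graph_def)
  then show ?thesis using that assms(3) by (auto simp: card_2_iff)
qed

lemma geometric_realization_eq:
  "geometric_realization K = subtopology (powertop_real UNIV) (realization K)"
  by (simp add: geometric_realization_def realization_def)

lemma independence_complex_iff:
  "simple_graph J \<Longrightarrow> s \<in> independence_complex J \<longleftrightarrow> s \<subseteq> verts J \<and> (\<forall>\<epsilon>\<in>edges J. \<not> \<epsilon> \<subseteq> s)"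
  by (simp add: independence_complex_def simple_graph_def)

lemma simplicial_complex_independence_complex:
  "simple_graph J \<Longrightarrow> simplicial_complex (verts J) (independence_complex J)"
  unfolding independence_complex_def simple_graph_def by unfold_locales (simp, blast, blast)

text \<open>Deleting the edge \<open>ab\<close> from the graph adds to the independence complex the simplices that contain
  both \<open>a\<close> and \<open>b\<close>. So the edge can be removed from the larger complex again, and its link
  there is the independence complex after exploding the edge.\<close>

theorem meshulam:
  assumes J: "simple_graph J" and ab: "adjacent_in J a b" and "0 \<le> k"
    and del: "k_connected k (geometric_realization (independence_complex (delete_edge J {a, b})))"
    and expl: "k_connected (k - 1) (geometric_realization (independence_complex (explode_edge J a b)))"
  shows "k_connected k (geometric_realization (independence_complex J))"
proof -
  define K where "K = independence_complex (delete_edge J {a, b})"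
  note J' = simple_graph_delete_edge[OF J, of "{a, b}"]
  note J'' = simple_graph_explode_edge[OF J, of a b]
  have abJ: "{a, b} \<in> edges J" using ab by (simp add: adjacent_in_def)
  then have "{a, b} \<subseteq> verts J" "card {a, b} = 2" using J by (auto simp: simple_graph_def)
  then have ne: "a \<noteq> b" by (auto simp: card_2_iff)
  interpret simplicial_complex "verts J" K
    using simplicial_complex_independence_complex[OF J'] by (simp add: K_def delete_edge_def)
  have K_iff: "s \<in> K \<longleftrightarrow> s \<subseteq> verts J \<and> (\<forall>\<epsilon>\<in>edges J. \<epsilon> \<noteq> {a, b} \<longrightarrow> \<not> \<epsilon> \<subseteq> s)" for s
    unfolding K_def independence_complex_iff[OF J'] by (auto simp: delete_edge_def)
  have "{a, b} \<in> K"
    unfolding K_iff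
  proof (intro conjI ballI impI notI)
    fix \<epsilon> assume "\<epsilon> \<in> edges J" "\<epsilon> \<noteq> {a, b}" "\<epsilon> \<subseteq> {a, b}"
    then have "card \<epsilon> = card {a, b}" using J ne by (simp add: simple_graph_def)
    then show False using \<open>\<epsilon> \<subseteq> {a, b}\<close> \<open>\<epsilon> \<noteq> {a, b}\<close> card_subset_eq[of "{a, b}" \<epsilon>] by simp
  qed fact
  have indJ: "{s\<in>K. \<not> {a, b} \<subseteq> s} = independence_complex J"
    by (rule set_eqI, unfold mem_Collect_eq K_iff independence_complex_iff[OF J]) (use abJ in metis)
  have ind_expl: "s \<in> independence_complex (explode_edge J a b) \<longleftrightarrow>
      s \<subseteq> far_verts J a b \<and> (\<forall>\<epsilon>\<in>edges J. \<epsilon> \<subseteq> far_verts J a b \<longrightarrow> \<not> \<epsilon> \<subseteq> s)" for s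
    unfolding independence_complex_iff[OF J''] by (auto simp: explode_edge_def)
  have link: "{s. s \<inter> {a, b} = {} \<and> s \<union> {a, b} \<in> K} = independence_complex (explode_edge J a b)"
  proof (intro set_eqI iffI)
    fix s assume "s \<in> {s. s \<inter> {a, b} = {} \<and> s \<union> {a, b} \<in> K}"
    then have s: "a \<notin> s" "b \<notin> s" "s \<subseteq> verts J"
      and nE: "\<And>\<epsilon>. \<epsilon> \<in> edges J \<Longrightarrow> \<epsilon> \<noteq> {a, b} \<Longrightarrow> \<not> \<epsilon> \<subseteq> s \<union> {a, b}"
      by (auto simp: K_iff)
    have "w \<in> far_verts J a b" if "w \<in> s" for w
    proof -
      have "w \<noteq> a" "w \<noteq> b" using s that by auto
      moreover have "{a, w} \<notin> edges J" using nE[of "{a, w}"] that \<open>w \<noteq> b\<close> \<open>w \<noteq> a\<close> by (auto simp: doubleton_eq_iff)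
      moreover have "{b, w} \<notin> edges J" using nE[of "{b, w}"] that \<open>w \<noteq> b\<close> \<open>w \<noteq> a\<close> by (auto simp: doubleton_eq_iff)
      ultimately show ?thesis using s that by (auto simp: far_verts_def adjacent_in_def)
    qed
    moreover have "\<not> \<epsilon> \<subseteq> s" if "\<epsilon> \<in> edges J" for \<epsilon> using nE[OF that] s by auto
    ultimately show "s \<in> independence_complex (explode_edge J a b)"
      unfolding ind_expl by blast
  next
    fix s assume "s \<in> independence_complex (explode_edge J a b)"
    then have s: "s \<subseteq> far_verts J a b" and nE: "\<And>\<epsilon>. \<epsilon> \<in> edges J \<Longrightarrow> \<epsilon> \<subseteq> far_verts J a b \<Longrightarrow> \<not> \<epsilon> \<subseteq> s"
      unfolding ind_expl by simp_all
    have "\<not> \<epsilon> \<subseteq> s \<union> {a, b}" if \<epsilon>: "\<epsilon> \<in> edges J" "\<epsilon> \<noteq> {a, b}" for \<epsilon>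
    proof
      assume sub: "\<epsilon> \<subseteq> s \<union> {a, b}"
      have "a \<notin> \<epsilon>"
      proof
        assume "a \<in> \<epsilon>"
        then obtain w where w: "\<epsilon> = {a, w}" "a \<noteq> w" using simple_graph_edgeE[OF J \<epsilon>(1)] by blast
        then have "w \<in> s" using sub \<epsilon> by auto
        then show False using s w \<epsilon> by (auto simp: far_verts_def adjacent_in_def)
      qed
      moreover have "b \<notin> \<epsilon>"
      proof
        assume "b \<in> \<epsilon>"
        then obtain w where w: "\<epsilon> = {b, w}" "b \<noteq> w" using simple_graph_edgeE[OF J \<epsilon>(1)] by blast
        then have "w \<in> s" using sub \<epsilon> by (auto simp: insert_commute)
        then show False using s w \<epsilon> by (auto simp: far_verts_def adjacent_in_def)
      qed
      ultimately have "\<epsilon> \<subseteq> s" using sub by auto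
      then show False using nE[OF \<epsilon>(1)] s by blast
    qed
    moreover have "s \<inter> {a, b} = {}" "s \<union> {a, b} \<subseteq> verts J"
      using s \<open>{a, b} \<subseteq> verts J\<close> by (auto simp: far_verts_def)
    ultimately show "s \<in> {s. s \<inter> {a, b} = {} \<and> s \<union> {a, b} \<in> K}" by (simp add: K_iff)
  qed
  have "fills_upto (nat (k + 1)) (realization (independence_complex J))"
    unfolding indJ[symmetric]
  proof (rule meshulam_complex[OF ne \<open>{a, b} \<in> K\<close>])
    show "0 < nat (k + 1)" using \<open>0 \<le> k\<close> by simp
    show "fills_upto (nat (k + 1)) (realization K)"
      using del \<open>0 \<le> k\<close> by (simp add: K_def geometric_realization_eq k_connected_iff_fills_upto)
    have "nat (k + 1) - 1 = nat ((k - 1) + 1)" using \<open>0 \<le> k\<close> by simp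
    moreover have "fills_upto (nat ((k - 1) + 1)) (realization (independence_complex (explode_edge J a b)))"
      using expl \<open>0 \<le> k\<close> by (subst k_connected_iff_fills_upto[symmetric]) (auto simp: geometric_realization_eq)
    ultimately show "fills_upto (nat (k + 1) - 1) (realization {s. s \<inter> {a, b} = {} \<and> s \<union> {a, b} \<in> K})"
      unfolding link by simp
  qed
  then show ?thesis using \<open>0 \<le> k\<close> by (simp add: geometric_realization_eq k_connected_iff_fills_upto)
qed

text \<open>The independence complex is a cone with the isolated vertex as its apex.\<close>

lemma k_connected_isolated_vertex:
  assumes J: "simple_graph J" and m: "m \<in> verts J" and iso: "\<And>b. \<not> adjacent_in J b m" and "- 1 \<le> k"
  shows "k_connected k (geometric_realization (independence_complex J))"
proof -
  interpret simplicial_complex "verts J" "independence_complex J"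
    by (rule simplicial_complex_independence_complex[OF J])
  have mE: "m \<notin> \<epsilon>" if E: "\<epsilon> \<in> edges J" for \<epsilon>
  proof
    assume "m \<in> \<epsilon>"
    then obtain w where "\<epsilon> = {m, w}" using simple_graph_edgeE[OF J E] by blast
    then show False using iso[of w] E by (simp add: adjacent_in_def insert_commute)
  qed
  have "\<epsilon> \<noteq> {}" if "\<epsilon> \<in> edges J" for \<epsilon> using J that by (fastforce simp: simple_graph_def)
  then have "{} \<in> independence_complex J" by (simp add: independence_complex_iff[OF J])
  then have "fills_upto (nat (k + 1)) (realization (independence_complex J))"
  proof (intro fills_upto_cone[OF m])
    show "insert m s \<in> independence_complex J" if "s \<in> independence_complex J" for s
      using that m mE by (auto simp: independence_complex_iff[OF J] subset_insert)
  qed auto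
  then show ?thesis using \<open>- 1 \<le> k\<close> by (simp add: geometric_realization_eq k_connected_iff_fills_upto)
qed

section \<open>Source components of digraphs\<close>

lemma rtrancl_leaves_set:
  assumes "(x, y) \<in> r\<^sup>*" "x \<in> A" "y \<notin> A"
  shows "\<exists>u v. (u, v) \<in> r \<and> u \<in> A \<and> v \<notin> A"
  using assms by (induction rule: rtrancl_induct) auto

definition strongly_connected :: "'a rel \<Rightarrow> 'a set \<Rightarrow> bool" where
  "strongly_connected R A \<longleftrightarrow> (\<forall>x\<in>A. \<forall>y\<in>A. (x, y) \<in> (R \<inter> A \<times> A)\<^sup>*)"

text \<open>The last ear of an ear decomposition. Take a maximal proper strongly connected subset \<open>C\<close> of \<open>Y\<close>
  and a path that leaves \<open>C\<close> and first returns to it by the arc \<open>(p, q)\<close>. By maximality this path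
  and \<open>C\<close> exhaust \<open>Y\<close>, so from \<open>q\<close> everything but \<open>p\<close> can be reached through \<open>C\<close> and along the
  path, up to its last vertex \<open>p\<close>.\<close>

lemma strongly_connected_ear:
  assumes "finite Y" and Y: "strongly_connected R Y" and "a \<in> Y" "b \<in> Y" "a \<noteq> b"
  obtains p q where "p \<in> Y" "q \<in> Y" "(p, q) \<in> R" "p \<noteq> q"
    "\<And>y. y \<in> Y - {p} \<Longrightarrow> (q, y) \<in> (R \<inter> (Y - {p}) \<times> (Y - {p}))\<^sup>*"
proof -
  let ?\<C> = "{C. C \<subset> Y \<and> C \<noteq> {} \<and> strongly_connected R C}"
  have "{a} \<in> ?\<C>" using assms by (auto simp: strongly_connected_def)
  moreover have "finite ?\<C>" using \<open>finite Y\<close> by (auto intro: finite_subset[of _ "Pow Y"])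
  ultimately obtain C where C: "C \<in> ?\<C>" and max: "\<And>D. D \<in> ?\<C> \<Longrightarrow> C \<subseteq> D \<Longrightarrow> C = D"
    using finite_has_maximal[of ?\<C>] by (metis (no_types, lifting) empty_iff)
  obtain c0 z where c0: "c0 \<in> C" and z: "z \<in> Y" "z \<notin> C" using C by blast
  have CY: "C \<subseteq> Y" and Csc: "\<And>x y. x \<in> C \<Longrightarrow> y \<in> C \<Longrightarrow> (x, y) \<in> (R \<inter> C \<times> C)\<^sup>*"
    using C by (auto simp: strongly_connected_def)
  \<comment> \<open>Paths in \<open>r\<close> that start in \<open>C\<close> cannot have returned to \<open>C\<close> yet: \<open>F\<close> has no arcs to \<open>C\<close>.\<close>
  define F where "F = {v \<in> Y - C. \<forall>c\<in>C. (v, c) \<notin> R}"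
  define r where "r = R \<inter> Y \<times> F"
  define X where "X = {v. \<exists>c\<in>C. (c, v) \<in> r\<^sup>*}"
  have "w \<in> C \<union> F" if "(c, w) \<in> r\<^sup>*" "c \<in> C" for c w
    using that(1) by (rule rtranclE) (use that(2) in \<open>simp_all add: r_def\<close>)
  then have XCF: "X \<subseteq> C \<union> F" unfolding X_def by blast
  have CX: "C \<subseteq> X" by (auto simp: X_def)
  have "(z, c0) \<in> (R \<inter> Y \<times> Y)\<^sup>*" using Y z c0 CY by (auto simp: strongly_connected_def)
  then have "\<exists>v c. (v, c) \<in> R \<inter> Y \<times> Y \<and> v \<in> - C \<and> c \<notin> - C"
    by (rule rtrancl_leaves_set) (use z c0 in simp_all)
  then obtain v c where v: "(v, c) \<in> R \<inter> Y \<times> Y" "v \<in> - C" "c \<notin> - C" by blast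
  then have "v \<notin> X" using XCF by (auto simp: F_def)
  moreover have "(c0, v) \<in> (R \<inter> Y \<times> Y)\<^sup>*" using Y v c0 CY by (auto simp: strongly_connected_def)
  moreover have "c0 \<in> X" using c0 CX by blast
  ultimately obtain x p where xp: "(x, p) \<in> R \<inter> Y \<times> Y" "x \<in> X" "p \<notin> X"
    using rtrancl_leaves_set[of c0 v "R \<inter> Y \<times> Y" X] by blast
  have pC: "p \<notin> C" using xp CX by blast
  have pF: "p \<notin> F"
  proof
    assume "p \<in> F"
    then have "(x, p) \<in> r" using xp by (auto simp: r_def)
    then show False using xp by (auto simp: X_def intro: rtrancl_into_rtrancl)
  qed
  obtain q where q: "q \<in> C" "(p, q) \<in> R" using pC pF xp by (auto simp: F_def)
  \<comment> \<open>The interior of the ear, possibly formed by several paths with the same end \<open>x\<close>.\<close>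
  define P where "P = {v \<in> X \<inter> F. (v, x) \<in> r\<^sup>*}"
  define D where "D = C \<union> P"
  have D: "D \<subseteq> Y" "p \<notin> D" using CY pC pF by (auto simp: D_def P_def F_def)
  let ?D = "R \<inter> D \<times> D"
  have inD: "w \<in> D" if "w \<in> X" "(w, x) \<in> r\<^sup>*" for w using that XCF by (auto simp: D_def P_def)
  have from_C: "(c, w) \<in> ?D\<^sup>*" if "(c, w) \<in> r\<^sup>*" "c \<in> C" "(w, x) \<in> r\<^sup>*" for c w
    using that
  proof (induction rule: rtrancl_induct)
    case (step w w')
    have "(w, x) \<in> r\<^sup>*" using step by (meson converse_rtrancl_into_rtrancl)
    moreover have "w \<in> X" "w' \<in> X" using step by (auto simp: X_def intro: rtrancl_into_rtrancl)
    ultimately have "(w, w') \<in> ?D" using inD step by (auto simp: r_def)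
    then show ?case using step \<open>(w, x) \<in> r\<^sup>*\<close> by (meson rtrancl_into_rtrancl)
  qed auto
  have to_x: "(w, x) \<in> ?D\<^sup>*" if "(w, x) \<in> r\<^sup>*" "w \<in> X" for w
    using that
  proof (induction rule: converse_rtrancl_induct)
    case (step w w')
    have "w' \<in> X" using step by (auto simp: X_def intro: rtrancl_into_rtrancl)
    moreover have "(w, x) \<in> r\<^sup>*" using step by (meson converse_rtrancl_into_rtrancl)
    ultimately have "(w, w') \<in> ?D" using inD step by (auto simp: r_def)
    then show ?case using step \<open>w' \<in> X\<close> by (meson converse_rtrancl_into_rtrancl)
  qed auto
  have xD: "x \<in> D" using inD xp by blast
  have CD: "(c, c') \<in> ?D\<^sup>*" if "c \<in> C" "c' \<in> C" for c c'
    using Csc[OF that] by (rule rtrancl_mono[THEN subsetD, rotated]) (auto simp: D_def)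
  have reach: "(c, y) \<in> ?D\<^sup>*" if "y \<in> D" "c \<in> C" for c y
  proof (cases "y \<in> C")
    case True
    then show ?thesis using CD that by blast
  next
    case False
    then have "y \<in> X" "(y, x) \<in> r\<^sup>*" using that by (auto simp: D_def P_def)
    then obtain c' where "c' \<in> C" "(c', y) \<in> ?D\<^sup>*" using from_C by (auto simp: X_def)
    then show ?thesis using CD[OF that(2)] by (meson rtrancl_trans)
  qed
  let ?E = "R \<inter> insert p D \<times> insert p D"
  have DE: "?D\<^sup>* \<subseteq> ?E\<^sup>*" by (rule rtrancl_mono) auto
  have xpE: "(x, p) \<in> ?E" "(p, q) \<in> ?E" using xp xD q by (auto simp: D_def)
  have fromE: "(c0, y) \<in> ?E\<^sup>*" if "y \<in> insert p D" for y
  proof (cases "y = p")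
    case True
    have "(c0, x) \<in> ?E\<^sup>*" using reach[OF xD c0] DE by blast
    then show ?thesis using xpE True by (meson rtrancl_into_rtrancl)
  next
    case False
    then show ?thesis using that reach[OF _ c0] DE by blast
  qed
  have pc0: "(p, c0) \<in> ?E\<^sup>*" using xpE(2) CD[OF q(1) c0] DE by (meson converse_rtrancl_into_rtrancl subsetD)
  have toE: "(y, c0) \<in> ?E\<^sup>*" if y: "y \<in> insert p D" for y
  proof -
    consider "y = p" | "y \<in> C" | "y \<in> P" using y by (auto simp: D_def)
    then show ?thesis
    proof cases
      case 2
      then show ?thesis using CD[OF _ c0] DE by blast
    next
      case 3
      then have "(y, x) \<in> ?E\<^sup>*" using to_x DE by (auto simp: P_def)
      then show ?thesis using xpE(1) pc0 by (meson rtrancl_into_rtrancl rtrancl_trans)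
    qed (use pc0 in simp)
  qed
  have "strongly_connected R (insert p D)"
    unfolding strongly_connected_def using fromE toE by (meson rtrancl_trans)
  moreover have "C \<subset> insert p D" using pC by (auto simp: D_def)
  moreover have "insert p D \<subseteq> Y" using D xp by auto
  ultimately have "insert p D = Y" using max[of "insert p D"] by blast
  then have DY: "D = Y - {p}" using D by blast
  show ?thesis
  proof (rule that[of p q])
    show "p \<in> Y" "q \<in> Y" "(p, q) \<in> R" using xp q CY by auto
    show "p \<noteq> q" using q pC by auto
    show "(q, y) \<in> (R \<inter> (Y - {p}) \<times> (Y - {p}))\<^sup>*" if "y \<in> Y - {p}" for y
      using reach[of y q] that q unfolding DY by blast
  qed
qed

text \<open>In a minimal nonempty set that is closed under predecessors, the elements from which a given
  element can be reached form such a set again.\<close>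

lemma minimal_source_set:
  assumes "finite M" "m \<in> M" and R: "R \<subseteq> M \<times> M"
  obtains Y where "Y \<subseteq> M" "Y \<noteq> {}" "\<And>x y. (x, y) \<in> R \<Longrightarrow> y \<in> Y \<Longrightarrow> x \<in> Y" "strongly_connected R Y"
proof -
  let ?\<Y> = "{Y. Y \<subseteq> M \<and> Y \<noteq> {} \<and> (\<forall>x y. (x, y) \<in> R \<and> y \<in> Y \<longrightarrow> x \<in> Y)}"
  have "M \<in> ?\<Y>" using assms by auto
  moreover have "finite ?\<Y>" using \<open>finite M\<close> by (auto intro: finite_subset[of _ "Pow M"])
  ultimately obtain Y where Y: "Y \<in> ?\<Y>" and min: "\<And>Z. Z \<in> ?\<Y> \<Longrightarrow> Z \<subseteq> Y \<Longrightarrow> Z = Y"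
    using finite_has_minimal[of ?\<Y>] by (metis (no_types, lifting) empty_iff)
  have "strongly_connected R Y"
    unfolding strongly_connected_def
  proof (intro ballI)
    fix x y assume xy: "x \<in> Y" "y \<in> Y"
    let ?Z = "{z\<in>Y. (z, y) \<in> (R \<inter> Y \<times> Y)\<^sup>*}"
    have "u \<in> ?Z" if uv: "(u, v) \<in> R" "v \<in> ?Z" for u v
    proof -
      have "u \<in> Y" using Y uv by blast
      then show ?thesis using uv by (auto intro: converse_rtrancl_into_rtrancl)
    qed
    then have "?Z \<in> ?\<Y>" using Y xy by auto
    then have "?Z = Y" by (rule min) auto
    then show "(x, y) \<in> (R \<inter> Y \<times> Y)\<^sup>*" using xy by blast
  qed
  then show ?thesis using Y by (intro that[of Y]) auto
qed

section \<open>Decompositions as sets of arcs\<close>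

lemma adjacent_in_sym: "adjacent_in J a b \<longleftrightarrow> adjacent_in J b a"
  by (simp add: adjacent_in_def insert_commute)

lemma adjacent_in_verts: "simple_graph J \<Longrightarrow> adjacent_in J a b \<Longrightarrow> a \<in> verts J \<and> b \<in> verts J \<and> a \<noteq> b"
  unfolding simple_graph_def adjacent_in_def by fastforce

lemma adjacent_in_delete_edge: "adjacent_in (delete_edge J \<epsilon>) a b \<Longrightarrow> adjacent_in J a b"
  by (simp add: adjacent_in_def delete_edge_def)

lemma adjacent_in_explode_edge: "adjacent_in (explode_edge J p q) a b \<Longrightarrow> adjacent_in J a b"
  by (simp add: adjacent_in_def explode_edge_def)

text \<open>An edge of a bipartite graph is represented by its two ends, which the functions \<open>v1\<close> and \<open>v2\<close>
  select on the two sides. Nothing else about the bipartite graph matters for the induction.\<close>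

locale edge_ends =
  fixes v1 :: "'e \<Rightarrow> 'a" and v2 :: "'e \<Rightarrow> 'b"
begin

definition line_subgraph :: "('e, 'e set) mgraph \<Rightarrow> bool" where
  "line_subgraph J \<longleftrightarrow> simple_graph J \<and> (\<forall>a b. adjacent_in J a b \<longrightarrow> v1 a = v1 b \<or> v2 a = v2 b)"

lemma line_subgraph_delete_edge: "line_subgraph J \<Longrightarrow> line_subgraph (delete_edge J \<epsilon>)"
  unfolding line_subgraph_def using simple_graph_delete_edge adjacent_in_delete_edge by meson

lemma line_subgraph_explode_edge: "line_subgraph J \<Longrightarrow> line_subgraph (explode_edge J a b)"
  unfolding line_subgraph_def using simple_graph_explode_edge adjacent_in_explode_edge by meson

text \<open>The edges \<open>p\<close>, \<open>d\<close>, \<open>s\<close> form a path whose middle edge \<open>d\<close> is adjacent to both others. When \<open>p\<close> and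
  \<open>s\<close> are edges of the matching, this is read as an arc of a digraph on the matching: it leaves \<open>p\<close>
  at the end \<open>v2\<close> and enters \<open>s\<close> at the end \<open>v1\<close>.\<close>

definition arc :: "('e, 'e set) mgraph \<Rightarrow> 'e \<Rightarrow> 'e \<Rightarrow> 'e \<Rightarrow> bool" where
  "arc J p d s \<longleftrightarrow> p \<noteq> s \<and> v2 d = v2 p \<and> v1 d = v1 s \<and> adjacent_in J d p \<and> adjacent_in J d s"

text \<open>A CP-decomposition in terms of its edges. A path consists of an arc between its two matching edges,
  a 4-cycle of two opposite arcs. The interior vertices of the path \<open>(p, d, s)\<close> are the end \<open>v2 p\<close>
  of its tail and the end \<open>v1 s\<close> of its head.\<close>

inductive pairing :: "('e, 'e set) mgraph \<Rightarrow> 'e set \<Rightarrow> ('e \<times> 'e \<times> 'e) set \<Rightarrow> ('e \<times> 'e \<times> 'e \<times> 'e) set \<Rightarrow> bool"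
  for J where
  empty: "pairing J {} {} {}"
| path: "pairing J M T S \<Longrightarrow> p \<notin> M \<Longrightarrow> s \<notin> M \<Longrightarrow> arc J p d s \<Longrightarrow>
    pairing J (insert p (insert s M)) (insert (p, d, s) T) S"
| cycle: "pairing J M T S \<Longrightarrow> p \<notin> M \<Longrightarrow> s \<notin> M \<Longrightarrow> arc J p d s \<Longrightarrow> arc J s c p \<Longrightarrow>
    pairing J (insert p (insert s M)) T (insert (p, d, s, c) S)"

text \<open>The two ways in which an edge can satisfy the covering condition: to be at home in a path, or to be
  spanned by the four vertices of a 4-cycle and hence to be parallel to one of its edges.\<close>

definition covered :: "('e, 'e set) mgraph \<Rightarrow> ('e \<times> 'e \<times> 'e) set \<Rightarrow> ('e \<times> 'e \<times> 'e \<times> 'e) set \<Rightarrow> 'e \<Rightarrow> bool" where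
  "covered J T S e \<longleftrightarrow>
     (\<exists>p d s. (p, d, s) \<in> T \<and> (v2 e = v2 p \<or> v1 e = v1 s) \<and>
        (adjacent_in J e p \<or> adjacent_in J e d \<or> adjacent_in J e s)) \<or>
     (\<exists>p d s c. (p, d, s, c) \<in> S \<and> (v1 e = v1 p \<or> v1 e = v1 s) \<and> (v2 e = v2 p \<or> v2 e = v2 s))"

definition decomposable :: "('e, 'e set) mgraph \<Rightarrow> 'e set \<Rightarrow> bool" where
  "decomposable J M \<longleftrightarrow> (\<exists>T S. pairing J M T S \<and> (\<forall>e\<in>verts J. covered J T S e))"

lemma arc_mono: "arc J p d s \<Longrightarrow> (\<And>a b. adjacent_in J a b \<Longrightarrow> adjacent_in J' a b) \<Longrightarrow> arc J' p d s"
  by (auto simp: arc_def)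

lemma pairing_mono:
  "pairing J M T S \<Longrightarrow> (\<And>a b. adjacent_in J a b \<Longrightarrow> adjacent_in J' a b) \<Longrightarrow> pairing J' M T S"
  by (induction rule: pairing.induct) (auto intro: pairing.intros arc_mono)

lemma covered_mono:
  assumes "covered J T S e" "\<And>a b. adjacent_in J a b \<Longrightarrow> adjacent_in J' a b" "T \<subseteq> T'" "S \<subseteq> S'"
  shows "covered J' T' S' e"
  using assms unfolding covered_def by (meson subsetD)

definition tails :: "('e \<times> 'e \<times> 'e) set \<Rightarrow> 'e set" where
  "tails T = {p. \<exists>d s. (p, d, s) \<in> T}"

definition heads :: "('e \<times> 'e \<times> 'e) set \<Rightarrow> 'e set" where
  "heads T = {s. \<exists>p d. (p, d, s) \<in> T}"

definition cyclic :: "('e \<times> 'e \<times> 'e \<times> 'e) set \<Rightarrow> 'e set" where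
  "cyclic S = {x. \<exists>p d s c. (p, d, s, c) \<in> S \<and> (x = p \<or> x = s)}"

lemma parts_simps [simp]:
  "tails {} = {}" "heads {} = {}" "cyclic {} = {}"
  "tails (insert (p, d, s) T) = insert p (tails T)"
  "heads (insert (p, d, s) T) = insert s (heads T)"
  "cyclic (insert (p, d, s, c) S) = insert p (insert s (cyclic S))"
  by (auto simp: tails_def heads_def cyclic_def)

lemma pairing_parts:
  assumes "pairing J M T S"
  shows "finite M \<and> even (card M) \<and> M = tails T \<union> heads T \<union> cyclic S \<and>
    tails T \<inter> heads T = {} \<and> tails T \<inter> cyclic S = {} \<and> heads T \<inter> cyclic S = {}"
  using assms by induction (auto simp: arc_def)

lemma pairing_path_arc: "pairing J M T S \<Longrightarrow> (p, d, s) \<in> T \<Longrightarrow> arc J p d s"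
  by (induction rule: pairing.induct) auto

lemma pairing_cycle_arc: "pairing J M T S \<Longrightarrow> (p, d, s, c) \<in> S \<Longrightarrow> arc J p d s \<and> arc J s c p"
  by (induction rule: pairing.induct) auto

lemma decomposable_even: "decomposable J M \<Longrightarrow> even (card M)"
  using pairing_parts by (auto simp: decomposable_def)

text \<open>Adding an edge to \<open>J\<close> only creates adjacencies, so deletable edges are harmless in the induction.\<close>

lemma decomposable_delete_edge:
  assumes "decomposable (delete_edge J \<epsilon>) M"
  shows "decomposable J M"
proof -
  obtain T S where "pairing (delete_edge J \<epsilon>) M T S" "\<forall>e\<in>verts J. covered (delete_edge J \<epsilon>) T S e"
    using assms by (auto simp: decomposable_def delete_edge_def)
  then have "pairing J M T S" "\<forall>e\<in>verts J. covered J T S e"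
    using pairing_mono covered_mono adjacent_in_delete_edge by (metis, metis order_refl)
  then show ?thesis by (auto simp: decomposable_def)
qed

end


section \<open>Minimal counterexamples\<close>

text \<open>The situation that remains in a minimal counterexample: no edge of \<open>J\<close> is deletable, so each one is
  explodable and the induction applies to what remains after its explosion, with respect to any part
  of the matching that survives and is large enough for the drop of the connectedness by one.\<close>

locale minimal_counterexample = edge_ends v1 v2 for v1 :: "'e \<Rightarrow> 'a" and v2 :: "'e \<Rightarrow> 'b" +
  fixes J :: "('e, 'e set) mgraph" and M :: "'e set"
  assumes J: "line_subgraph J"
    and inj1: "inj_on v1 M" and inj2: "inj_on v2 M" and MJ: "M \<subseteq> verts J"
    and card_M: "2 \<le> card M"
    and no_isolated: "\<And>m. m \<in> M \<Longrightarrow> \<exists>b. adjacent_in J b m"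
    and explodable: "\<And>a b M'. adjacent_in J a b \<Longrightarrow> M' \<subseteq> M \<inter> far_verts J a b \<Longrightarrow>
      card M div 2 \<le> card M' div 2 + 1 \<Longrightarrow> decomposable (explode_edge J a b) M'"
    and not_decomposable: "\<not> decomposable J M"
begin

lemma fin_M: "finite M"
  using card_M by (metis card.infinite not_numeral_le_zero)

lemma sg: "simple_graph J"
  using J by (simp add: line_subgraph_def)

lemma eq1: "a \<in> M \<Longrightarrow> b \<in> M \<Longrightarrow> v1 a = v1 b \<Longrightarrow> a = b"
  using inj1 by (auto dest: inj_onD)

lemma eq2: "a \<in> M \<Longrightarrow> b \<in> M \<Longrightarrow> v2 a = v2 b \<Longrightarrow> a = b"
  using inj2 by (auto dest: inj_onD)

lemma adj_share: "adjacent_in J a b \<Longrightarrow> v1 a = v1 b \<or> v2 a = v2 b"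
  using J by (simp add: line_subgraph_def)

lemma adj_ne: "adjacent_in J a b \<Longrightarrow> a \<noteq> b \<and> a \<in> verts J \<and> b \<in> verts J"
  using adjacent_in_verts[OF sg] by blast

lemma M_not_adj: "a \<in> M \<Longrightarrow> b \<in> M \<Longrightarrow> \<not> adjacent_in J a b"
  using adj_share adj_ne eq1 eq2 by blast

text \<open>If \<open>d\<close> were adjacent to no other matching edge, exploding the edge \<open>md\<close> would kill only \<open>m\<close>. Then
  there would be decompositions with respect to matchings of size \<open>card M - 1\<close> and \<open>card M - 2\<close>,
  but decompositions exist only for matchings of even size. So \<open>d\<close> is adjacent to a second matching
  edge, which \<open>d\<close> meets at its other end.\<close>

lemma neighbour_is_arc:
  assumes d: "adjacent_in J d m" and m: "m \<in> M"
  shows "\<exists>s\<in>M. arc J m d s \<or> arc J s d m"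
proof -
  have dM: "d \<notin> M" using M_not_adj d m by blast
  have "\<exists>s\<in>M. s \<noteq> m \<and> adjacent_in J d s"
  proof (rule ccontr)
    assume *: "\<not> (\<exists>s\<in>M. s \<noteq> m \<and> adjacent_in J d s)"
    then have far: "M - {m} \<subseteq> far_verts J m d"
      using MJ dM M_not_adj m by (auto simp: far_verts_def)
    have md: "adjacent_in J m d" using d adjacent_in_sym by metis
    have c1: "card (M - {m}) = card M - 1" using m by simp
    have "decomposable (explode_edge J m d) (M - {m})"
      using far c1 by (intro explodable md) auto
    then have 1: "even (card M - 1)" using decomposable_even c1 by metis
    have "M - {m} \<noteq> {}" using c1 card_M by (metis card.empty diff_is_0_eq not_less_eq_eq numeral_2_eq_2 One_nat_def)
    then obtain x where x: "x \<in> M - {m}" by blast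
    then have c2: "card (M - {m} - {x}) = card M - 2" using c1 by simp
    have "decomposable (explode_edge J m d) (M - {m} - {x})"
      using far c2 card_M by (intro explodable md) auto
    then have "even (card M - 2)" using decomposable_even c2 by metis
    then show False using 1 card_M by presburger
  qed
  then obtain s where s: "s \<in> M" "s \<noteq> m" "adjacent_in J d s" by blast
  then have "v1 s \<noteq> v1 m" "v2 s \<noteq> v2 m" using eq1 eq2 m by blast+
  then have "arc J m d s \<or> arc J s d m"
    using adj_share[OF d] adj_share[OF s(3)] d s by (auto simp: arc_def)
  then show ?thesis using s(1) by blast
qed

lemma decomposition_after_explosion:
  assumes "adjacent_in J a b" "p \<in> M" "s \<in> M" "p \<noteq> s"
    and far: "M - {p, s} \<subseteq> far_verts J a b"
  obtains T S where "pairing J (M - {p, s}) T S" "\<And>e. e \<in> far_verts J a b \<Longrightarrow> covered J T S e"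
proof -
  have "card (M - {p, s}) = card M - 2" using assms(2-4) fin_M by simp
  then have "decomposable (explode_edge J a b) (M - {p, s})"
    using far card_M by (intro explodable assms(1)) auto
  then obtain T S where TS: "pairing (explode_edge J a b) (M - {p, s}) T S"
      "\<forall>e\<in>far_verts J a b. covered (explode_edge J a b) T S e"
    by (auto simp: decomposable_def explode_edge_def)
  show ?thesis
  proof (rule that[of T S])
    show "pairing J (M - {p, s}) T S" using pairing_mono[OF TS(1)] adjacent_in_explode_edge by metis
    show "covered J T S e" if "e \<in> far_verts J a b" for e
      using covered_mono[OF TS(2)[rule_format, OF that]] adjacent_in_explode_edge by (metis order_refl)
  qed
qed

definition arcs :: "'e rel" where
  "arcs = {(p, s). p \<in> M \<and> s \<in> M \<and> (\<exists>d. arc J p d s)}"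

lemma arc_verts: "arc J p d s \<Longrightarrow> d \<in> verts J"
  using adj_ne by (auto simp: arc_def)

lemma arc_notin_M: "arc J p d s \<Longrightarrow> p \<in> M \<Longrightarrow> d \<notin> M"
  using M_not_adj by (auto simp: arc_def)

text \<open>Among the matching edges, exploding the tail \<open>p\<close> of an arc together with its middle edge \<open>d\<close> kills
  just \<open>p\<close> and the head \<open>s\<close>.\<close>

lemma tail_explosion:
  assumes a: "arc J p d s" and p: "p \<in> M" and s: "s \<in> M"
  obtains T S where "pairing J (M - {p, s}) T S" "\<And>e. e \<in> far_verts J p d \<Longrightarrow> covered J T S e"
proof -
  have "M - {p, s} \<subseteq> far_verts J p d"
  proof
    fix m assume m: "m \<in> M - {p, s}"
    then have ne: "v1 m \<noteq> v1 s" "v2 m \<noteq> v2 p" using eq1 eq2 p s by blast+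
    have "\<not> adjacent_in J d m" using adj_share[of d m] ne a by (auto simp: arc_def)
    then show "m \<in> far_verts J p d"
      using m MJ M_not_adj[OF p] arc_notin_M[OF a p] by (auto simp: far_verts_def)
  qed
  moreover have "adjacent_in J p d" "p \<noteq> s" using a adjacent_in_sym[of J d p] by (auto simp: arc_def)
  ultimately show ?thesis using decomposition_after_explosion p s that by metis
qed

text \<open>The middle edge of an arc from \<open>g\<close> to \<open>t\<close> survives the explosion and has to be covered afterwards.
  It is at home in a path only if it meets \<open>t\<close> as the head or \<open>g\<close> as the tail of this path. Here
  \<open>g = s\<close> is allowed; as \<open>s\<close> is in no piece, all arcs from \<open>s\<close> then lead to heads or back to \<open>p\<close>.\<close>

lemma surviving_arc:
  assumes a: "arc J p d s" and p: "p \<in> M" and s: "s \<in> M"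
    and TS: "pairing J (M - {p, s}) T S" "\<And>e. e \<in> far_verts J p d \<Longrightarrow> covered J T S e"
    and gt: "(g, t) \<in> arcs" "g \<noteq> p" "t \<noteq> p" "t \<noteq> s"
  shows "t \<in> heads T \<or> g \<in> tails T \<or> t \<in> cyclic S \<and> g \<in> cyclic S"
proof -
  obtain e where e: "arc J g e t" and g: "g \<in> M" and t: "t \<in> M" using gt by (auto simp: arcs_def)
  have M: "M - {p, s} = tails T \<union> heads T \<union> cyclic S" using pairing_parts[OF TS(1)] by blast
  have ne: "v1 t \<noteq> v1 s" "v1 t \<noteq> v1 p" "v2 g \<noteq> v2 p" using eq1 eq2 g t p s gt by blast+
  have "\<not> adjacent_in J p e" using adj_share[of p e] ne e by (auto simp: arc_def)
  moreover have "\<not> adjacent_in J d e" using adj_share[of d e] ne e a by (auto simp: arc_def)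
  moreover have "e \<noteq> p" "e \<noteq> d" using ne e a by (auto simp: arc_def)
  ultimately have "e \<in> far_verts J p d" using arc_verts[OF e] by (simp add: far_verts_def)
  then consider p' d' s' where "(p', d', s') \<in> T" "v2 e = v2 p' \<or> v1 e = v1 s'"
    | p' d' s' c' where "(p', d', s', c') \<in> S" "v1 e = v1 p' \<or> v1 e = v1 s'" "v2 e = v2 p' \<or> v2 e = v2 s'"
    using TS(2)[of e] unfolding covered_def by blast
  then show ?thesis
  proof cases
    case 1
    then have "p' \<in> tails T" "s' \<in> heads T" by (auto simp: tails_def heads_def)
    then have "p' \<in> M" "s' \<in> M" using M by blast+
    then have "g = p' \<or> t = s'" using 1 e g t eq1 eq2 by (auto simp: arc_def)
    then show ?thesis using \<open>p' \<in> tails T\<close> \<open>s' \<in> heads T\<close> by blast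
  next
    case 2
    then have c: "p' \<in> cyclic S" "s' \<in> cyclic S" by (auto simp: cyclic_def)
    then have "p' \<in> M" "s' \<in> M" using M by blast+
    then have "(g = p' \<or> g = s') \<and> (t = p' \<or> t = s')" using 2 e g t eq1 eq2 by (auto simp: arc_def)
    then show ?thesis using c by blast
  qed
qed

text \<open>Otherwise adding the path \<open>(p, d, s)\<close> gives a decomposition of \<open>J\<close>. The killed edges that are not
  obviously at home in the new path are those adjacent to \<open>p\<close> at its end \<open>v1 p\<close>. Such an edge is
  the middle edge of an arc that enters \<open>p\<close> from a tail, and it is at home in the path of this tail.\<close>

lemma obstructing_arc:
  assumes a: "arc J p d s" and p: "p \<in> M" and s: "s \<in> M"
    and TS: "pairing J (M - {p, s}) T S" "\<And>e. e \<in> far_verts J p d \<Longrightarrow> covered J T S e"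
  shows "\<exists>r. (r, p) \<in> arcs \<and> r \<notin> tails T"
proof (rule ccontr)
  assume *: "\<nexists>r. (r, p) \<in> arcs \<and> r \<notin> tails T"
  have ps: "p \<noteq> s" using a by (simp add: arc_def)
  let ?T = "insert (p, d, s) T"
  have "insert p (insert s (M - {p, s})) = M" using p s by blast
  then have pair: "pairing J M ?T S" using pairing.path[OF TS(1) _ _ a] by simp
  have "covered J ?T S e" if e: "e \<in> verts J" for e
  proof (cases "e \<in> far_verts J p d")
    case True
    then show ?thesis using TS(2) covered_mono by blast
  next
    case False
    then consider "e = p" | "e = d" | "adjacent_in J e d" | "adjacent_in J e p"
      using e adjacent_in_sym by (fastforce simp: far_verts_def)
    then show ?thesis
    proof cases
      case 1
      then have "adjacent_in J e d" using a adjacent_in_sym[of J d p] by (auto simp: arc_def)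
      then show ?thesis using 1 unfolding covered_def by blast
    next
      case 2
      then show ?thesis using a unfolding covered_def arc_def by blast
    next
      case 3
      then have "v2 e = v2 p \<or> v1 e = v1 s" using adj_share[OF 3] a by (auto simp: arc_def)
      then show ?thesis using 3 unfolding covered_def by blast
    next
      case 4
      then obtain r where r: "r \<in> M" "arc J p e r \<or> arc J r e p" using neighbour_is_arc[OF 4 p] by blast
      show ?thesis
      proof (cases "arc J p e r")
        case True
        then have "v2 e = v2 p" by (simp add: arc_def)
        then show ?thesis using 4 unfolding covered_def by blast
      next
        case False
        then have arc: "arc J r e p" using r by blast
        then have "(r, p) \<in> arcs" using r p by (auto simp: arcs_def)
        then have "r \<in> tails T" using * by blast
        then obtain h b where "(r, h, b) \<in> ?T" by (auto simp: tails_def)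
        moreover have "v2 e = v2 r" "adjacent_in J e r" using arc by (auto simp: arc_def)
        ultimately show ?thesis unfolding covered_def by blast
      qed
    qed
  qed
  then show False using pair not_decomposable by (auto simp: decomposable_def)
qed

lemma arcs_irrefl: "(p, p) \<notin> arcs"
  by (auto simp: arcs_def arc_def)

lemma arcs_subset: "arcs \<subseteq> M \<times> M"
  by (auto simp: arcs_def)

lemma tails_heads_cyclic_pred:
  assumes "pairing J (M - {p, s}) T S"
  shows "t \<in> heads T \<Longrightarrow> \<exists>g\<in>tails T. (g, t) \<in> arcs"
    and "t \<in> cyclic S \<Longrightarrow> \<exists>g\<in>cyclic S. (g, t) \<in> arcs"
proof -
  note parts = pairing_parts[OF assms]
  show "\<exists>g\<in>tails T. (g, t) \<in> arcs" if t: "t \<in> heads T"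
  proof -
    obtain g d where gd: "(g, d, t) \<in> T" using t by (auto simp: heads_def)
    then have "g \<in> tails T" by (auto simp: tails_def)
    moreover have "arc J g d t" using pairing_path_arc[OF assms gd] .
    moreover have "g \<in> M" "t \<in> M" using parts t \<open>g \<in> tails T\<close> by blast+
    ultimately show ?thesis by (auto simp: arcs_def)
  qed
  show "\<exists>g\<in>cyclic S. (g, t) \<in> arcs" if t: "t \<in> cyclic S"
  proof -
    obtain a d b c where abcd: "(a, d, b, c) \<in> S" "t = a \<or> t = b" using t by (auto simp: cyclic_def)
    then have ab: "a \<in> cyclic S" "b \<in> cyclic S" by (auto simp: cyclic_def)
    moreover have "a \<in> M" "b \<in> M" using parts ab by blast+
    moreover have "arc J a d b" "arc J b c a" using pairing_cycle_arc[OF assms abcd(1)] by blast+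
    ultimately show ?thesis using abcd(2) by (auto simp: arcs_def)
  qed
qed

lemma has_in_arc:
  assumes m: "m \<in> M"
  shows "\<exists>r. (r, m) \<in> arcs"
proof -
  obtain b where "adjacent_in J b m" using no_isolated[OF m] by blast
  then obtain s where s: "s \<in> M" "arc J m b s \<or> arc J s b m" using neighbour_is_arc m by blast
  show ?thesis
  proof (cases "arc J m b s")
    case True
    obtain T S where "pairing J (M - {m, s}) T S" "\<And>e. e \<in> far_verts J m b \<Longrightarrow> covered J T S e"
      using tail_explosion[OF True m s(1)] by blast
    then show ?thesis using obstructing_arc[OF True m s(1)] by blast
  next
    case False
    then show ?thesis using s m by (auto simp: arcs_def)
  qed
qed

text \<open>Choose a minimal nonempty predecessor-closed set \<open>Y\<close> and an arc \<open>(p, q)\<close> of \<open>Y\<close> such that \<open>Y - {p}\<close> can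
  be reached from \<open>q\<close> without \<open>p\<close>, and explode at the tail \<open>p\<close>. Arcs from \<open>q\<close> and from heads lead
  to heads only, so all of \<open>Y - {p, q}\<close> consists of heads. But each head has a tail as a predecessor,
  which lies in \<open>Y\<close> again and is not a head. So \<open>Y = {p, q}\<close>.\<close>

lemma source_two_cycle:
  obtains p q where "(p, q) \<in> arcs" "(q, p) \<in> arcs"
    "\<And>r. (r, p) \<in> arcs \<Longrightarrow> r = q" "\<And>r. (r, q) \<in> arcs \<Longrightarrow> r = p"
proof -
  obtain m where "m \<in> M" using card_M by fastforce
  then obtain Y where Y: "Y \<subseteq> M" "Y \<noteq> {}" "\<And>x y. (x, y) \<in> arcs \<Longrightarrow> y \<in> Y \<Longrightarrow> x \<in> Y"
      "strongly_connected arcs Y"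
    using minimal_source_set[OF fin_M _ arcs_subset] by metis
  obtain a where a: "a \<in> Y" using Y by blast
  obtain b where b: "(b, a) \<in> arcs" using has_in_arc a Y by blast
  then have "b \<in> Y" "a \<noteq> b" using Y(3) a arcs_irrefl by blast+
  then obtain p q where pq: "p \<in> Y" "q \<in> Y" "(p, q) \<in> arcs" "p \<noteq> q"
    and reach: "\<And>y. y \<in> Y - {p} \<Longrightarrow> (q, y) \<in> (arcs \<inter> (Y - {p}) \<times> (Y - {p}))\<^sup>*"
    using strongly_connected_ear[OF finite_subset[OF Y(1) fin_M] Y(4) a] by metis
  then obtain d where d: "arc J p d q" and pM: "p \<in> M" and qM: "q \<in> M" by (auto simp: arcs_def)
  obtain T S where TS: "pairing J (M - {p, q}) T S" "\<And>e. e \<in> far_verts J p d \<Longrightarrow> covered J T S e"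
    using tail_explosion[OF d pM qM] by blast
  note parts = pairing_parts[OF TS(1)]
  have heads: "y = q \<or> y \<in> heads T" if "y \<in> Y - {p}" for y
    using reach[OF that]
  proof (induction rule: rtrancl_induct)
    case (step g t)
    show ?case
    proof (cases "t = q")
      case False
      have "t \<in> heads T \<or> g \<in> tails T \<or> t \<in> cyclic S \<and> g \<in> cyclic S"
        using surviving_arc[OF d pM qM TS, of g t] step False by blast
      moreover have "q \<notin> tails T \<union> cyclic S" using parts by blast
      ultimately show ?thesis using step.IH parts by blast
    qed simp
  qed simp
  have Ypq: "Y = {p, q}"
  proof (rule ccontr)
    assume "Y \<noteq> {p, q}"
    then obtain y where y: "y \<in> Y" "y \<noteq> p" "y \<noteq> q" using pq by blast
    then have "y \<in> heads T" using heads by blast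
    then obtain g where g: "g \<in> tails T" "(g, y) \<in> arcs" using tails_heads_cyclic_pred[OF TS(1)] by blast
    then have "g \<in> Y" using Y(3) y by blast
    moreover have "g \<noteq> p" "g \<noteq> q" "g \<notin> heads T" using g parts by blast+
    ultimately show False using heads by blast
  qed
  have in_p: "r = q" if "(r, p) \<in> arcs" for r using Y(3)[OF that] arcs_irrefl that Ypq by blast
  have in_q: "r = p" if "(r, q) \<in> arcs" for r using Y(3)[OF that] arcs_irrefl that Ypq by blast
  have "(q, p) \<in> arcs" using has_in_arc[OF pM] in_p by blast
  then show ?thesis using that pq(3) in_p in_q by blast
qed

text \<open>Explode an arc from \<open>p\<close> to another edge \<open>s\<close> at its tail. The predecessor \<open>q\<close> of \<open>p\<close> is then not a
  tail, by the previous obstruction, so it is a head or on a 4-cycle. In both cases \<open>q\<close> has a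
  predecessor among the surviving matching edges, although \<open>p\<close> is its only predecessor.\<close>

lemma source_two_cycle_closed:
  assumes "(p, q) \<in> arcs" "\<And>r. (r, p) \<in> arcs \<Longrightarrow> r = q" "\<And>r. (r, q) \<in> arcs \<Longrightarrow> r = p" "(p, s) \<in> arcs"
  shows "s = q"
proof (rule ccontr)
  assume sq: "s \<noteq> q"
  obtain d where d: "arc J p d s" and pM: "p \<in> M" and sM: "s \<in> M" using assms(4) by (auto simp: arcs_def)
  obtain T S where TS: "pairing J (M - {p, s}) T S" "\<And>e. e \<in> far_verts J p d \<Longrightarrow> covered J T S e"
    using tail_explosion[OF d pM sM] by blast
  note parts = pairing_parts[OF TS(1)]
  have "q \<notin> tails T" using obstructing_arc[OF d pM sM TS] assms(2) by blast
  moreover have "q \<in> M - {p, s}" using assms(1) sq arcs_irrefl arcs_subset by auto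
  ultimately have "q \<in> heads T \<union> cyclic S" using parts by blast
  then obtain g where "g \<in> tails T \<union> cyclic S" "(g, q) \<in> arcs" using tails_heads_cyclic_pred[OF TS(1)] by blast
  then show False using assms(3) parts by blast
qed

text \<open>The matching edges \<open>p\<close> and \<open>q\<close> of an isolated 2-cycle form a 4-cycle with the middle edges \<open>d\<close> and
  \<open>c\<close> of the two arcs, and adding it to the decomposition after the explosion of \<open>pd\<close> gives a
  decomposition of \<open>J\<close>. All neighbours of \<open>p\<close> are spanned by the 4-cycle. If a neighbour \<open>e\<close> of \<open>d\<close>
  were not, exploding \<open>ed\<close> would kill just \<open>p\<close> and \<open>q\<close> of the matching and leave \<open>c\<close>, whose ends
  lie on \<open>p\<close> and \<open>q\<close> and so on no piece of the decomposition after that explosion.\<close>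

lemma no_minimal_counterexample: False
proof -
  obtain p q where pq: "(p, q) \<in> arcs" "(q, p) \<in> arcs"
    and in_p: "\<And>r. (r, p) \<in> arcs \<Longrightarrow> r = q" and in_q: "\<And>r. (r, q) \<in> arcs \<Longrightarrow> r = p"
    using source_two_cycle by metis
  have out_p: "s = q" if "(p, s) \<in> arcs" for s using source_two_cycle_closed[OF pq(1) in_p in_q that] .
  have out_q: "s = p" if "(q, s) \<in> arcs" for s using source_two_cycle_closed[OF pq(2) in_q in_p that] .
  obtain d c where d: "arc J p d q" and c: "arc J q c p" and p: "p \<in> M" and q: "q \<in> M"
    using pq by (auto simp: arcs_def)
  have pq_ne: "p \<noteq> q" "v1 p \<noteq> v1 q" "v2 p \<noteq> v2 q" using d eq1 eq2 p q by (auto simp: arc_def)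
  obtain T S where TS: "pairing J (M - {p, q}) T S" "\<And>e. e \<in> far_verts J p d \<Longrightarrow> covered J T S e"
    using tail_explosion[OF d p q] by blast
  let ?S = "insert (p, d, q, c) S"
  have "insert p (insert q (M - {p, q})) = M" using p q by blast
  then have pair: "pairing J M T ?S" using pairing.cycle[OF TS(1) _ _ d c] by simp
  have new: "covered J T ?S e" if "v1 e = v1 p \<or> v1 e = v1 q" "v2 e = v2 p \<or> v2 e = v2 q" for e
    using that unfolding covered_def by blast
  have nbr_p: "covered J T ?S e" if e: "adjacent_in J e p" for e
  proof -
    obtain r where "r \<in> M" "arc J p e r \<or> arc J r e p" using neighbour_is_arc[OF e p] by blast
    then have "arc J p e q \<or> arc J q e p" using in_p out_p p by (auto simp: arcs_def)
    then show ?thesis by (intro new) (auto simp: arc_def)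
  qed
  have nbr_q: "covered J T ?S e" if e: "adjacent_in J e q" for e
  proof -
    obtain r where "r \<in> M" "arc J q e r \<or> arc J r e q" using neighbour_is_arc[OF e q] by blast
    then have "arc J p e q \<or> arc J q e p" using in_q out_q q by (auto simp: arcs_def)
    then show ?thesis by (intro new) (auto simp: arc_def)
  qed
  have nbr_M: "e \<in> M \<Longrightarrow> adjacent_in J e d \<Longrightarrow> e = p \<or> e = q" for e
    using adj_share[of e d] d eq1[OF _ q] eq2[OF _ p] by (auto simp: arc_def)
  have nbr_d: "covered J T ?S e" if e: "adjacent_in J e d" for e
  proof (rule ccontr)
    assume not: "\<not> covered J T ?S e"
    have eM: "e \<notin> M" using nbr_M e not new by blast
    \<comment> \<open>A matching edge adjacent to \<open>e\<close> comes with a second one at the other end of \<open>e\<close>. As \<open>e\<close> meets \<open>d\<close>,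
      one of the two is \<open>p\<close> or \<open>q\<close>, whose neighbours are all covered.\<close>
    have e_nbr: "m \<in> M \<Longrightarrow> \<not> adjacent_in J e m" for m
    proof
      assume m: "m \<in> M" "adjacent_in J e m"
      obtain r where r: "r \<in> M" "arc J m e r \<or> arc J r e m" using neighbour_is_arc[OF m(2,1)] by blast
      have "m \<noteq> p" "m \<noteq> q" "r \<noteq> p" "r \<noteq> q"
        using not nbr_p nbr_q m(2) r by (auto simp: arc_def)
      moreover have "v2 e = v2 p \<or> v1 e = v1 q" using adj_share[OF e] d by (auto simp: arc_def)
      ultimately show False using r m p q eq1 eq2 by (auto simp: arc_def)
    qed
    have far: "M - {p, q} \<subseteq> far_verts J e d"
      using MJ eM e_nbr nbr_M arc_notin_M[OF d p] adjacent_in_sym by (fastforce simp: far_verts_def)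
    obtain T' S' where TS': "pairing J (M - {p, q}) T' S'" "\<And>x. x \<in> far_verts J e d \<Longrightarrow> covered J T' S' x"
      using decomposition_after_explosion[OF e p q pq_ne(1) far] by blast
    have cv: "v2 c = v2 q" "v1 c = v1 p" "v2 d = v2 p" "v1 d = v1 q" using c d by (auto simp: arc_def)
    have "\<not> adjacent_in J d c" "c \<noteq> d" using adj_share[of d c] cv pq_ne by auto
    moreover have "\<not> adjacent_in J e c" "c \<noteq> e"
      using adj_share[of e c] adj_share[OF e] cv not new pq_ne by auto
    ultimately have "c \<in> far_verts J e d" using arc_verts[OF c] by (simp add: far_verts_def)
    then have "covered J T' S' c" by (rule TS')
    then obtain m where "m \<in> tails T' \<union> heads T' \<union> cyclic S'" "v1 c = v1 m \<or> v2 c = v2 m"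
      unfolding covered_def tails_def heads_def cyclic_def by blast
    then have "m \<in> M - {p, q}" "v1 p = v1 m \<or> v2 q = v2 m" using pairing_parts[OF TS'(1)] cv by auto
    then show False using eq1 eq2 p q by blast
  qed
  have "covered J T ?S e" if e: "e \<in> verts J" for e
  proof (cases "e \<in> far_verts J p d")
    case True
    then show ?thesis using TS(2) covered_mono by blast
  next
    case False
    then consider "e = p" | "e = d" | "adjacent_in J e d" | "adjacent_in J e p"
      using e adjacent_in_sym by (fastforce simp: far_verts_def)
    then show ?thesis
    proof cases
      case 2
      then show ?thesis using d by (intro new) (auto simp: arc_def)
    qed (use nbr_d nbr_p new in blast)+
  qed
  then show False using pair not_decomposable by (auto simp: decomposable_def)
qed

end

context edge_ends
begin

text \<open>If the complex of \<open>J\<close> is not \<open>k\<close>-connected but becomes so when an edge is deleted, then by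
  Meshulam's theorem the complex after the explosion of this edge is not \<open>(k - 1)\<close>-connected. So the
  induction hypothesis applies after the deletion or after the explosion.\<close>

theorem decomposable_if_not_connected:
  assumes "line_subgraph J" "inj_on v1 M" "inj_on v2 M" "M \<subseteq> verts J"
    and "\<not> k_connected (int (card M div 2) - 1) (geometric_realization (independence_complex J))"
  shows "decomposable J M"
  using assms
proof (induction "card (verts J) + card (edges J)" arbitrary: J M rule: less_induct)
  case less
  let ?conn = "\<lambda>k J. k_connected k (geometric_realization (independence_complex J))"
  let ?k = "int (card M div 2) - 1"
  have sg: "simple_graph J" using less.prems(1) by (simp add: line_subgraph_def)
  have finV: "finite (verts J)" using sg by (simp add: simple_graph_def)
  have finE: "finite (edges J)"
    using sg finV by (auto simp: simple_graph_def intro: finite_subset[of _ "Pow (verts J)"])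
  have finM: "finite M" using less.prems(4) finV finite_subset by blast
  show ?case
  proof (cases "card M \<le> 1")
    case True
    then have k: "?k = - 1" by simp
    \<comment> \<open>The hypothesis now says that the complex is empty.\<close>
    have "verts J = {}"
    proof (rule ccontr)
      assume "verts J \<noteq> {}"
      then obtain w where w: "w \<in> verts J" by blast
      have "topspace (geometric_realization (independence_complex J)) \<noteq> {}"
      proof -
        have "{w} \<in> independence_complex J"
          unfolding independence_complex_iff[OF sg]
        proof (intro conjI ballI notI)
          fix \<epsilon> assume "\<epsilon> \<in> edges J" "\<epsilon> \<subseteq> {w}"
          then have "card \<epsilon> \<le> 1" "card \<epsilon> = 2" using card_mono[of "{w}" \<epsilon>] sg by (auto simp: simple_graph_def)
          then show False by simp
        qed (use w in simp)
        then have "(\<lambda>v. if v = w then 1 else 0) \<in> realization (independence_complex J)"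
          by (simp add: realization_def)
        then show ?thesis unfolding geometric_realization_eq by auto
      qed
      then show False using less.prems(5) k k_connected_minus_1 by metis
    qed
    then have "M = {}" using less.prems(4) by simp
    then show ?thesis using \<open>verts J = {}\<close> pairing.empty by (auto simp: decomposable_def)
  next
    case False
    show ?thesis
    proof (rule ccontr)
      assume nd: "\<not> decomposable J M"
      have "minimal_counterexample v1 v2 J M"
      proof
        show "\<exists>b. adjacent_in J b m" if "m \<in> M" for m
          using k_connected_isolated_vertex[OF sg, of m ?k] less.prems(4,5) that by auto
        fix a b M'
        assume ab: "adjacent_in J a b" and M': "M' \<subseteq> M \<inter> far_verts J a b" "card M div 2 \<le> card M' div 2 + 1"
        have abJ: "{a, b} \<in> edges J" "a \<in> verts J" using ab adjacent_in_verts[OF sg ab] by (auto simp: adjacent_in_def)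
        have "?conn ?k (delete_edge J {a, b})"
        proof (rule ccontr)
          assume "\<not> ?conn ?k (delete_edge J {a, b})"
          moreover have "line_subgraph (delete_edge J {a, b})"
            using line_subgraph_delete_edge[OF less.prems(1)] .
          moreover have "card (verts (delete_edge J {a, b})) + card (edges (delete_edge J {a, b}))
              < card (verts J) + card (edges J)"
            using card_Diff1_less[OF finE abJ(1)] by (simp add: delete_edge_def)
          moreover have "M \<subseteq> verts (delete_edge J {a, b})" using less.prems(4) by (simp add: delete_edge_def)
          ultimately have "decomposable (delete_edge J {a, b}) M" using less.hyps less.prems(2,3) by blast
          then show False using nd decomposable_delete_edge by blast
        qed
        then have "\<not> ?conn (?k - 1) (explode_edge J a b)"
          using meshulam[OF sg ab, of ?k] less.prems(5) False by fastforce
        then have "\<not> ?conn (int (card M' div 2) - 1) (explode_edge J a b)"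
          using k_connected_mono[of "int (card M' div 2) - 1" _ "?k - 1"] M'(2) by fastforce
        moreover have "line_subgraph (explode_edge J a b)"
          using line_subgraph_explode_edge[OF less.prems(1)] .
        moreover have "card (verts (explode_edge J a b)) + card (edges (explode_edge J a b))
              < card (verts J) + card (edges J)"
        proof (rule add_less_le_mono)
          show "card (verts (explode_edge J a b)) < card (verts J)"
            using abJ(2) by (intro psubset_card_mono finV) (auto simp: explode_edge_def far_verts_def)
          show "card (edges (explode_edge J a b)) \<le> card (edges J)"
            by (intro card_mono finE) (auto simp: explode_edge_def)
        qed
        moreover have "M' \<subseteq> verts (explode_edge J a b)" using M'(1) by (simp add: explode_edge_def)
        moreover have "inj_on v1 M'" "inj_on v2 M'"
          using less.prems(2,3) M'(1) by (auto intro: inj_on_subset)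
        ultimately show "decomposable (explode_edge J a b) M'" using less.hyps by blast
      qed (use less.prems nd False in auto)
      then show False by (rule minimal_counterexample.no_minimal_counterexample)
    qed
  qed
qed

end

section \<open>From arcs to subgraphs\<close>

text \<open>The dictionary between the ends of edges and the actual subgraphs of \<open>G\<close>.\<close>

locale bipartite_line = edge_ends v1 v2 for v1 v2 :: "'e \<Rightarrow> 'v" +
  fixes G :: "('v, 'e) mgraph" and J :: "('e, 'e set) mgraph" and M :: "'e set"
  assumes ends_eq: "\<And>e. e \<in> edges G \<Longrightarrow> ends G e = {v1 e, v2 e}"
    and ends_verts: "\<And>e. e \<in> edges G \<Longrightarrow> ends G e \<subseteq> verts G"
    and sides: "\<And>e f. e \<in> edges G \<Longrightarrow> f \<in> edges G \<Longrightarrow> v1 e \<noteq> v2 f"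
    and JG: "verts J \<subseteq> edges G" and J: "line_subgraph J"
    and MJ: "M \<subseteq> verts J" and matching_M: "matching G M"
begin

definition path_piece :: "'e \<times> 'e \<times> 'e \<Rightarrow> ('v, 'e) mgraph" where
  "path_piece = (\<lambda>(p, d, s). \<lparr>verts = ends G p \<union> ends G s, edges = {p, d, s}, ends = ends G\<rparr>)"

definition cycle_piece :: "'e \<times> 'e \<times> 'e \<times> 'e \<Rightarrow> ('v, 'e) mgraph" where
  "cycle_piece = (\<lambda>(p, d, s, c). \<lparr>verts = ends G p \<union> ends G s, edges = {p, d, s, c}, ends = ends G\<rparr>)"

lemma M_edges: "M \<subseteq> edges G"
  using MJ JG by blast

lemma M_disjoint: "a \<in> M \<Longrightarrow> b \<in> M \<Longrightarrow> a \<noteq> b \<Longrightarrow> ends G a \<inter> ends G b = {}"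
  using matching_M by (auto simp: matching_def disjoint_family_on_def)

lemma M_ends_distinct: "a \<in> M \<Longrightarrow> b \<in> M \<Longrightarrow> a \<noteq> b \<Longrightarrow> v1 a \<noteq> v1 b \<and> v2 a \<noteq> v2 b"
  using M_disjoint[of a b] ends_eq M_edges by auto

lemma arc_facts:
  assumes "arc J p d s" "p \<in> M" "s \<in> M"
  shows "p \<in> edges G" "s \<in> edges G" "d \<in> edges G" "ends G p = {v1 p, v2 p}" "ends G s = {v1 s, v2 s}"
    "ends G d = {v1 s, v2 p}" "p \<noteq> s" "v1 p \<noteq> v1 s" "v2 p \<noteq> v2 s" "d \<noteq> p" "d \<noteq> s" "d \<notin> M"
    "v1 p \<noteq> v2 p" "v1 p \<noteq> v2 s" "v1 s \<noteq> v2 p" "v1 s \<noteq> v2 s"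
    "adjacent_in J d p" "adjacent_in J d s" "adjacent_in J p d" "adjacent_in J s d" "d \<in> verts J"
proof -
  have sg: "simple_graph J" using J by (simp add: line_subgraph_def)
  show 1: "p \<noteq> s" "adjacent_in J d p" "adjacent_in J d s" using assms(1) by (auto simp: arc_def)
  then show "adjacent_in J p d" "adjacent_in J s d" using adjacent_in_sym by metis+
  show dJ: "d \<in> verts J" "d \<noteq> p" "d \<noteq> s" using adjacent_in_verts[OF sg] 1 by blast+
  show E: "p \<in> edges G" "s \<in> edges G" "d \<in> edges G" using M_edges assms dJ JG by auto
  show "ends G p = {v1 p, v2 p}" "ends G s = {v1 s, v2 s}" "ends G d = {v1 s, v2 p}"
    using E ends_eq assms(1) by (auto simp: arc_def)
  show "v1 p \<noteq> v1 s" "v2 p \<noteq> v2 s" using M_ends_distinct assms 1 by blast+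
  show "d \<notin> M" using M_ends_distinct[of d p] assms dJ by (auto simp: arc_def)
  show "v1 p \<noteq> v2 p" "v1 p \<noteq> v2 s" "v1 s \<noteq> v2 p" "v1 s \<noteq> v2 s" using sides E by auto
qed

lemma path_graph_4: "path_graph 4 = \<lparr>verts = {0, 1, 2, 3}, edges = {{0, 1}, {1, 2}, {2, 3}}, ends = id\<rparr>"
proof -
  have "{i. Suc i < 4} = {..<3}" by auto
  then have "{{i, Suc i} | i. Suc i < 4} = (\<lambda>i. {i, Suc i}) ` {..<3}" by (simp only: setcompr_eq_image)
  also have "{..<3} = {0, 1, 2 :: nat}" by auto
  finally have "{{i, Suc i} | i. Suc i < 4} = {{0, 1}, {1, 2}, {2, 3}}" by (simp add: numeral_2_eq_2 numeral_3_eq_3)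
  moreover have "{..<4} = {0, 1, 2, 3 :: nat}" by auto
  ultimately show ?thesis by (simp add: path_graph_def)
qed

lemma cycle_graph_4:
  "cycle_graph 4 = \<lparr>verts = {0, 1, 2, 3}, edges = {{0, 1}, {1, 2}, {2, 3}, {3, 0}}, ends = id\<rparr>"
proof -
  have 4: "{..<4} = {0, 1, 2, 3 :: nat}" by auto
  have "{{i, Suc i mod 4} | i. i < 4} = (\<lambda>i. {i, Suc i mod 4}) ` {..<4}"
    by (simp only: setcompr_eq_image lessThan_def)
  also have "\<dots> = {{0, 1}, {1, 2}, {2, 3}, {3, 0}}"
  proof -
    have "Suc 0 mod 4 = 1" "Suc 1 mod 4 = 2" "Suc 2 mod 4 = 3" "Suc 3 mod 4 = 0" by simp_all
    then show ?thesis unfolding 4 by (simp only: image_insert image_empty)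
  qed
  finally show ?thesis using 4 by (simp add: cycle_graph_def)
qed

lemma path_piece_facts:
  assumes a: "arc J p d s" "p \<in> M" "s \<in> M"
  shows "subgraph (path_piece (p, d, s)) G" "isomorphic_graphs (path_piece (p, d, s)) (path_graph 4)"
    "card (edges (path_piece (p, d, s)) \<inter> M) = 2" "intersecting_edges_adjacent G J (path_piece (p, d, s))"
    "v2 p \<in> interior_verts (path_piece (p, d, s))" "v1 s \<in> interior_verts (path_piece (p, d, s))"
proof -
  note f = arc_facts[OF a]
  show "subgraph (path_piece (p, d, s)) G"
    using ends_verts[OF f(1)] ends_verts[OF f(2)] f by (auto simp: subgraph_def path_piece_def)
  show "isomorphic_graphs (path_piece (p, d, s)) (path_graph 4)"
    unfolding isomorphic_graphs_def
  proof (intro exI conjI)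
    \<comment> \<open>The path visits \<open>v1 p\<close>, \<open>v2 p\<close>, \<open>v1 s\<close>, \<open>v2 s\<close> in this order.\<close>
    let ?\<phi> = "\<lambda>x. if x = v1 p then 0 else if x = v2 p then 1 else if x = v1 s then 2 else (3::nat)"
    let ?\<psi> = "\<lambda>e. if e = p then {0, 1} else if e = d then {1, 2} else {2, 3 :: nat}"
    show "bij_betw ?\<phi> (verts (path_piece (p, d, s))) (verts (path_graph 4))"
      using f by (auto simp: bij_betw_def inj_on_def path_piece_def path_graph_4)
    show "bij_betw ?\<psi> (edges (path_piece (p, d, s))) (edges (path_graph 4))"
      using f by (auto simp: bij_betw_def inj_on_def path_piece_def path_graph_4 doubleton_eq_iff)
    show "\<forall>e\<in>edges (path_piece (p, d, s)). ends (path_graph 4) (?\<psi> e) = ?\<phi> ` ends (path_piece (p, d, s)) e"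
      using f by (auto simp: path_piece_def path_graph_4)
  qed
  have "edges (path_piece (p, d, s)) \<inter> M = {p, s}" using f a by (auto simp: path_piece_def)
  then show "card (edges (path_piece (p, d, s)) \<inter> M) = 2" using f by simp
  show "intersecting_edges_adjacent G J (path_piece (p, d, s))"
    using f by (auto simp: intersecting_edges_adjacent_def path_piece_def)
  have "{e \<in> {p, d, s}. v2 p \<in> ends G e} = {p, d}" "{e \<in> {p, d, s}. v1 s \<in> ends G e} = {d, s}"
    using f by auto
  then show "v2 p \<in> interior_verts (path_piece (p, d, s))" "v1 s \<in> interior_verts (path_piece (p, d, s))"
    using f by (simp_all add: interior_verts_def path_piece_def)
qed

lemma cycle_piece_facts:
  assumes a: "arc J p d s" "arc J s c p" "p \<in> M" "s \<in> M"
  shows "subgraph (cycle_piece (p, d, s, c)) G" "isomorphic_graphs (cycle_piece (p, d, s, c)) (cycle_graph 4)"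
    "card (edges (cycle_piece (p, d, s, c)) \<inter> M) = 2"
    "intersecting_edges_adjacent G J (cycle_piece (p, d, s, c))"
proof -
  note f = arc_facts[OF a(1,3,4)] and h = arc_facts[OF a(2,4,3)]
  have dc: "d \<noteq> c" using a f by (auto simp: arc_def)
  show "subgraph (cycle_piece (p, d, s, c)) G"
    using ends_verts[OF f(1)] ends_verts[OF f(2)] f h by (auto simp: subgraph_def cycle_piece_def)
  show "isomorphic_graphs (cycle_piece (p, d, s, c)) (cycle_graph 4)"
    unfolding isomorphic_graphs_def
  proof (intro exI conjI)
    let ?\<phi> = "\<lambda>x. if x = v1 p then 0 else if x = v2 p then 1 else if x = v1 s then 2 else (3::nat)"
    let ?\<psi> = "\<lambda>e. if e = p then {0, 1} else if e = d then {1, 2} else if e = s then {2, 3} else {3, 0 :: nat}"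
    show "bij_betw ?\<phi> (verts (cycle_piece (p, d, s, c))) (verts (cycle_graph 4))"
      using f h by (auto simp: bij_betw_def inj_on_def cycle_piece_def cycle_graph_4)
    show "bij_betw ?\<psi> (edges (cycle_piece (p, d, s, c))) (edges (cycle_graph 4))"
      using f h dc by (auto simp: bij_betw_def inj_on_def cycle_piece_def cycle_graph_4 doubleton_eq_iff)
    show "\<forall>e\<in>edges (cycle_piece (p, d, s, c)).
        ends (cycle_graph 4) (?\<psi> e) = ?\<phi> ` ends (cycle_piece (p, d, s, c)) e"
      using f h dc by (auto simp: cycle_piece_def cycle_graph_4)
  qed
  have "edges (cycle_piece (p, d, s, c)) \<inter> M = {p, s}" using f h a by (auto simp: cycle_piece_def)
  then show "card (edges (cycle_piece (p, d, s, c)) \<inter> M) = 2" using f by simp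
  show "intersecting_edges_adjacent G J (cycle_piece (p, d, s, c))"
    using f h by (auto simp: intersecting_edges_adjacent_def cycle_piece_def)
qed

text \<open>A piece has the same vertices as its two matching edges. So the pieces inherit their disjointness
  from the matching, and distinct entries of the pairing give distinct pieces.\<close>

lemma pairing_pieces:
  assumes "pairing J N T S" "N \<subseteq> M"
  defines "P \<equiv> cycle_piece ` S \<union> path_piece ` T"
  shows "finite P \<and> card N = 2 * card P \<and> disjoint_family_on verts P \<and> (\<Union>H\<in>P. verts H) = \<Union> (ends G ` N)"
  using assms(1,2) unfolding P_def
proof induction
  case (path N T S p s d)
  let ?P = "cycle_piece ` S \<union> path_piece ` T" and ?H = "path_piece (p, d, s)"
  have IH: "finite ?P" "card N = 2 * card ?P" "disjoint_family_on verts ?P"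
      "(\<Union>H\<in>?P. verts H) = \<Union> (ends G ` N)" using path by auto
  note f = arc_facts[OF path(4)]
  have "verts ?H \<inter> ends G x = {}" if "x \<in> N" for x
  proof -
    have "x \<noteq> p" "x \<noteq> s" "x \<in> M" "p \<in> M" "s \<in> M" using that path by auto
    then show ?thesis using M_disjoint[of x p] M_disjoint[of x s] by (auto simp: path_piece_def)
  qed
  then have "verts ?H \<inter> (\<Union>H\<in>?P. verts H) = {}" unfolding IH(4) by blast
  moreover have "verts ?H \<noteq> {}" using f path.prems by (auto simp: path_piece_def)
  ultimately have "?H \<notin> ?P" and "disjoint_family_on verts (insert ?H ?P)"
    using IH(3) by (blast, subst disjoint_family_on_insert, blast+)
  moreover have "cycle_piece ` S \<union> path_piece ` insert (p, d, s) T = insert ?H ?P" by simp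
  moreover have "card (insert p (insert s N)) = Suc (Suc (card N))"
  proof -
    have "finite N" "p \<notin> insert s N" "s \<notin> N"
      using path.hyps path.prems f(7) pairing_parts[OF path(1)] by blast+
    then show ?thesis by simp
  qed
  moreover have "(\<Union>H\<in>insert ?H ?P. verts H) = \<Union> (ends G ` insert p (insert s N))"
    using IH(4) by (simp add: path_piece_def Un_assoc)
  ultimately show ?case using IH(1,2) by simp
next
  case (cycle N T S p s d c)
  let ?P = "cycle_piece ` S \<union> path_piece ` T" and ?H = "cycle_piece (p, d, s, c)"
  have IH: "finite ?P" "card N = 2 * card ?P" "disjoint_family_on verts ?P"
      "(\<Union>H\<in>?P. verts H) = \<Union> (ends G ` N)" using cycle by auto
  note f = arc_facts[OF cycle(4)]
  have "verts ?H \<inter> ends G x = {}" if "x \<in> N" for x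
  proof -
    have "x \<noteq> p" "x \<noteq> s" "x \<in> M" "p \<in> M" "s \<in> M" using that cycle by auto
    then show ?thesis using M_disjoint[of x p] M_disjoint[of x s] by (auto simp: cycle_piece_def)
  qed
  then have "verts ?H \<inter> (\<Union>H\<in>?P. verts H) = {}" unfolding IH(4) by blast
  moreover have "verts ?H \<noteq> {}" using f cycle.prems by (auto simp: cycle_piece_def)
  ultimately have "?H \<notin> ?P" and "disjoint_family_on verts (insert ?H ?P)"
    using IH(3) by (blast, subst disjoint_family_on_insert, blast+)
  moreover have "cycle_piece ` insert (p, d, s, c) S \<union> path_piece ` T = insert ?H ?P" by simp
  moreover have "card (insert p (insert s N)) = Suc (Suc (card N))"
  proof -
    have "finite N" "p \<notin> insert s N" "s \<notin> N"
      using cycle.hyps cycle.prems f(7) pairing_parts[OF cycle(1)] by blast+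
    then show ?thesis by simp
  qed
  moreover have "(\<Union>H\<in>insert ?H ?P. verts H) = \<Union> (ends G ` insert p (insert s N))"
    using IH(4) by (simp add: cycle_piece_def Un_assoc)
  ultimately show ?case using IH(1,2) by simp
qed (simp add: disjoint_family_on_def)

lemma decomposable_imp_CP_decomposition:
  assumes "decomposable J M"
  shows "has_CP_decomposition G J M"
proof -
  obtain T S where TS: "pairing J M T S" and cov: "\<And>e. e \<in> verts J \<Longrightarrow> covered J T S e"
    using assms by (auto simp: decomposable_def)
  have parts: "M = tails T \<union> heads T \<union> cyclic S" using pairing_parts[OF TS] by blast
  have T: "arc J p d s \<and> p \<in> M \<and> s \<in> M" if "(p, d, s) \<in> T" for p d s
  proof -
    have "p \<in> tails T" "s \<in> heads T" using that unfolding tails_def heads_def by blast+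
    then show ?thesis using pairing_path_arc[OF TS that] parts by blast
  qed
  have S: "arc J p d s \<and> arc J s c p \<and> p \<in> M \<and> s \<in> M" if "(p, d, s, c) \<in> S" for p d s c
  proof -
    have "p \<in> cyclic S" "s \<in> cyclic S" using that unfolding cyclic_def by blast+
    then show ?thesis using pairing_cycle_arc[OF TS that] parts by blast
  qed
  have cover: "(\<exists>H\<in>cycle_piece ` S. \<exists>f\<in>edges H. parallel_edges G e f) \<or> (\<exists>H\<in>path_piece ` T. at_home G J e H)"
    if e: "e \<in> verts J" for e
  proof -
    have eG: "e \<in> edges G" using e JG by blast
    consider p d s where "(p, d, s) \<in> T" "v2 e = v2 p \<or> v1 e = v1 s"
        "adjacent_in J e p \<or> adjacent_in J e d \<or> adjacent_in J e s"
      | p d s c where "(p, d, s, c) \<in> S" "v1 e = v1 p \<or> v1 e = v1 s" "v2 e = v2 p \<or> v2 e = v2 s"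
      using cov[OF e] unfolding covered_def by blast
    then show ?thesis
    proof cases
      case 1
      note f = path_piece_facts[of p d s]
      have "ends G e \<inter> interior_verts (path_piece (p, d, s)) \<noteq> {}"
        using f(5,6) T[OF 1(1)] 1(2) ends_eq[OF eG] by auto
      moreover have "\<exists>f\<in>edges (path_piece (p, d, s)). adjacent_in J e f"
        using 1(3) by (auto simp: path_piece_def)
      ultimately have "at_home G J e (path_piece (p, d, s))"
        using f(1,2) T[OF 1(1)] e by (simp add: at_home_def)
      then show ?thesis using 1(1) by blast
    next
      case 2
      have a: "arc J p d s" "arc J s c p" "p \<in> M" "s \<in> M" using S[OF 2(1)] by auto
      note f = arc_facts[OF a(1,3,4)] and h = arc_facts[OF a(2,4,3)]
      have "\<exists>f\<in>{p, d, s, c}. parallel_edges G e f"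
      proof -
        have "ends G e = {v1 e, v2 e}" "ends G d = {v1 s, v2 p}" "ends G c = {v1 p, v2 s}"
          using ends_eq[OF eG] f(6) h(6) by simp_all
        then show ?thesis
          using 2(2,3) f(1-5) h(3) eG unfolding parallel_edges_def by (elim disjE) simp_all
      qed
      then have "\<exists>f\<in>edges (cycle_piece (p, d, s, c)). parallel_edges G e f" by (simp add: cycle_piece_def)
      then show ?thesis using 2(1) by blast
    qed
  qed
  note pieces = pairing_pieces[OF TS order_refl]
  have sub: "subgraph H G" if "H \<in> cycle_piece ` S \<union> path_piece ` T" for H
    using that by (elim UnE imageE) (auto intro!: cycle_piece_facts(1) path_piece_facts(1) dest: S T)
  have cyc: "isomorphic_graphs H (cycle_graph 4) \<and> card (edges H \<inter> M) = 2 \<and> intersecting_edges_adjacent G J H"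
    if H: "H \<in> cycle_piece ` S" for H
  proof -
    obtain p d s c where "(p, d, s, c) \<in> S" "H = cycle_piece (p, d, s, c)" using H by auto
    then show ?thesis using cycle_piece_facts[of p d s c] S[of p d s c] by simp
  qed
  have pth: "isomorphic_graphs H (path_graph 4) \<and> card (edges H \<inter> M) = 2 \<and> intersecting_edges_adjacent G J H"
    if H: "H \<in> path_piece ` T" for H
  proof -
    obtain p d s where "(p, d, s) \<in> T" "H = path_piece (p, d, s)" using H by auto
    then show ?thesis using path_piece_facts[of p d s] T[of p d s] by simp
  qed
  let ?P = "cycle_piece ` S \<union> path_piece ` T"
  have "CP_decomposition G J M (card ?P) (cycle_piece ` S) (path_piece ` T)"
    unfolding CP_decomposition_def
  proof (intro conjI)
    show "card M = 2 * card ?P" "finite ?P" "disjoint_family_on verts ?P" using pieces by blast+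
    show "\<forall>H\<in>?P. subgraph H G" using sub by (rule ballI)
    show "\<forall>H\<in>cycle_piece ` S. isomorphic_graphs H (cycle_graph 4) \<and> card (edges H \<inter> M) = 2 \<and>
        intersecting_edges_adjacent G J H" using cyc by (rule ballI)
    show "\<forall>H\<in>path_piece ` T. isomorphic_graphs H (path_graph 4) \<and> card (edges H \<inter> M) = 2 \<and>
        intersecting_edges_adjacent G J H" using pth by (rule ballI)
    show "\<forall>e\<in>verts J. (\<exists>H\<in>cycle_piece ` S. \<exists>f\<in>edges H. parallel_edges G e f) \<or>
        (\<exists>H\<in>path_piece ` T. at_home G J e H)" using cover by (rule ballI)
  qed (rule MJ matching_M refl)+
  then show ?thesis unfolding has_CP_decomposition_def by blast
qed

end


theorem theorem3p3:
  fixes G :: "('v, 'e) mgraph" and J :: "('e, 'e set) mgraph" and M :: "'e set"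
  assumes "bipartite_graph G"
    and "subgraph J (line_graph G)"
    and "matching G M"
    and "M \<subseteq> verts J"
    and "graph_conn J \<le> ereal (real (card M) / 2 - 2)"
  shows "has_CP_decomposition G J M"
proof -
  have fg: "finite_graph G" using assms(1) by (simp add: bipartite_graph_def)
  obtain A B where AB: "A \<inter> B = {}" "\<forall>e\<in>edges G. \<exists>a\<in>A. \<exists>b\<in>B. ends G e = {a, b}"
    using assms(1) by (auto simp: bipartite_graph_def)
  define v1 where "v1 = (\<lambda>e. SOME a. a \<in> A \<and> (\<exists>b\<in>B. ends G e = {a, b}))"
  have v1: "v1 e \<in> A \<and> (\<exists>b\<in>B. ends G e = {v1 e, b})" if "e \<in> edges G" for e
    unfolding v1_def by (rule someI_ex) (use AB(2) that in blast)
  define v2 where "v2 = (\<lambda>e. SOME b. b \<in> B \<and> ends G e = {v1 e, b})"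
  have v2: "v2 e \<in> B \<and> ends G e = {v1 e, v2 e}" if "e \<in> edges G" for e
    unfolding v2_def by (rule someI_ex) (use v1[OF that] in blast)
  have sides: "v1 e \<noteq> v2 f" if "e \<in> edges G" "f \<in> edges G" for e f
    using v1[OF that(1)] v2[OF that(2)] AB(1) by auto
  interpret edge_ends v1 v2 .
  have J_sub: "verts J \<subseteq> edges G" "edges J \<subseteq> edges (line_graph G)" "ends J = id"
    using assms(2) by (simp_all add: subgraph_def line_graph_def)
  have J_edges: "\<epsilon> \<subseteq> verts J" if "\<epsilon> \<in> edges J" for \<epsilon>
    using assms(2) J_sub(3) that by (simp add: subgraph_def)
  have "line_subgraph J"
    unfolding line_subgraph_def simple_graph_def
  proof (intro conjI allI impI ballI)
    show "finite (verts J)" using J_sub(1) fg finite_subset by (auto simp: finite_graph_def)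
    show "card \<epsilon> = 2" if "\<epsilon> \<in> edges J" for \<epsilon> using J_sub(2) that by (auto simp: line_graph_def)
    fix a b assume "adjacent_in J a b"
    then have "{a, b} \<in> edges (line_graph G)" using J_sub(2) by (auto simp: adjacent_in_def)
    then have "a \<in> edges G" "b \<in> edges G" "ends G a \<inter> ends G b \<noteq> {}"
      by (auto simp: line_graph_def doubleton_eq_iff)
    then show "v1 a = v1 b \<or> v2 a = v2 b" using v2[of a] v2[of b] sides[of a b] sides[of b a] by auto
  next
    show "\<epsilon> \<subseteq> verts J" if "\<epsilon> \<in> edges J" for \<epsilon> using J_edges[OF that] .
  qed (rule J_sub(3))
  then interpret bipartite_line v1 v2 G J M
    using v2 sides J_sub(1) assms(3,4) fg by unfold_locales (auto simp: finite_graph_def)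
  have "inj_on v1 M" "inj_on v2 M" using M_ends_distinct by (auto simp: inj_on_def)
  \<comment> \<open>The least integer that exceeds \<open>card M / 2 - 2\<close> is \<open>card M div 2 - 1\<close>.\<close>
  moreover have "\<not> k_connected (int (card M div 2) - 1) (geometric_realization (independence_complex J))"
  proof
    assume "k_connected (int (card M div 2) - 1) (geometric_realization (independence_complex J))"
    then have "ereal (of_int (int (card M div 2) - 1)) \<le> graph_conn J"
      unfolding graph_conn_def by (subst le_conn_iff) auto
    then have "ereal (of_int (int (card M div 2) - 1)) \<le> ereal (real (card M) / 2 - 2)"
      using assms(5) by (rule order_trans)
    then have "real (card M div 2) \<le> real (card M) / 2 - 1" by simp
    moreover have "real (card M) \<le> 2 * real (card M div 2) + 1"
    proof -
      have "card M \<le> 2 * (card M div 2) + 1" by simp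
      then have "real (card M) \<le> real (2 * (card M div 2) + 1)" by (simp only: of_nat_le_iff)
      then show ?thesis by simp
    qed
    ultimately show False by simp
  qed
  ultimately have "decomposable J M"
    using decomposable_if_not_connected \<open>line_subgraph J\<close> assms(4) by blast
  then show ?thesis by (rule decomposable_imp_CP_decomposition)
qed

end
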